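(* Let $(v_l(0))_{l\ge1}$ be non-negative with $\sum_l v_l(0)=1$ and $\sum_l l^3v_l(0)<\infty$, let $C$ be the associated limiting tagged-cluster process, let $Y_t(z)=\mathbb{E}[z^{C_t}]$, and let $T_{gel}=\big(\sum_l l v_l(0)\big)^{-1}$. For $y>T_{gel}$ let $\psi_y$ be the characteristic curve defined in the context. Then for any $y>T_{gel}$ and $0\le s<y$, $$Y_s(\psi_y(s))=\mathbb{P}\big[C\text{ does not explode in }[s,y]\big]$$ and $\mathbb{P}[C\text{ explodes at time }y]=0$. Furthermore, $$\mathbb{P}\big[C\text{ explodes during }[0,T_{gel}]\big]=0 .$$
   Context: Here $\mathbb{N}=\{1,2,\dots\}$. Critical forest fire equations. Given $v_l(0)\ge0$ with $\sum_l v_l(0)=1$ and $\sum_l l^3v_l(0)<\infty$, it is known (Ráth–Tóth) that there is a unique solution $(v_k(t))_{k\ge1,\,t\ge0}$, with values in $[0,1]$ and each $v_k$ continuous, of $$\frac{dv_k(t)}{dt}=-kv_k(t)+\frac k2\sum_{l=1}^{k-1}v_l(t)v_{k-l}(t)\ \ (k\ge2),\qquad \sum_{l=1}^\infty v_l(t)=1\ \ (t\ge0).$$ Put $X_t(z)=\sum_{k\ge1}z^kv_k(t)$ for $z\in[0,1]$. Characteristic curves. For each $y>T_{gel}$, $\psi_y:[0,\infty)\to(0,1]$ is the unique continuous function with $\psi_y(t)=1$ for $t\ge y$, $\psi_y(t)<1$ for $t<y$, and $\frac{d}{dt}\psi_y(t)=\psi_y(t)\big(1-X_t(\psi_y(t))\big)$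 for $t>0$. State space $E$. $E=\mathbb{N}$ with the metric $d_E(i,j)=|f(i)-f(j)|$, where $f(1)=0$ and $f(i)=1/i$ for $i\ge2$. Thus $E$ is compact, $n\to1$ in $E$ as $n\to\infty$, and $1$ is the only non-isolated point. Process $C$. $C=(C_t)_{t\ge0}$ is the unique càdlàg $E$-valued strong Markov process such that: the law of $C_0$ is $k\mapsto v_k(0)$; $C$ jumps out of state $k$ at rate $k$, and when such a jump occurs at time $\tau$, then, conditionally on $\tau$, the value of $C$ increases by $L$, where $L$ has law $\mathbb{P}_\tau[L=l]=v_l(\tau)$. Explosion. $C$ explodes at the (random) time $t>0$ if $C_t=1$ and for some (random) $\epsilon>0$, $C_s\ne1$ for all $s\in(t-\epsilon,t)$; equivalently, $C$ makes infinitely many jumps in $(s,t)$ for every $s<t$. *)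

theory Defs
  imports "HOL-Probability.Probability"
begin

section \<open>Critical forest fire equations\<close>

text \<open>Component sizes are naturals \<open>\<ge> 1\<close>; the value of \<open>v 0\<close> is never used.\<close>

definition solves_forest_fire :: "(nat \<Rightarrow> real) \<Rightarrow> (nat \<Rightarrow> real \<Rightarrow> real) \<Rightarrow> bool" where
  "solves_forest_fire p v \<longleftrightarrow>
     (\<forall>k\<ge>1. v k 0 = p k) \<and>
     (\<forall>k\<ge>1. \<forall>t\<ge>0. v k t \<in> {0..1}) \<and>
     (\<forall>k\<ge>1. continuous_on {0..} (v k)) \<and>
     (\<forall>k\<ge>2. \<forall>t\<ge>0. (v k has_real_derivative
        - real k * v k t + real k / 2 * (\<Sum>l=1..k-1. v l t * v (k - l) t)) (at t within {0..})) \<and>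
     (\<forall>t\<ge>0. ((\<lambda>l. v l t) has_sum 1) {1..})"

definition unique_forest_fire_solution :: "(nat \<Rightarrow> real) \<Rightarrow> (nat \<Rightarrow> real \<Rightarrow> real) \<Rightarrow> bool" where
  "unique_forest_fire_solution p v \<longleftrightarrow>
     solves_forest_fire p v \<and>
     (\<forall>w. solves_forest_fire p w \<longrightarrow> (\<forall>k\<ge>1. \<forall>t\<ge>0. w k t = v k t))"

definition X_gf :: "(nat \<Rightarrow> real \<Rightarrow> real) \<Rightarrow> real \<Rightarrow> real \<Rightarrow> real" where
  "X_gf v t z = (\<Sum>\<^sub>\<infinity>k\<in>{1..}. z ^ k * v k t)"

definition T_gel :: "(nat \<Rightarrow> real) \<Rightarrow> real" where
  "T_gel p = inverse (\<Sum>\<^sub>\<infinity>l\<in>{1..}. real l * p l)"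


section \<open>Characteristic curves\<close>

definition is_characteristic :: "(nat \<Rightarrow> real \<Rightarrow> real) \<Rightarrow> real \<Rightarrow> (real \<Rightarrow> real) \<Rightarrow> bool" where
  "is_characteristic v y \<psi> \<longleftrightarrow>
     continuous_on {0..} \<psi> \<and>
     (\<forall>t\<ge>0. \<psi> t \<in> {0<..1}) \<and>
     (\<forall>t\<ge>0. t \<ge> y \<longrightarrow> \<psi> t = 1) \<and>
     (\<forall>t\<ge>0. t < y \<longrightarrow> \<psi> t < 1) \<and>
     (\<forall>t>0. (\<psi> has_real_derivative \<psi> t * (1 - X_gf v t (\<psi> t))) (at t))"

definition unique_characteristic :: "(nat \<Rightarrow> real \<Rightarrow> real) \<Rightarrow> real \<Rightarrow> (real \<Rightarrow> real) \<Rightarrow> bool" where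
  "unique_characteristic v y \<psi> \<longleftrightarrow>
     is_characteristic v y \<psi> \<and>
     (\<forall>\<phi>. is_characteristic v y \<phi> \<longrightarrow> (\<forall>t\<ge>0. \<phi> t = \<psi> t))"


section \<open>The state space\<close>

definition fE :: "nat \<Rightarrow> real" where
  "fE i = (if i = 1 then 0 else 1 / real i)"

definition dE :: "nat \<Rightarrow> nat \<Rightarrow> real" where
  "dE i j = \<bar>fE i - fE j\<bar>"

interpretation E: Metric_space "{1::nat..}" dE
proof
  show "dE x y = 0 \<longleftrightarrow> x = y" if "x \<in> {1..}" "y \<in> {1..}" for x y
    using that by (auto simp: dE_def fE_def)
qed (auto simp: dE_def)

definition cadlag_E :: "(real \<Rightarrow> nat) \<Rightarrow> bool" where
  "cadlag_E c \<longleftrightarrow>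
     (\<forall>t\<ge>0. limitin E.mtopology c (c t) (at_right t)) \<and>
     (\<forall>t>0. \<exists>i. limitin E.mtopology c i (at_left t))"


section \<open>The process \<open>C\<close>\<close>

text \<open>The index \<open>t\<close> ranges over all reals so that the library's notions for filtrations apply;
  for \<open>t < 0\<close> this is the trivial \<open>\<sigma>\<close>-algebra.\<close>

definition natural_filtration :: "'w measure \<Rightarrow> (real \<Rightarrow> 'w \<Rightarrow> nat) \<Rightarrow> real \<Rightarrow> 'w measure" where
  "natural_filtration M C t =
     sigma (space M) {C u -` B \<inter> space M | u B. 0 \<le> u \<and> u \<le> t}"

definition finite_stopping_time :: "'w measure \<Rightarrow> (real \<Rightarrow> 'w \<Rightarrow> nat) \<Rightarrow> ('w \<Rightarrow> real) \<Rightarrow> bool" where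
  "finite_stopping_time M C \<sigma> \<longleftrightarrow>
     stopping_time (natural_filtration M C) \<sigma> \<and> (\<forall>\<omega>\<in>space M. 0 \<le> \<sigma> \<omega>)"

abbreviation past :: "'w measure \<Rightarrow> (real \<Rightarrow> 'w \<Rightarrow> nat) \<Rightarrow> ('w \<Rightarrow> real) \<Rightarrow> 'w set set" where
  "past M C \<sigma> \<equiv> sets (filtration.pre_sigma (space M) (natural_filtration M C) \<sigma>)"

text \<open>\<open>q s i t\<close> is the transition law from state \<open>i\<close> at time \<open>s\<close> to time \<open>t\<close>. The equation says
  that the conditional law of \<open>C\<close> at time \<open>\<sigma> + h\<close> given the past at \<open>\<sigma>\<close> is
  \<open>q \<sigma> C\<^sub>\<sigma> (\<sigma> + h)\<close>; as \<open>\<sigma> + h\<close> is again a stopping time, iterating it yields the joint laws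
  at several times after \<open>\<sigma>\<close>.\<close>

definition strong_markov :: "'w measure \<Rightarrow> (real \<Rightarrow> 'w \<Rightarrow> nat) \<Rightarrow> bool" where
  "strong_markov M C \<longleftrightarrow>
     (\<exists>q :: real \<Rightarrow> nat \<Rightarrow> real \<Rightarrow> nat pmf.
        (\<forall>i h j. h \<ge> 0 \<longrightarrow> (\<lambda>s. pmf (q s i (s + h)) j) \<in> borel_measurable borel) \<and>
        (\<forall>\<sigma> h j A. finite_stopping_time M C \<sigma> \<longrightarrow> h \<ge> 0 \<longrightarrow> A \<in> past M C \<sigma> \<longrightarrow>
           measure M {\<omega> \<in> A. C (\<sigma> \<omega> + h) \<omega> = j} =
             (LINT \<omega>:A|M. pmf (q (\<sigma> \<omega>) (C (\<sigma> \<omega>) \<omega>) (\<sigma> \<omega> + h)) j)))"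

text \<open>The value \<open>s\<close> is a dummy: by \<open>holding\<close> below, almost surely every state is left.\<close>

definition next_jump :: "(real \<Rightarrow> 'w \<Rightarrow> nat) \<Rightarrow> real \<Rightarrow> 'w \<Rightarrow> real" where
  "next_jump C s \<omega> =
     (if \<exists>u>s. C u \<omega> \<noteq> C s \<omega> then Inf {u. s < u \<and> C u \<omega> \<noteq> C s \<omega>} else s)"

text \<open>Conditional probabilities given the past at a stopping time \<open>\<sigma>\<close> are expressed by
  integration over all events \<open>A\<close> of that past.
  \<^item> \<open>holding\<close>: given the past at \<open>\<sigma>\<close>, the remaining time in the state \<open>k = C\<^sub>\<sigma>\<close> is exponential
    with rate \<open>k\<close>.
  \<^item> \<open>increment\<close>: given the past at \<open>\<sigma>\<close> and the time \<open>\<tau>\<close> of the next jump, the increment equals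
    \<open>l\<close> with probability \<open>v l \<tau>\<close>.
  \<^item> \<open>accumulation\<close>: jumps happen only out of a state which the process has been holding. Where
    jump times accumulate from the left, the left limit in \<open>E\<close> is necessarily \<open>1\<close>, and the process
    is at \<open>1\<close> rather than jumping further at that very instant. The other conditions do not
    determine where the process is placed at the limit of its jump times.\<close>

locale tagged_cluster_process = prob_space M
  for v :: "nat \<Rightarrow> real \<Rightarrow> real" and M :: "'w measure" and C :: "real \<Rightarrow> 'w \<Rightarrow> nat" +
  assumes measurable_C: "t \<ge> 0 \<Longrightarrow> C t \<in> measurable M (count_space UNIV)"
    and state: "t \<ge> 0 \<Longrightarrow> \<omega> \<in> space M \<Longrightarrow> C t \<omega> \<ge> 1"
    and cadlag: "\<omega> \<in> space M \<Longrightarrow> cadlag_E (\<lambda>t. C t \<omega>)"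
    and accumulation: "\<omega> \<in> space M \<Longrightarrow> t > 0 \<Longrightarrow>
      (\<And>s. 0 \<le> s \<Longrightarrow> s < t \<Longrightarrow> \<not> (\<lambda>u. C u \<omega>) constant_on {s<..<t}) \<Longrightarrow> C t \<omega> = 1"
    and strong_markov: "strong_markov M C"
    and initial: "k \<ge> 1 \<Longrightarrow> \<P>(\<omega> in M. C 0 \<omega> = k) = v k 0"
    and holding: "finite_stopping_time M C \<sigma> \<Longrightarrow> A \<in> past M C \<sigma> \<Longrightarrow> h \<ge> 0 \<Longrightarrow>
      measure M {\<omega> \<in> A. \<forall>u\<in>{\<sigma> \<omega>..\<sigma> \<omega> + h}. C u \<omega> = C (\<sigma> \<omega>) \<omega>} =
        (LINT \<omega>:A|M. exp (- real (C (\<sigma> \<omega>) \<omega>) * h))"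
    and increment: "finite_stopping_time M C \<sigma> \<Longrightarrow> A \<in> past M C \<sigma> \<Longrightarrow> B \<in> sets borel \<Longrightarrow> l \<ge> 1 \<Longrightarrow>
      measure M {\<omega> \<in> A. next_jump C (\<sigma> \<omega>) \<omega> \<in> B \<and>
                        C (next_jump C (\<sigma> \<omega>) \<omega>) \<omega> = C (\<sigma> \<omega>) \<omega> + l} =
        (LINT \<omega>:A|M. indicat_real B (next_jump C (\<sigma> \<omega>) \<omega>) * v l (next_jump C (\<sigma> \<omega>) \<omega>))"

definition Y_gf :: "'w measure \<Rightarrow> (real \<Rightarrow> 'w \<Rightarrow> nat) \<Rightarrow> real \<Rightarrow> real \<Rightarrow> real" where
  "Y_gf M C t z = (LINT \<omega>|M. z ^ C t \<omega>)"

definition explodes_at :: "(real \<Rightarrow> 'w \<Rightarrow> nat) \<Rightarrow> 'w \<Rightarrow> real \<Rightarrow> bool" where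
  "explodes_at C \<omega> t \<longleftrightarrow>
     t > 0 \<and> C t \<omega> = 1 \<and> (\<exists>\<epsilon>>0. \<forall>s\<in>{t - \<epsilon><..<t}. s \<ge> 0 \<longrightarrow> C s \<omega> \<noteq> 1)"

definition explodes_during :: "(real \<Rightarrow> 'w \<Rightarrow> nat) \<Rightarrow> 'w \<Rightarrow> real set \<Rightarrow> bool" where
  "explodes_during C \<omega> I \<longleftrightarrow> (\<exists>t\<in>I. explodes_at C \<omega> t)"

end

theory Submission
  imports Defs
begin

text \<open>Along a characteristic curve \<open>\<phi> = \<psi>\<^sub>y\<close> the function \<open>\<phi>(t)^C\<^sub>t\<close> has zero drift, so its values at
  the successive jump times \<open>\<sigma>\<^sub>n\<close> of \<open>C\<close> after \<open>s\<close> have constant expectation \<open>Y\<^sub>s(\<phi>(s))\<close>. If the jump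
  times accumulate before \<open>y\<close>, then \<open>C\<close> tends to infinity while \<open>\<phi>\<close> stays away from 1, and the values tend
  to 0; if they pass \<open>y\<close>, the values equal 1. Hence \<open>Y\<^sub>s(\<psi>\<^sub>y(s))\<close> lies between the probabilities of no
  explosion in \<open>(s, y]\<close> and of no explosion in \<open>(s, a]\<close> for every \<open>a < y\<close>. Uniqueness of characteristics makes
  \<open>y \<mapsto> \<psi>\<^sub>y(s)\<close> continuous, which identifies \<open>Y\<^sub>s(\<psi>\<^sub>y(s))\<close> with the former probability and excludes
  explosions at a fixed time. Finally \<open>X\<^sub>t(\<psi>\<^sub>y(t))\<close> does not decrease in \<open>t\<close>, which bounds the time
  a characteristic needs to reach 1 from below and gives \<open>\<psi>\<^sub>y(0) \<rightarrow> 1\<close> as \<open>y\<close> decreases to \<open>T\<^sub>g\<^sub>e\<^sub>l\<close>.\<close>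

subsection \<open>Generating functions of the forest fire equations\<close>

text \<open>Zero drift is a single integration. Out of state k the waiting time is exponential with
  rate k and the increment of a jump at time t has generating function X_t. Started from state k at
  time a, the expectation after the jump is the integral of k exp(-k h) \<phi>(a+h)^k X(\<phi>(a+h))
  over h, and this integrand is the derivative of -exp(-k h) \<phi>(a+h)^k because \<phi>' = \<phi>
  (1 - X). The upper bound for Y stops at a < y, where \<phi>(a) < 1; it is carried to y itself by
  curves with later end points, for which y is an admissible a. A chain of jumps started at s cannot
  see an explosion at s, so both bounds concern half-open intervals. Closing them requires that no
  explosion occurs at s, and s may lie below the gelation time; hence the claim about [0, T_gel]
  enters the formula for Y. An explosion at y is always the first one after some rational s < y,
  since the path avoids 1 just before it. This is how continuity of the probabilities in y excludes
  fixed times.\<close>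

lemma sum_convolution:
  fixes a :: "nat \<Rightarrow> real"
  shows "(\<Sum>k=2..N. real k / 2 * (\<Sum>i=1..k-1. a i * a (k - i)))
       = (\<Sum>i=1..N. real i * a i * (\<Sum>j=1..N-i. a j))"
proof (induction N)
  case 0
  then show ?case by simp
next
  case (Suc N)
  \<comment> \<open>Exchanging i with \<open>Suc N - i\<close> turns the weight i into
    \<open>Suc N - i\<close>; the two weights add up to \<open>Suc N\<close>, which accounts for the
    factor 1/2 of the coagulation term.\<close>
  have halves: "real (Suc N) / 2 * (\<Sum>i=1..N. a i * a (Suc N - i)) = (\<Sum>i=1..N. real i * a i * a (Suc N - i))"
    (is "_ = ?R")
  proof -
    have 1: "?R = (\<Sum>i=1..N. real (Suc N - i) * a (Suc N - i) * a i)"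
      by (rule sum.reindex_bij_witness[of _ "\<lambda>i. Suc N - i" "\<lambda>i. Suc N - i"]) auto
    have "?R + ?R = (\<Sum>i=1..N. real i * a i * a (Suc N - i) + real (Suc N - i) * a (Suc N - i) * a i)"
      by (subst (2) 1) (simp only: sum.distrib)
    also have "\<dots> = (\<Sum>i=1..N. real (Suc N) * (a i * a (Suc N - i)))"
    proof (rule sum.cong)
      fix i assume "i \<in> {1..N}"
      then have "real (Suc N - i) = real (Suc N) - real i"
        by (intro of_nat_diff) auto
      then show "real i * a i * a (Suc N - i) + real (Suc N - i) * a (Suc N - i) * a i
          = real (Suc N) * (a i * a (Suc N - i))"
        by (simp only: ring_distribs mult_ac)
    qed simp
    also have "\<dots> = real (Suc N) * (\<Sum>i=1..N. a i * a (Suc N - i))"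
      by (rule sum_distrib_left[symmetric])
    finally have 2: "?R + ?R = real (Suc N) * (\<Sum>i=1..N. a i * a (Suc N - i))" .
    have "n / 2 * s = r" if "r + r = n * s" for n s r :: real
      using that by simp
    from this[OF 2] show ?thesis .
  qed
  have "(\<Sum>i=1..Suc N. real i * a i * (\<Sum>j=1..Suc N-i. a j))
      = (\<Sum>i=1..N. real i * a i * (\<Sum>j=1..Suc N-i. a j))"
    by simp
  also have "\<dots> = (\<Sum>i=1..N. real i * a i * (\<Sum>j=1..N-i. a j) + real i * a i * a (Suc N - i))"
    by (rule sum.cong) (auto simp: Suc_diff_le distrib_left)
  also have "\<dots> = (\<Sum>k=2..N. real k / 2 * (\<Sum>i=1..k-1. a i * a (k - i)))
       + real (Suc N) / 2 * (\<Sum>i=1..N. a i * a (Suc N - i))"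
    by (simp only: sum.distrib Suc.IH[symmetric] halves[symmetric])
  also have "\<dots> = (\<Sum>k=2..Suc N. real k / 2 * (\<Sum>i=1..k-1. a i * a (k - i)))"
    by (cases "N = 0") simp_all
  finally show ?case by (rule sym)
qed

lemma has_sum_from_1_imp_LIMSEQ:
  fixes f :: "nat \<Rightarrow> real"
  assumes "(f has_sum S) {1..}"
  shows "(\<lambda>N. \<Sum>k=1..N. f k) \<longlonglongrightarrow> S" "(\<lambda>n. f (Suc n)) sums S"
proof -
  have "{1..} = range Suc"
    by (auto simp: image_iff Suc_le_eq gr0_conv_Suc)
  then have "((f \<circ> Suc) has_sum S) UNIV"
    using assms has_sum_reindex[of Suc UNIV f S] by simp
  then show *: "(\<lambda>n. f (Suc n)) sums S"
    using has_sum_imp_sums by (fastforce simp: o_def)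
  then show "(\<lambda>N. \<Sum>k=1..N. f k) \<longlonglongrightarrow> S"
    unfolding sums_def by (simp add: sum.atLeast1_atMost_eq)
qed

locale forest_fire =
  fixes p :: "nat \<Rightarrow> real" and v :: "nat \<Rightarrow> real \<Rightarrow> real"
  assumes solution: "solves_forest_fire p v"
begin

lemma v_initial: "k \<ge> 1 \<Longrightarrow> v k 0 = p k"
  and v_nonneg: "k \<ge> 1 \<Longrightarrow> t \<ge> 0 \<Longrightarrow> 0 \<le> v k t"
  and v_le_one: "k \<ge> 1 \<Longrightarrow> t \<ge> 0 \<Longrightarrow> v k t \<le> 1"
  and v_continuous: "k \<ge> 1 \<Longrightarrow> continuous_on {0..} (v k)"
  and v_has_derivative: "k \<ge> 2 \<Longrightarrow> t \<ge> 0 \<Longrightarrow> (v k has_real_derivative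
        - real k * v k t + real k / 2 * (\<Sum>l=1..k-1. v l t * v (k - l) t)) (at t within {0..})"
  and v_has_sum: "t \<ge> 0 \<Longrightarrow> ((\<lambda>l. v l t) has_sum 1) {1..}"
  using solution unfolding solves_forest_fire_def by auto

lemma v_LIMSEQ: "t \<ge> 0 \<Longrightarrow> (\<lambda>N. \<Sum>k=1..N. v k t) \<longlonglongrightarrow> 1"
  by (rule has_sum_from_1_imp_LIMSEQ[OF v_has_sum])

lemma v_partial_le_one: "t \<ge> 0 \<Longrightarrow> (\<Sum>k=1..N. v k t) \<le> 1"
  using v_has_sum[of t] v_nonneg[of _ t]
  by (intro has_sum_mono_neutral[OF has_sum_finite v_has_sum]) auto

lemma X_has_sum:
  assumes "t \<ge> 0" "z \<in> {0..1}"
  shows "((\<lambda>k. z ^ k * v k t) has_sum X_gf v t z) {1..}"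
  unfolding X_gf_def
proof (rule has_sum_infsum)
  show "(\<lambda>k. z ^ k * v k t) summable_on {1..}"
  proof (rule summable_on_comparison_test)
    show "(\<lambda>k. v k t) summable_on {1..}"
      using v_has_sum[OF assms(1)] by (auto simp: summable_on_def)
  qed (use assms v_nonneg in \<open>auto intro!: mult_left_le_one_le power_le_one mult_nonneg_nonneg\<close>)
qed

lemma X_LIMSEQ: "t \<ge> 0 \<Longrightarrow> z \<in> {0..1} \<Longrightarrow> (\<lambda>N. \<Sum>k=1..N. z ^ k * v k t) \<longlonglongrightarrow> X_gf v t z"
  and X_sums: "t \<ge> 0 \<Longrightarrow> z \<in> {0..1} \<Longrightarrow> (\<lambda>n. z ^ Suc n * v (Suc n) t) sums X_gf v t z"
  using has_sum_from_1_imp_LIMSEQ[OF X_has_sum] by auto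

lemma X_partial_le:
  assumes "t \<ge> 0" "z \<in> {0..1}"
  shows "(\<Sum>k=1..N. z ^ k * v k t) \<le> X_gf v t z"
  using assms v_nonneg
  by (intro has_sum_mono_neutral[OF has_sum_finite X_has_sum]) auto

text \<open>All exponents beyond N are at least N + 1, and the mass found there is 1 minus the
  partial sum. The mass factor serves continuity in t; the power of z gives the geometric error of
  the truncation along a characteristic.\<close>

lemma X_tail:
  assumes t: "t \<ge> 0" and z: "z \<in> {0..1}"
  shows "X_gf v t z - (\<Sum>k=1..N. z ^ k * v k t) \<le> z ^ Suc N * (1 - (\<Sum>k=1..N. v k t))"
proof (rule LIMSEQ_le)
  show "(\<lambda>K. (\<Sum>k=1..K. z ^ k * v k t) - (\<Sum>k=1..N. z ^ k * v k t))
      \<longlonglongrightarrow> X_gf v t z - (\<Sum>k=1..N. z ^ k * v k t)"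
    by (intro tendsto_intros X_LIMSEQ assms)
  show "(\<lambda>K. z ^ Suc N * ((\<Sum>k=1..K. v k t) - (\<Sum>k=1..N. v k t)))
      \<longlonglongrightarrow> z ^ Suc N * (1 - (\<Sum>k=1..N. v k t))"
    by (intro tendsto_intros v_LIMSEQ t)
  show "\<exists>K0. \<forall>K\<ge>K0. (\<Sum>k=1..K. z ^ k * v k t) - (\<Sum>k=1..N. z ^ k * v k t)
      \<le> z ^ Suc N * ((\<Sum>k=1..K. v k t) - (\<Sum>k=1..N. v k t))"
  proof (intro exI allI impI)
    fix K assume "K \<ge> N"
    then have split: "(\<Sum>k=1..K. f k) = (\<Sum>k=1..N. f k) + (\<Sum>k=Suc N..K. f k)" for f :: "nat \<Rightarrow> real"
      using sum.ub_add_nat[of 1 N f "K - N"] by simp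
    have "(\<Sum>k=Suc N..K. z ^ k * v k t) \<le> (\<Sum>k=Suc N..K. z ^ Suc N * v k t)"
      using z t v_nonneg by (intro sum_mono mult_right_mono power_decreasing) auto
    then show "(\<Sum>k=1..K. z ^ k * v k t) - (\<Sum>k=1..N. z ^ k * v k t)
        \<le> z ^ Suc N * ((\<Sum>k=1..K. v k t) - (\<Sum>k=1..N. v k t))"
      by (simp only: split) (simp add: sum_distrib_left)
  qed
qed

lemma X_bounds:
  assumes "t \<ge> 0" "z \<in> {0..1}"
  shows "X_gf v t z \<in> {0..1}"
  using X_tail[OF assms, of 0] X_partial_le[OF assms, of 0] assms by simp

text \<open>The mass beyond N equals 1 minus a finite sum of continuous functions, so it is
  continuous in t although it is an infinite tail. Choosing N at the limit point therefore controls
  the tail at all nearby times, and only a polynomial in z with continuous coefficients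
  remains.\<close>

lemma tendsto_X:
  assumes T: "(T \<longlongrightarrow> t) F" and Z: "(Z \<longlongrightarrow> z) F"
    and Tpos: "\<forall>\<^sub>F x in F. T x \<ge> 0" and Zunit: "\<forall>\<^sub>F x in F. Z x \<in> {0..1}"
    and t: "t \<ge> 0" and z: "z \<in> {0..1}"
  shows "((\<lambda>x. X_gf v (T x) (Z x)) \<longlongrightarrow> X_gf v t z) F"
proof (rule tendstoI)
  fix e :: real assume e: "e > 0"
  have vT: "((\<lambda>x. v k (T x)) \<longlongrightarrow> v k t) F" if "k \<ge> 1" for k
    by (rule continuous_on_tendsto_compose[OF v_continuous[OF that] T]) (use t Tpos in simp_all)
  have "\<forall>\<^sub>F N in sequentially. dist (\<Sum>k=1..N. v k t) 1 < e/3"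
    by (rule tendstoD[OF v_LIMSEQ[OF t]]) (use e in simp)
  then obtain N where "dist (\<Sum>k=1..N. v k t) 1 < e/3"
    by (auto simp: eventually_sequentially)
  moreover have "1 - c < e/3" if "dist c 1 < e/3" for c :: real
    using that unfolding dist_real_def by linarith
  ultimately have N: "1 - (\<Sum>k=1..N. v k t) < e/3"
    by blast
  have 1: "((\<lambda>x. 1 - (\<Sum>k=1..N. v k (T x))) \<longlongrightarrow> 1 - (\<Sum>k=1..N. v k t)) F"
    by (intro tendsto_intros vT) auto
  have 2: "((\<lambda>x. \<Sum>k=1..N. Z x ^ k * v k (T x)) \<longlongrightarrow> (\<Sum>k=1..N. z ^ k * v k t)) F"
    by (intro tendsto_intros vT Z) auto
  have tail: "X_gf v s w - (\<Sum>k=1..N. w ^ k * v k s) \<in> {0..1 - (\<Sum>k=1..N. v k s)}"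
    if "s \<ge> 0" "w \<in> {0..1}" for s w
  proof -
    have "w ^ Suc N * (1 - (\<Sum>k=1..N. v k s)) \<le> 1 - (\<Sum>k=1..N. v k s)"
      by (intro mult_left_le_one_le power_le_one zero_le_power)
        (use that v_partial_le_one[OF that(1), of N] in simp_all)
    then have "X_gf v s w - (\<Sum>k=1..N. w ^ k * v k s) \<le> 1 - (\<Sum>k=1..N. v k s)"
      by (rule order_trans[OF X_tail[OF that]])
    with X_partial_le[OF that, of N] show ?thesis
      by (simp only: atLeastAtMost_iff diff_ge_0_iff_ge)
  qed
  have e3: "e / 3 > 0" using e by simp
  show "\<forall>\<^sub>F x in F. dist (X_gf v (T x) (Z x)) (X_gf v t z) < e"
    using order_tendstoD(2)[OF 1 N] tendstoD[OF 2 e3] Tpos Zunit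
  proof eventually_elim
    case (elim x)
    have near: "\<bar>a' - a\<bar> < e"
      if "\<bar>b' - b\<bar> < e/3" "a' - b' \<in> {0..c'}" "a - b \<in> {0..c}" "c' < e/3" "c < e/3" for a a' b b' c c'
      using that by (simp only: atLeastAtMost_iff abs_less_iff) linarith
    show ?case
      unfolding dist_real_def
      by (rule near[OF elim(2)[unfolded dist_real_def] tail[OF elim(3,4)] tail[OF t z] elim(1) N])
  qed
qed

lemma continuous_on_X:
  assumes "continuous_on S \<phi>" "S \<subseteq> {0..}" "\<phi> ` S \<subseteq> {0..1}"
  shows "continuous_on S (\<lambda>t. X_gf v t (\<phi> t))"
  unfolding continuous_on_def
proof
  fix t assume t: "t \<in> S"
  have ev: "\<forall>\<^sub>F x in at t within S. x \<in> S"
    by (simp add: eventually_at_filter)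
  show "((\<lambda>t. X_gf v t (\<phi> t)) \<longlongrightarrow> X_gf v t (\<phi> t)) (at t within S)"
  proof (rule tendsto_X)
    show "(\<phi> \<longlongrightarrow> \<phi> t) (at t within S)"
      using assms t by (auto simp: continuous_on_def)
  qed (use ev t assms(2,3) in \<open>auto elim!: eventually_mono\<close>)
qed

text \<open>Since \<open>\<Sum>\<^sub>k v\<^sub>k = 1\<close>, the equations for \<open>k \<ge> 2\<close> force fire to act as a nonnegative source of
  singletons, so the generating function cannot decrease along a characteristic. As \<open>v\<^sub>1\<close> need not
  be differentiable, it is eliminated by writing
  \<open>X\<^sub>t(\<phi>) = \<phi> - \<Sum>\<^sub>k\<^sub>\<ge>\<^sub>2 (\<phi> - \<phi>\<^sup>k) v\<^sub>k\<close> and truncating this sum at \<open>N\<close>.\<close>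

lemma X_along_characteristic_mono:
  assumes T: "0 \<le> T" and cont: "continuous_on {0..T} \<phi>"
    and der: "\<And>t. 0 < t \<Longrightarrow> t < T \<Longrightarrow> (\<phi> has_real_derivative \<phi> t * (1 - X_gf v t (\<phi> t))) (at t)"
    and range: "\<And>t. 0 \<le> t \<Longrightarrow> t \<le> T \<Longrightarrow> 0 \<le> \<phi> t \<and> \<phi> t \<le> r" and r: "r < 1"
  shows "X_gf v 0 (\<phi> 0) \<le> X_gf v T (\<phi> T)"
proof -
  define H where "H N t = \<phi> t - (\<Sum>k=2..N. (\<phi> t - \<phi> t ^ k) * v k t)" for N t
  \<comment> \<open>Bound for the error of the truncated convolution: its i-th term has weight i, a
    coefficient of at most \<open>r ^ i\<close> and a remainder of the series after N - i terms of
    at most \<open>r ^ (N - i)\<close>.\<close>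
  define d where "d N = r ^ N * (\<Sum>i=1..N. real i)" for N :: nat
  have r0: "r \<ge> 0" using range[of 0] T by auto
  have split2: "(\<Sum>k=2..N. f k) = (\<Sum>k=1..N. f k) - f 1" if "N \<ge> 1" for f :: "nat \<Rightarrow> real" and N
    using that by (simp add: sum.atLeast_Suc_atMost numeral_2_eq_2)
  have dlim: "d \<longlonglongrightarrow> 0"
  proof -
    have gauss: "(\<Sum>i=1..N. real i) = real N * (real N + 1) / 2" for N
      by (induction N) (auto simp: field_simps)
    then have d: "d N = (real N * (real N * r ^ N) + real N * r ^ N) / 2" for N
      unfolding d_def gauss by (simp add: algebra_simps)
    \<comment> \<open>N^2 r^N is the square of N q^N, so the limit with a linear factor
      suffices.\<close>
    define q where "q = sqrt r"
    have q: "0 \<le> q" "q < 1" "r = q * q"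
      using r r0 by (auto simp: q_def)
    have 1: "(\<lambda>N. real N * q ^ N) \<longlonglongrightarrow> 0"
      using q by (intro powser_times_n_limit_0) auto
    have 2: "(\<lambda>N. real N * r ^ N) \<longlonglongrightarrow> 0"
      using r r0 by (intro powser_times_n_limit_0) auto
    have "(\<lambda>N. ((real N * q ^ N) * (real N * q ^ N) + real N * r ^ N) / 2) \<longlonglongrightarrow> (0 * 0 + 0) / 2"
      by (intro tendsto_intros 1 2) auto
    then show ?thesis
      by (simp add: d[abs_def] q(3) power_mult_distrib mult_ac)
  qed
  have Hderiv: "\<exists>D. (H N has_real_derivative D) (at t) \<and> D \<ge> - d N"
    if t: "0 < t" "t < T" and N: "N \<ge> 1" for t N
  proof -
    define x where "x = X_gf v t (\<phi> t)"
    define w where "w k = - real k * v k t + real k / 2 * (\<Sum>l=1..k-1. v l t * v (k - l) t)" for k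
    define a where "a k = \<phi> t ^ k * v k t" for k
    define V where "V = (\<Sum>k=1..N. v k t)"
    have ph: "0 \<le> \<phi> t" "\<phi> t \<le> r" using range[of t] t by auto
    have unit: "\<phi> t \<in> {0..1}" using ph r by auto
    have x: "0 \<le> x" "x \<le> 1" using X_bounds[OF _ unit, of t] t by (auto simp: x_def)
    have vD: "(v k has_real_derivative w k) (at t)" if "k \<ge> 2" for k
      using v_has_derivative[OF that, of t] t at_within_interior[of t "{0..}"]
      by (simp add: w_def)
    have pD: "(\<phi> has_real_derivative \<phi> t * (1 - x)) (at t)"
      using der[OF t] by (simp add: x_def)
    let ?D = "\<phi> t * (1 - x) - (\<Sum>k=2..N. (\<phi> t - real k * \<phi> t ^ k) * (1 - x) * v k t + (\<phi> t - \<phi> t ^ k) * w k)"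
    have HD: "(H N has_real_derivative ?D) (at t)"
      unfolding H_def
    proof (rule DERIV_diff[OF pD], rule DERIV_sum)
      fix k assume "k \<in> {2..N}"
      then have k: "k \<ge> 2" by simp
      have pw: "\<phi> t ^ (k - Suc 0) * \<phi> t = \<phi> t ^ k"
        using k power_minus_mult[of k "\<phi> t"] by simp
      have "((\<lambda>t. (\<phi> t - \<phi> t ^ k) * v k t) has_real_derivative
          (\<phi> t * (1 - x) - real k * (\<phi> t * (1 - x) * \<phi> t ^ (k - Suc 0))) * v k t
            + w k * (\<phi> t - \<phi> t ^ k)) (at t)"
        by (intro DERIV_mult DERIV_diff DERIV_power pD vD k)
      also have "\<phi> t * (1 - x) * \<phi> t ^ (k - Suc 0) = \<phi> t ^ k * (1 - x)"
        unfolding pw[symmetric] by (simp only: mult_ac)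
      finally show "((\<lambda>t. (\<phi> t - \<phi> t ^ k) * v k t) has_real_derivative
          (\<phi> t - real k * \<phi> t ^ k) * (1 - x) * v k t + (\<phi> t - \<phi> t ^ k) * w k) (at t)"
        by (simp add: algebra_simps)
    qed
    have alg: "B * (- K * c + K / 2 * S) = - (K * (B * c)) + K / 2 * (B * S)" for B K c S :: real
      by (simp add: algebra_simps)
    have le: "- A + c + B \<le> c" if "B \<le> A" for A B c :: real
      using that by simp
    \<comment> \<open>The base b stays free: b = 1 yields the mass balance of the sizes 2 to N, and
      b = \<open>\<phi> t\<close> the corresponding part of the derivative of the generating
      function.\<close>
    have conv: "(\<Sum>k=2..N. b ^ k * w k)
      = - (\<Sum>k=1..N. real k * (b ^ k * v k t)) + b * v 1 t
        + (\<Sum>i=1..N. real i * (b ^ i * v i t) * (\<Sum>j=1..N-i. b ^ j * v j t))" for b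
    proof -
      have "(\<Sum>k=2..N. b ^ k * w k) = (\<Sum>k=2..N. - (real k * (b ^ k * v k t)))
          + (\<Sum>k=2..N. real k / 2 * (\<Sum>l=1..k-1. (b ^ l * v l t) * (b ^ (k - l) * v (k - l) t)))"
      proof (subst sum.distrib[symmetric], rule sum.cong)
        fix k assume "k \<in> {2..N}"
        have "b ^ k * (\<Sum>l=1..k-1. v l t * v (k - l) t)
            = (\<Sum>l=1..k-1. (b ^ l * v l t) * (b ^ (k - l) * v (k - l) t))"
          unfolding sum_distrib_left
        proof (rule sum.cong)
          fix l assume "l \<in> {1..k-1}"
          then have "b ^ k = b ^ l * b ^ (k - l)"
            by (auto simp flip: power_add)
          then show "b ^ k * (v l t * v (k - l) t) = (b ^ l * v l t) * (b ^ (k - l) * v (k - l) t)"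
            by (simp only: mult_ac)
        qed simp
        then show "b ^ k * w k = - (real k * (b ^ k * v k t))
            + real k / 2 * (\<Sum>l=1..k-1. (b ^ l * v l t) * (b ^ (k - l) * v (k - l) t))"
          by (simp only: w_def alg)
      qed simp
      also have "(\<Sum>k=2..N. - (real k * (b ^ k * v k t))) = - (\<Sum>k=1..N. real k * (b ^ k * v k t)) + b * v 1 t"
        by (simp add: split2[OF N] sum_negf)
      finally show ?thesis
        unfolding sum_convolution[of "\<lambda>k. b ^ k * v k t"] .
    qed
    define A where "A = (\<Sum>k=1..N. real k * a k)"
    define B where "B = (\<Sum>i=1..N. real i * a i * (\<Sum>j=1..N-i. a j))"
    define W where "W = (\<Sum>k=2..N. w k)"
    \<comment> \<open>The gain of the sizes up to N by coagulation is at most their loss, as each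
      inner sum is at most 1. Formally \<open>v 1 t - W\<close> tends to v_1' + v_1, the rate at
      which fire creates singletons.\<close>
    have w_le: "W \<le> v 1 t"
    proof -
      have "(\<Sum>i=1..N. real i * v i t * (\<Sum>j=1..N-i. v j t)) \<le> (\<Sum>i=1..N. real i * v i t)"
        by (intro sum_mono mult_left_le v_partial_le_one mult_nonneg_nonneg v_nonneg) (use t in auto)
      then show ?thesis
        unfolding W_def conv[of 1, unfolded power_one mult_1] by (rule le)
    qed
    define Q where "Q = (\<Sum>i=1..N. real i * a i * (x - (\<Sum>j=1..N-i. a j)))"
    have P: "(\<Sum>k=2..N. \<phi> t ^ k * w k) = - A + a 1 + B"
      unfolding conv A_def B_def a_def by simp
    have "?D = \<phi> t * (1 - x) - (\<Sum>k=2..N. (1 - x) * \<phi> t * v k t - (1 - x) * (real k * a k)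
          + \<phi> t * w k - \<phi> t ^ k * w k)"
      by (intro arg_cong2[where f = minus] sum.cong refl) (simp add: a_def algebra_simps)
    also have "\<dots> = \<phi> t * (1 - x) - ((1 - x) * \<phi> t * (V - v 1 t) - (1 - x) * (A - a 1)
          + \<phi> t * W - (- A + a 1 + B))"
      unfolding sum.distrib sum_subtractf sum_distrib_left[symmetric] P
      by (simp add: split2[OF N] V_def A_def W_def)
    also have "\<dots> = \<phi> t * (1 - x) * (1 - V) + \<phi> t * (v 1 t - W) - (x * A - B)"
      by (simp add: a_def algebra_simps)
    also have "x * A - B = Q"
      by (simp add: Q_def A_def B_def right_diff_distrib sum_subtractf sum_distrib_left mult_ac)
    \<comment> \<open>Two nonnegative terms, from the missing mass beyond N and from the fire
      source, and a remainder \<open>Q\<close> that is at most \<open>d N\<close>.\<close>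
    finally have D1: "?D = \<phi> t * (1 - x) * (1 - V) + \<phi> t * (v 1 t - W) - Q" .
    have tail: "Q \<le> d N"
      unfolding Q_def d_def sum_distrib_left
    proof (rule sum_mono)
      fix i assume i: "i \<in> {1..N}"
      have "x - (\<Sum>j=1..N-i. a j) \<le> \<phi> t ^ Suc (N - i) * (1 - (\<Sum>k=1..N-i. v k t))"
        unfolding x_def a_def by (rule X_tail) (use t unit in auto)
      also have "\<dots> \<le> \<phi> t ^ Suc (N - i)"
        using v_partial_le_one[of t "N-i"] t ph v_nonneg[of _ t] by (intro mult_left_le) (auto intro!: sum_nonneg)
      also have "\<dots> \<le> r ^ Suc (N - i)" using ph by (intro power_mono) auto
      also have "\<dots> \<le> r ^ (N - i)" using r r0 by (intro power_decreasing) auto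
      finally have 1: "x - (\<Sum>j=1..N-i. a j) \<le> r ^ (N - i)" .
      have "a i \<le> \<phi> t ^ i" unfolding a_def using v_le_one[of i t] i t ph by (intro mult_left_le) auto
      also have "\<dots> \<le> r ^ i" using ph by (intro power_mono) auto
      finally have 2: "a i \<le> r ^ i" .
      have 3: "0 \<le> a i" unfolding a_def using v_nonneg[of i t] i t ph by auto
      have 4: "0 \<le> x - (\<Sum>j=1..N-i. a j)"
        using X_partial_le[of t "\<phi> t"] t unit by (auto simp: x_def a_def)
      have "a i * (x - (\<Sum>j=1..N-i. a j)) \<le> r ^ i * r ^ (N - i)"
        by (rule mult_mono) (use 1 2 3 4 r0 in auto)
      also have "\<dots> = r ^ N" using i by (simp flip: power_add)
      finally have "real i * (a i * (x - (\<Sum>j=1..N-i. a j))) \<le> real i * r ^ N"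
        by (rule mult_left_mono) simp
      then show "real i * a i * (x - (\<Sum>j=1..N-i. a j)) \<le> r ^ N * real i"
        by (simp only: mult_ac)
    qed
    have "0 \<le> \<phi> t * (1 - x) * (1 - V)" "0 \<le> \<phi> t * (v 1 t - W)"
      using ph x w_le v_partial_le_one[of t N] t by (auto simp: V_def)
    then have "?D \<ge> - d N" unfolding D1 using tail by simp
    with HD show ?thesis by blast
  qed
  have Hcont: "continuous_on {0..T} (H N)" for N
    unfolding H_def
    by (intro continuous_intros cont continuous_on_subset[OF v_continuous]) auto
  have step: "H N 0 \<le> H N T + d N * T" if N: "N \<ge> 1" for N
  proof -
    \<comment> \<open>Adding \<open>d N * t\<close> compensates the lower bound \<open>- d N\<close>
      of the derivative.\<close>
    have "H N 0 + d N * 0 \<le> H N T + d N * T"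
    proof (rule DERIV_nonneg_imp_increasing_open[OF T])
      show "continuous_on {0..T} (\<lambda>t. H N t + d N * t)"
        by (intro continuous_intros Hcont)
    next
      fix t assume "0 < t" "t < T"
      then obtain D where D: "(H N has_real_derivative D) (at t)" "D \<ge> - d N"
        using Hderiv[OF _ _ N] by blast
      then have "((\<lambda>t. H N t + d N * t) has_real_derivative D + d N) (at t)"
        by (auto intro!: derivative_eq_intros)
      then show "\<exists>y. ((\<lambda>t. H N t + d N * t) has_real_derivative y) (at t) \<and> 0 \<le> y"
        using D(2) by (intro exI[of _ "D + d N"]) auto
    qed
    then show ?thesis by simp
  qed
  have Hlim: "(\<lambda>N. H N t) \<longlonglongrightarrow> X_gf v t (\<phi> t)" if t: "0 \<le> t" "t \<le> T" for t
  proof -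
    have unit: "\<phi> t \<in> {0..1}" using range[OF t] r by auto
    have "H N t = \<phi> t - \<phi> t * (\<Sum>k=1..N. v k t) + (\<Sum>k=1..N. \<phi> t ^ k * v k t)" if "N \<ge> 1" for N
      unfolding H_def using that by (simp add: split2 algebra_simps sum_subtractf sum_distrib_left)
    moreover have "(\<lambda>N. \<phi> t - \<phi> t * (\<Sum>k=1..N. v k t) + (\<Sum>k=1..N. \<phi> t ^ k * v k t))
        \<longlonglongrightarrow> \<phi> t - \<phi> t * 1 + X_gf v t (\<phi> t)"
      by (intro tendsto_intros v_LIMSEQ X_LIMSEQ unit t)
    ultimately show ?thesis
      by (subst tendsto_cong[where g="\<lambda>N. \<phi> t - \<phi> t * (\<Sum>k=1..N. v k t) + (\<Sum>k=1..N. \<phi> t ^ k * v k t)"])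
        (auto simp: eventually_sequentially intro!: exI[of _ 1])
  qed
  have "X_gf v 0 (\<phi> 0) \<le> X_gf v T (\<phi> T) + 0 * T"
  proof (rule LIMSEQ_le[OF Hlim])
    show "(\<lambda>N. H N T + d N * T) \<longlonglongrightarrow> X_gf v T (\<phi> T) + 0 * T"
      by (intro tendsto_intros Hlim dlim) (use T in auto)
  qed (use T step in auto)
  then show ?thesis by simp
qed

section \<open>Characteristics: bounds, closure under limits, comparison\<close>

lemma characteristic_has_integral:
  assumes "is_characteristic v y \<phi>" "0 \<le> a" "a \<le> b"
  shows "((\<lambda>u. \<phi> u * (1 - X_gf v u (\<phi> u))) has_integral \<phi> b - \<phi> a) {a..b}"
proof (rule fundamental_theorem_of_calculus_interior)
  show "continuous_on {a..b} \<phi>"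
    using assms by (auto simp: is_characteristic_def elim: continuous_on_subset)
qed (use assms in \<open>auto simp: is_characteristic_def has_real_derivative_iff_has_vector_derivative[symmetric]\<close>)

text \<open>Both factors lie in [0,1]. This one bound makes every characteristic nondecreasing and
  1-Lipschitz, uniformly in y.\<close>

lemma characteristic_integrand_bounds:
  assumes "is_characteristic v y \<phi>" "0 \<le> u"
  shows "\<phi> u * (1 - X_gf v u (\<phi> u)) \<in> {0..1}"
proof -
  have 1: "\<phi> u \<in> {0<..1}" using assms by (auto simp: is_characteristic_def)
  then have 2: "X_gf v u (\<phi> u) \<in> {0..1}" by (intro X_bounds assms) auto
  from 1 2 show ?thesis by (auto intro!: mult_le_one)
qed

lemma characteristic_mono:
  assumes "is_characteristic v y \<phi>" "0 \<le> a" "a \<le> b"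
  shows "\<phi> a \<le> \<phi> b"
proof -
  have "0 \<le> \<phi> b - \<phi> a"
  proof (rule has_integral_nonneg[OF characteristic_has_integral[OF assms]])
    fix u assume "u \<in> {a..b}"
    then show "0 \<le> \<phi> u * (1 - X_gf v u (\<phi> u))"
      using characteristic_integrand_bounds[OF assms(1), of u] assms(2) by simp
  qed
  then show ?thesis by simp
qed

lemma characteristic_lipschitz:
  assumes "is_characteristic v y \<phi>" "0 \<le> a" "a \<le> b"
  shows "\<phi> b - \<phi> a \<le> b - a"
proof -
  have "((\<lambda>u::real. 1::real) has_integral (b - a)) {a..b}"
    using has_integral_const_real[of "1::real" a b] assms by simp
  then show ?thesis
  proof (rule has_integral_le[OF characteristic_has_integral[OF assms]])
    fix u assume "u \<in> {a..b}"
    then show "\<phi> u * (1 - X_gf v u (\<phi> u)) \<le> 1"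
      using characteristic_integrand_bounds[OF assms(1), of u] assms(2) by simp
  qed
qed

lemma continuous_characteristic_integrand:
  assumes "continuous_on {0..} \<phi>" "\<And>t. t \<ge> 0 \<Longrightarrow> \<phi> t \<in> {0..1}"
  shows "continuous_on {0..} (\<lambda>u. \<phi> u * (1 - X_gf v u (\<phi> u)))"
  by (intro continuous_on_mult continuous_on_diff continuous_on_const continuous_on_X assms(1) order_refl)
    (use assms(2) in blast)

text \<open>The equation passes to the limit in integrated form by dominated convergence. The common
  Lipschitz bound makes the limit continuous, so the integral equation can be differentiated again.
  Positivity and staying below 1 before y are strict inequalities that a limit can lose, hence they
  are hypotheses.\<close>

lemma characteristic_limit:
  assumes char: "\<And>n. is_characteristic v (z n) (\<phi> n)" and z: "z \<longlonglongrightarrow> y"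
    and lim: "\<And>t. t \<ge> 0 \<Longrightarrow> (\<lambda>n. \<phi> n t) \<longlonglongrightarrow> \<rho> t"
    and pos: "\<And>t. t \<ge> 0 \<Longrightarrow> \<rho> t > 0" and below: "\<And>t. t \<ge> 0 \<Longrightarrow> t < y \<Longrightarrow> \<rho> t < 1"
  shows "is_characteristic v y \<rho>"
proof -
  have unit: "\<phi> n t \<in> {0<..1}" if "t \<ge> 0" for n t
    using char[of n] that by (auto simp: is_characteristic_def)
  have le1: "\<rho> t \<le> 1" if "t \<ge> 0" for t
    by (rule LIMSEQ_le_const2[OF lim[OF that]]) (use unit[OF that] in auto)
  have diff: "\<rho> b - \<rho> a \<in> {0..b - a}" if "0 \<le> a" "a \<le> b" for a b
  proof -
    have l: "(\<lambda>n. \<phi> n b - \<phi> n a) \<longlonglongrightarrow> \<rho> b - \<rho> a"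
      using that by (intro tendsto_diff lim) auto
    show ?thesis
      using LIMSEQ_le_const[OF l, of 0] LIMSEQ_le_const2[OF l, of "b - a"]
        characteristic_mono[OF char that] characteristic_lipschitz[OF char that] by auto
  qed
  have cont: "continuous_on {0..} \<rho>"
    unfolding continuous_on_iff
  proof (intro ballI allI impI)
    fix a e :: real assume a: "a \<in> {0..}" "e > 0"
    have "dist (\<rho> b) (\<rho> a) \<le> dist b a" if "b \<in> {0..}" for b
      using diff[of a b] diff[of b a] a(1) that by (cases "a \<le> b") (auto simp: dist_real_def)
    then show "\<exists>d>0. \<forall>b\<in>{0..}. dist b a < d \<longrightarrow> dist (\<rho> b) (\<rho> a) < e"
      using a(2) le_less_trans by blast
  qed
  have above: "\<rho> t = 1" if "t \<ge> 0" "t \<ge> y" for t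
  proof (rule antisym[OF le1[OF that(1)]])
    \<comment> \<open>A curve with slope at most 1 that equals 1 from \<open>z n\<close> on lies
      above this broken line, which tends to 1 for every t at or beyond y.\<close>
    have "\<phi> n t \<ge> 1 - max 0 (z n - t)" for n
    proof (cases "z n \<le> t")
      case True
      then show ?thesis using char[of n] that by (auto simp: is_characteristic_def)
    next
      case False
      then have "\<phi> n (z n) = 1" using char[of n] that by (auto simp: is_characteristic_def)
      then show ?thesis
        using characteristic_lipschitz[OF char[of n] that(1), of "z n"] False by auto
    qed
    moreover have "(\<lambda>n. 1 - max 0 (z n - t)) \<longlonglongrightarrow> 1 - max 0 (y - t)"
      by (intro tendsto_intros z)
    ultimately have "1 - max 0 (y - t) \<le> \<rho> t"
      using LIMSEQ_le[OF _ lim[OF that(1)]] by blast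
    then show "1 \<le> \<rho> t" using that by simp
  qed
  have integral_eq: "integral {0..t} (\<lambda>u. \<rho> u * (1 - X_gf v u (\<rho> u))) = \<rho> t - \<rho> 0" if t: "t \<ge> 0" for t
  proof (rule LIMSEQ_unique)
    have int: "integral {0..t} (\<lambda>u. \<phi> n u * (1 - X_gf v u (\<phi> n u))) = \<phi> n t - \<phi> n 0"
      "(\<lambda>u. \<phi> n u * (1 - X_gf v u (\<phi> n u))) integrable_on {0..t}" for n
      using characteristic_has_integral[OF char order_refl t, of n] by (auto simp: has_integral_iff)
    show "(\<lambda>n. integral {0..t} (\<lambda>u. \<phi> n u * (1 - X_gf v u (\<phi> n u)))) \<longlonglongrightarrow> \<rho> t - \<rho> 0"
      unfolding int by (intro tendsto_diff lim t order_refl)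
    show "(\<lambda>n. integral {0..t} (\<lambda>u. \<phi> n u * (1 - X_gf v u (\<phi> n u))))
        \<longlonglongrightarrow> integral {0..t} (\<lambda>u. \<rho> u * (1 - X_gf v u (\<rho> u)))"
    proof (rule dominated_convergence)
      show "(\<lambda>_. 1::real) integrable_on {0..t}" by (rule integrable_const_ivl)
      fix n u assume u: "u \<in> {0..t}"
      then show "norm (\<phi> n u * (1 - X_gf v u (\<phi> n u))) \<le> 1"
        using characteristic_integrand_bounds[OF char[of n], of u] by auto
    next
      fix u assume u: "u \<in> {0..t}"
      have "(\<lambda>n. X_gf v u (\<phi> n u)) \<longlonglongrightarrow> X_gf v u (\<rho> u)"
        by (rule tendsto_X[OF tendsto_const lim])
          (use u unit le1 pos in \<open>auto intro!: always_eventually less_imp_le\<close>)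
      then show "(\<lambda>n. \<phi> n u * (1 - X_gf v u (\<phi> n u))) \<longlonglongrightarrow> \<rho> u * (1 - X_gf v u (\<rho> u))"
        using u by (intro tendsto_intros lim) auto
    qed (rule int)
  qed
  have "(\<rho> has_real_derivative \<rho> t * (1 - X_gf v t (\<rho> t))) (at t)" if t: "t > 0" for t
  proof -
    let ?g = "\<lambda>u. \<rho> u * (1 - X_gf v u (\<rho> u))"
    have "continuous_on {0..t + 1} ?g"
      by (rule continuous_on_subset[OF continuous_characteristic_integrand])
        (use cont pos le1 in \<open>auto intro: less_imp_le\<close>)
    then have "((\<lambda>x. \<rho> 0 + integral {0..x} ?g) has_real_derivative 0 + ?g t) (at t within {0..t + 1})"
      using t by (intro DERIV_add DERIV_const integral_has_real_derivative) auto
    then have "((\<lambda>x. \<rho> 0 + integral {0..x} ?g) has_real_derivative ?g t) (at t)"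
      using t at_within_interior[of t "{0..t+1}"] by simp
    then show ?thesis
    proof (rule has_field_derivative_transform_within_open)
      show "open {0::real<..}" "t \<in> {0<..}" using t by auto
    qed (simp add: integral_eq)
  qed
  then show ?thesis
    using cont pos le1 above below by (auto simp: is_characteristic_def)
qed

text \<open>If the later curve lay above at \<open>t1\<close>, it would have to meet
  \<open>\<phi>\<close> before y, since at y it is still below 1. Following \<open>\<phi>'\<close>
  up to the meeting point and \<open>\<phi>\<close> afterwards gives a second characteristic
  reaching 1 at y, against uniqueness.\<close>

lemma characteristic_antimono:
  assumes uniq: "unique_characteristic v y \<phi>" and char': "is_characteristic v y' \<phi>'"
    and less: "y < y'" and t1: "t1 \<ge> 0"
  shows "\<phi>' t1 \<le> \<phi> t1"
proof (rule ccontr)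
  assume "\<not> \<phi>' t1 \<le> \<phi> t1"
  then have gt: "\<phi>' t1 > \<phi> t1" by simp
  have char: "is_characteristic v y \<phi>" using uniq by (simp add: unique_characteristic_def)
  have c: "continuous_on {0..} \<phi>" "continuous_on {0..} \<phi>'"
    using char char' by (auto simp: is_characteristic_def)
  have unit: "0 < \<phi> t" "\<phi> t \<le> 1" "0 < \<phi>' t" "\<phi>' t \<le> 1" if "t \<ge> 0" for t
    using char char' that by (auto simp: is_characteristic_def)
  have one: "\<phi> t = 1" if "t \<ge> 0" "t \<ge> y" for t
    using char that by (auto simp: is_characteristic_def)
  have below: "\<phi> t < 1" if "t \<ge> 0" "t < y" for t
    using char that by (auto simp: is_characteristic_def)
  have below': "\<phi>' t < 1" if "t \<ge> 0" "t < y'" for t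
    using char' that by (auto simp: is_characteristic_def)
  have "t1 < y"
    using gt one[OF t1] unit[OF t1] by fastforce
  have neg: "\<phi>' y - \<phi> y \<le> 0"
    using one[of y] below'[of y] t1 \<open>t1 < y\<close> less by simp
  have "\<exists>t0\<ge>t1. t0 \<le> y \<and> \<phi>' t0 - \<phi> t0 = 0"
    by (rule IVT2'[where f = "\<lambda>t. \<phi>' t - \<phi> t"])
      (use neg gt \<open>t1 < y\<close> t1 in \<open>auto intro!: continuous_intros continuous_on_subset[OF c(1)] continuous_on_subset[OF c(2)]\<close>)
  then obtain t0 where t0: "t1 \<le> t0" "t0 \<le> y" "\<phi>' t0 = \<phi> t0" by auto
  have "t0 \<noteq> t1" using t0 gt by auto
  have "t0 \<noteq> y"
    using t0 t1 one[of y] below'[of y] less by fastforce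
  then have "t0 < y" using t0 by simp
  define \<rho> where "\<rho> t = (if t \<le> t0 then \<phi>' t else \<phi> t)" for t
  have lo: "\<rho> t = \<phi>' t" if "t \<le> t0" for t using that by (simp add: \<rho>_def)
  have hi: "\<rho> t = \<phi> t" if "t \<ge> t0" for t using that t0(3) by (auto simp: \<rho>_def)
  have cont: "continuous_on {0..} \<rho>"
  proof -
    have "continuous_on ({0..t0} \<union> {t0..}) \<rho>"
      unfolding \<rho>_def
      by (rule continuous_on_cases)
        (use t0 t1 c in \<open>auto elim: continuous_on_subset\<close>)
    moreover have "{0..t0} \<union> {t0..} = {0..}" using t0 t1 by auto
    ultimately show ?thesis by simp
  qed
  have deriv: "(\<rho> has_real_derivative \<rho> t * (1 - X_gf v t (\<rho> t))) (at t)" if t: "t > 0" for t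
  proof -
    have d: "(\<phi> has_real_derivative \<phi> t * (1 - X_gf v t (\<phi> t))) (at t)"
      "(\<phi>' has_real_derivative \<phi>' t * (1 - X_gf v t (\<phi>' t))) (at t)"
      using char char' t by (auto simp: is_characteristic_def)
    consider "t < t0" | "t > t0" | "t = t0" by linarith
    then show ?thesis
    proof cases
      case 1
      from d(2) have "(\<rho> has_real_derivative \<phi>' t * (1 - X_gf v t (\<phi>' t))) (at t)"
        by (rule has_field_derivative_transform_within_open[where S = "{..<t0}"])
          (use 1 in \<open>auto simp: lo\<close>)
      then show ?thesis using 1 by (simp add: lo)
    next
      case 2
      from d(1) have "(\<rho> has_real_derivative \<phi> t * (1 - X_gf v t (\<phi> t))) (at t)"
        by (rule has_field_derivative_transform_within_open[where S = "{t0<..}"])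
          (use 2 in \<open>auto simp: hi\<close>)
      then show ?thesis using 2 by (simp add: hi)
    next
      case 3
      \<comment> \<open>At the meeting point the one-sided derivatives agree because the right-hand
        side of the equation depends only on the common value.\<close>
      have "((\<lambda>u. (\<rho> u - \<rho> t) / (u - t)) \<longlongrightarrow> \<phi> t * (1 - X_gf v t (\<phi> t))) (at t)"
      proof (rule filterlim_split_at)
        have "((\<lambda>u. (\<phi>' u - \<phi>' t) / (u - t)) \<longlongrightarrow> \<phi> t * (1 - X_gf v t (\<phi> t))) (at_left t)"
          using d(2) 3 t0(3) by (simp add: has_field_derivative_iff filterlim_at_split)
        then show "((\<lambda>u. (\<rho> u - \<rho> t) / (u - t)) \<longlongrightarrow> \<phi> t * (1 - X_gf v t (\<phi> t))) (at_left t)"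
          by (rule Lim_transform_eventually) (auto simp: eventually_at_filter lo 3)
        have "((\<lambda>u. (\<phi> u - \<phi> t) / (u - t)) \<longlongrightarrow> \<phi> t * (1 - X_gf v t (\<phi> t))) (at_right t)"
          using d(1) by (simp add: has_field_derivative_iff filterlim_at_split)
        then show "((\<lambda>u. (\<rho> u - \<rho> t) / (u - t)) \<longlongrightarrow> \<phi> t * (1 - X_gf v t (\<phi> t))) (at_right t)"
          by (rule Lim_transform_eventually) (auto simp: eventually_at_filter hi 3)
      qed
      then show ?thesis using 3 by (simp add: has_field_derivative_iff hi)
    qed
  qed
  have "is_characteristic v y \<rho>"
    unfolding is_characteristic_def
  proof (intro conjI allI impI)
    fix t :: real assume "t \<ge> 0"
    then show "\<rho> t \<in> {0<..1}" using unit by (simp add: \<rho>_def)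
    show "\<rho> t = 1" if "t \<ge> y"
      using that \<open>t \<ge> 0\<close> \<open>t0 < y\<close> one by (simp add: hi)
    show "\<rho> t < 1" if "t < y"
      using that \<open>t \<ge> 0\<close> less below below' by (simp add: \<rho>_def)
  qed (use cont deriv in auto)
  then have "\<rho> t1 = \<phi> t1"
    using uniq t1 by (simp add: unique_characteristic_def)
  then show False using gt t0 by (simp add: lo)
qed

text \<open>As X does not decrease along the curve, \<open>\<phi>\<close> grows at rate at most c =
  1 - X_0(w) until it reaches 1 at time y, where w is its initial value; so -ln w is at most c y.
  Bernoulli's inequality bounds c by m (1 - w). The resulting bound tends to 1 as y decreases to
  1/m.\<close>

lemma characteristic_initial_lower_bound:
  assumes char: "is_characteristic v y \<phi>" and y: "y > 0"
    and mean: "((\<lambda>l. real l * p l) has_sum m) {1..}" and m: "m > 0"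
  shows "2 / (m * y) - 1 \<le> sqrt (\<phi> 0)"
proof -
  define w where "w = \<phi> 0"
  define c where "c = 1 - X_gf v 0 w"
  have w: "0 < w" "w < 1" using char y by (auto simp: is_characteristic_def w_def)
  have unit: "w \<in> {0..1}" using w by simp
  have cont: "continuous_on {0..} \<phi>" using char by (simp add: is_characteristic_def)
  have Xmono: "X_gf v 0 w \<le> X_gf v t (\<phi> t)" if t: "0 < t" "t < y" for t
    unfolding w_def
  proof (rule X_along_characteristic_mono[where r = "\<phi> t" and \<phi> = \<phi> and T = t])
    show "\<phi> t < 1" using char t by (simp add: is_characteristic_def)
    show "0 \<le> \<phi> u \<and> \<phi> u \<le> \<phi> t" if "0 \<le> u" "u \<le> t" for u
      using characteristic_mono[OF char that] char that by (auto simp: is_characteristic_def less_imp_le)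
  qed (use char t in \<open>auto simp: is_characteristic_def elim: continuous_on_subset\<close>)
  have "exp (- c * y) * \<phi> y \<le> exp (- c * 0) * \<phi> 0"
  proof (rule DERIV_nonpos_imp_decreasing_open[where f = "\<lambda>t. exp (- c * t) * \<phi> t" and a = 0 and b = y])
    fix t assume t: "0 < t" "t < y"
    have "((\<lambda>t. exp (- c * t) * \<phi> t) has_real_derivative
        exp (- c * t) * (- c) * \<phi> t + \<phi> t * (1 - X_gf v t (\<phi> t)) * exp (- c * t)) (at t)"
      by (rule DERIV_mult) (use char t in \<open>auto simp: is_characteristic_def intro!: derivative_eq_intros\<close>)
    moreover have "exp (- c * t) * (- c) * \<phi> t + \<phi> t * (1 - X_gf v t (\<phi> t)) * exp (- c * t)
        = - (exp (- c * t) * \<phi> t * (X_gf v t (\<phi> t) - X_gf v 0 w))"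
      by (simp add: c_def algebra_simps)
    moreover have "\<dots> \<le> 0"
      using Xmono[OF t] char t by (auto simp: is_characteristic_def less_imp_le)
    ultimately show "\<exists>D. ((\<lambda>t. exp (- c * t) * \<phi> t) has_real_derivative D) (at t) \<and> D \<le> 0"
      by metis
  qed (use y in \<open>auto intro!: continuous_intros continuous_on_subset[OF cont]\<close>)
  moreover have "\<phi> y = 1" using char y by (simp add: is_characteristic_def)
  ultimately have "exp (- (c * y)) \<le> w" by (simp add: w_def)
  then have ln_w: "- ln w \<le> c * y"
    using w by (metis exp_le_cancel_iff exp_ln minus_le_iff)
  have "c \<le> m * (1 - w)"
  proof (rule has_sum_mono)
    have "((\<lambda>k. v k 0 + (-1) * (w ^ k * v k 0)) has_sum 1 + (-1) * X_gf v 0 w) {1..}"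
      by (intro has_sum_add has_sum_cmult_right v_has_sum X_has_sum unit) auto
    then show "((\<lambda>k. (1 - w ^ k) * v k 0) has_sum c) {1..}"
      by (simp add: c_def algebra_simps)
    show "((\<lambda>k. real k * p k * (1 - w)) has_sum m * (1 - w)) {1..}"
      by (rule has_sum_cmult_left[OF mean])
    fix k :: nat assume k: "k \<in> {1..}"
    have "1 + real k * (w - 1) \<le> (1 + (w - 1)) ^ k"
      by (rule Bernoulli_inequality) (use w in auto)
    then have "1 - w ^ k \<le> real k * (1 - w)" by (simp add: algebra_simps)
    then have "(1 - w ^ k) * p k \<le> real k * (1 - w) * p k"
      using k v_initial[of k] v_nonneg[of k 0] by (intro mult_right_mono) auto
    then show "(1 - w ^ k) * v k 0 \<le> real k * p k * (1 - w)"
      using k v_initial[of k] by (simp add: mult_ac)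
  qed
  then have 1: "- ln w \<le> m * (1 - w) * y"
    using ln_w y by (meson mult_right_mono less_imp_le order_trans)
  \<comment> \<open>The inequality -ln w \<ge> 1 - w would only give m y \<ge> 1. Applied to the
    square root it leaves the factor 1 + q after division by 1 - q, since 1 - w = (1 - q)(1 + q),
    and so yields information about w.\<close>
  define q where "q = sqrt w"
  have q: "0 < q" "q < 1" "w = q * q" using w by (auto simp: q_def)
  have "ln w = 2 * ln q" using q by (simp add: ln_mult)
  moreover have "ln q \<le> q - 1" using q by (intro ln_le_minus_one)
  ultimately have "2 * (1 - q) \<le> m * y * (1 + q) * (1 - q)"
    using 1 unfolding q(3) by (simp add: algebra_simps)
  then have "2 \<le> m * y * (1 + q)"
    using q by (simp only: mult_le_cancel_right_pos[of "1 - q"] diff_gt_0_iff_gt)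
  then show ?thesis
    using m y by (simp add: q_def[symmetric] w_def[symmetric] field_simps)
qed

text \<open>The third moment dominates the mean termwise, so the \<open>infsum\<close> in
  \<open>T_gel\<close> is a genuine sum and not the default value 0 of a divergent one. The mean is
  at least 1 because all sizes are.\<close>

lemma T_gel_inverse:
  assumes "\<And>l. l \<ge> 1 \<Longrightarrow> p l \<ge> 0" "(p has_sum 1) {1..}" "(\<lambda>l. real l ^ 3 * p l) summable_on {1..}"
  obtains m where "((\<lambda>l. real l * p l) has_sum m) {1..}" "m \<ge> 1" "T_gel p = inverse m"
proof -
  have "(\<lambda>l. real l * p l) summable_on {1..}"
  proof (rule summable_on_comparison_test[OF assms(3)])
    fix l :: nat assume l: "l \<in> {1..}"
    then have "real l ^ 1 \<le> real l ^ 3" by (intro power_increasing) auto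
    then show "real l * p l \<le> real l ^ 3 * p l"
      using assms(1)[of l] l by (intro mult_right_mono) auto
    show "0 \<le> real l * p l" using assms(1)[of l] l by simp
  qed
  then obtain m where m: "((\<lambda>l. real l * p l) has_sum m) {1..}"
    by (auto simp: summable_on_def)
  have "1 \<le> m"
  proof (rule has_sum_mono[OF assms(2) m])
    fix l :: nat assume "l \<in> {1..}"
    then show "p l \<le> real l * p l"
      using assms(1)[of l] mult_right_mono[of 1 "real l" "p l"] by auto
  qed
  moreover have "T_gel p = inverse m"
    unfolding T_gel_def using infsumI[OF m] by simp
  ultimately show ?thesis using m that by blast
qed

end

section \<open>The characteristics as functions of their end point\<close>

locale forest_fire_characteristics = forest_fire +
  fixes \<psi> :: "real \<Rightarrow> real \<Rightarrow> real"
  assumes p_nonneg: "\<And>l. l \<ge> 1 \<Longrightarrow> p l \<ge> 0"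
    and p_has_sum: "(p has_sum 1) {1..}"
    and p_third_moment: "(\<lambda>l. real l ^ 3 * p l) summable_on {1..}"
    and unique_psi: "\<And>y. y > T_gel p \<Longrightarrow> unique_characteristic v y (\<psi> y)"
begin

lemma T_gel_pos: "T_gel p > 0"
  using T_gel_inverse[OF p_nonneg p_has_sum p_third_moment] by (metis inverse_positive_iff_positive less_le_trans zero_less_one)

lemma psi_characteristic: "y > T_gel p \<Longrightarrow> is_characteristic v y (\<psi> y)"
  using unique_psi by (simp add: unique_characteristic_def)

lemma psi_antimono: "T_gel p < y \<Longrightarrow> y \<le> y' \<Longrightarrow> t \<ge> 0 \<Longrightarrow> \<psi> y' t \<le> \<psi> y t"
  using characteristic_antimono[OF unique_psi psi_characteristic, of y y' t] by (cases "y = y'") auto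

lemma psi_bounds: "y > T_gel p \<Longrightarrow> t \<ge> 0 \<Longrightarrow> 0 < \<psi> y t \<and> \<psi> y t \<le> 1"
  using psi_characteristic[of y] by (auto simp: is_characteristic_def)

lemma psi_less_one: "y > T_gel p \<Longrightarrow> t \<ge> 0 \<Longrightarrow> t < y \<Longrightarrow> \<psi> y t < 1"
  using psi_characteristic[of y] by (auto simp: is_characteristic_def)

text \<open>Uniqueness identifies a limit curve with \<open>\<psi> y\<close> as soon as it is a
  characteristic at all; this replaces any quantitative estimate of the dependence on y.\<close>

lemma psi_limit_unique:
  assumes "y > T_gel p" "\<And>n. z n > T_gel p" "z \<longlonglongrightarrow> y"
    and "\<And>t. t \<ge> 0 \<Longrightarrow> (\<lambda>n. \<psi> (z n) t) \<longlonglongrightarrow> \<rho> t"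
    and "\<And>t. t \<ge> 0 \<Longrightarrow> \<rho> t > 0" and "\<And>t. t \<ge> 0 \<Longrightarrow> t < y \<Longrightarrow> \<rho> t < 1" and "t \<ge> 0"
  shows "(\<lambda>n. \<psi> (z n) t) \<longlonglongrightarrow> \<psi> y t"
proof -
  have "is_characteristic v y \<rho>"
    by (rule characteristic_limit[where z=z and \<phi>="\<lambda>n. \<psi> (z n)"])
      (use assms psi_characteristic in auto)
  then have "\<rho> t = \<psi> y t"
    using unique_psi[OF assms(1)] assms(7) by (simp add: unique_characteristic_def)
  then show ?thesis using assms(4)[OF assms(7)] by simp
qed

text \<open>The curves increase with n and stay below \<open>\<psi> y\<close>. The first of them
  keeps the limit positive, and \<open>\<psi> y\<close> keeps it below 1.\<close>

lemma psi_limit_decseq: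
  assumes y: "y > T_gel p" and z: "decseq z" "z \<longlonglongrightarrow> y" and t: "t \<ge> 0"
  shows "(\<lambda>n. \<psi> (z n) t) \<longlonglongrightarrow> \<psi> y t"
proof -
  have ge: "z n \<ge> y" for n using z by (simp add: decseq_ge)
  have gel: "z n > T_gel p" for n using ge[of n] y by simp
  have inc: "incseq (\<lambda>n. \<psi> (z n) t)" if "t \<ge> 0" for t
    using z(1) gel that by (auto simp: incseq_def decseq_def intro!: psi_antimono)
  have le: "\<psi> (z n) t \<le> \<psi> y t" if "t \<ge> 0" for n t
    by (rule psi_antimono) (use ge y that in auto)
  have "\<exists>l. (\<lambda>n. \<psi> (z n) t) \<longlonglongrightarrow> l" if "t \<ge> 0" for t
    using incseq_convergent[OF inc[OF that], of "\<psi> y t"] le that by metis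
  then obtain \<rho> where \<rho>: "\<And>t. t \<ge> 0 \<Longrightarrow> (\<lambda>n. \<psi> (z n) t) \<longlonglongrightarrow> \<rho> t" by metis
  show ?thesis
  proof (rule psi_limit_unique[OF y gel z(2) \<rho> _ _ t])
    fix t :: real assume t: "t \<ge> 0"
    have "\<psi> (z 0) t \<le> \<rho> t" by (rule incseq_le[OF inc \<rho>]) (use t in auto)
    then show "\<rho> t > 0" using psi_bounds[OF gel t, of 0] by simp
    have "\<rho> t \<le> \<psi> y t" by (rule LIMSEQ_le_const2[OF \<rho>]) (use t le in auto)
    then show "\<rho> t < 1" if "t < y" using psi_less_one[OF y t that] by simp
  qed
qed

text \<open>The curves decrease and stay above \<open>\<psi> y\<close>, which settles positivity of
  the limit. That it is below 1 at a time t < y follows from any single curve with t <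
  \<open>z n\<close>.\<close>

lemma psi_limit_incseq:
  assumes y: "y > T_gel p" and z: "incseq z" "z \<longlonglongrightarrow> y" and gel: "\<And>n. z n > T_gel p" and t: "t \<ge> 0"
  shows "(\<lambda>n. \<psi> (z n) t) \<longlonglongrightarrow> \<psi> y t"
proof -
  have ge: "z n \<le> y" for n using z by (simp add: incseq_le)
  have dec: "decseq (\<lambda>n. \<psi> (z n) t)" if "t \<ge> 0" for t
    using z(1) gel that by (auto simp: incseq_def decseq_def intro!: psi_antimono)
  have le: "\<psi> y t \<le> \<psi> (z n) t" if "t \<ge> 0" for n t
    by (rule psi_antimono) (use ge gel that in auto)
  have "\<exists>l. (\<lambda>n. \<psi> (z n) t) \<longlonglongrightarrow> l" if "t \<ge> 0" for t
    using decseq_convergent[OF dec[OF that], of "\<psi> y t"] le that by metis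
  then obtain \<rho> where \<rho>: "\<And>t. t \<ge> 0 \<Longrightarrow> (\<lambda>n. \<psi> (z n) t) \<longlonglongrightarrow> \<rho> t" by metis
  show ?thesis
  proof (rule psi_limit_unique[OF y gel z(2) \<rho> _ _ t])
    fix t :: real assume t: "t \<ge> 0"
    have "\<psi> y t \<le> \<rho> t" by (rule LIMSEQ_le_const[OF \<rho>]) (use t le in auto)
    then show "\<rho> t > 0" using psi_bounds[OF y t] by simp
    assume "t < y"
    then obtain n where n: "t < z n"
      using order_tendstoD(1)[OF z(2)] by (auto simp: eventually_sequentially)
    have "\<rho> t \<le> \<psi> (z n) t" by (rule decseq_ge[OF dec \<rho>]) (use t in auto)
    then show "\<rho> t < 1" using psi_less_one[OF gel t n] by simp
  qed
qed

text \<open>With m the inverse of \<open>T_gel p\<close>, the lower bound 2/(m y) - 1 equals 1 at y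
  = \<open>T_gel p\<close>, so the square roots of the initial values are squeezed to 1.\<close>

lemma psi_initial_limit:
  assumes z: "\<And>n. z n > T_gel p" "z \<longlonglongrightarrow> T_gel p"
  shows "(\<lambda>n. \<psi> (z n) 0) \<longlonglongrightarrow> 1"
proof -
  obtain m where m: "((\<lambda>l. real l * p l) has_sum m) {1..}" "m \<ge> 1" "T_gel p = inverse m"
    using T_gel_inverse[OF p_nonneg p_has_sum p_third_moment] .
  have lower: "2 / (m * z n) - 1 \<le> sqrt (\<psi> (z n) 0)" for n
    by (rule characteristic_initial_lower_bound[OF psi_characteristic[OF z(1)] _ m(1)])
      (use z(1)[of n] T_gel_pos m(2) in auto)
  have "(\<lambda>n. 2 / (m * z n) - 1) \<longlonglongrightarrow> 2 / (m * T_gel p) - 1"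
    by (intro tendsto_intros z) (use m T_gel_pos in auto)
  then have lim: "(\<lambda>n. 2 / (m * z n) - 1) \<longlonglongrightarrow> 1" using m by simp
  have "(\<lambda>n. sqrt (\<psi> (z n) 0)) \<longlonglongrightarrow> 1"
    by (rule tendsto_sandwich[OF _ _ lim tendsto_const])
      (use lower psi_bounds[OF z(1)] in auto)
  then have "(\<lambda>n. sqrt (\<psi> (z n) 0) ^ 2) \<longlonglongrightarrow> 1 ^ 2" by (intro tendsto_power)
  then show ?thesis using psi_bounds[OF z(1)] by (simp add: less_imp_le)
qed

end

subsection \<open>Paths in the state space\<close>

lemma fE_nonneg: "0 \<le> fE i"
  by (simp add: fE_def)

lemma fE_inj: "i \<ge> 1 \<Longrightarrow> j \<ge> 1 \<Longrightarrow> fE i = fE j \<longleftrightarrow> i = j"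
  by (auto simp: fE_def)

lemma fE_eq_0: "i \<ge> 1 \<Longrightarrow> fE i = 0 \<longleftrightarrow> i = 1"
  by (auto simp: fE_def)

text \<open>The number 1/(j (j+1)) is the distance from 1/j to 1/(j+1), the nearest other point;
  smaller states and the state 1, placed at 0, are no closer.\<close>

lemma fE_isolated:
  assumes i: "i \<ge> 1" and j: "j \<ge> 2" and near: "\<bar>fE i - fE j\<bar> < 1 / (real j * (real j + 1))"
  shows "i = j"
proof (rule ccontr)
  assume ne: "i \<noteq> j"
  have j0: "real j > 0" using j by simp
  consider "i = 1" | "i \<ge> 2" "i < j" | "i > j" using ne i by linarith
  then show False
  proof cases
    case 1
    have "real j * 1 \<le> real j * (real j + 1)"
      using j0 by (intro mult_left_mono) auto
    then have "1 / (real j * (real j + 1)) \<le> 1 / real j"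
      using j0 by (intro frac_le) auto
    moreover have "\<bar>fE i - fE j\<bar> = 1 / real j"
      using 1 j by (simp add: fE_def)
    ultimately show False using near by linarith
  next
    case 2
    have i0: "real i > 0" "real i + 1 \<le> real j" using 2 by auto
    have "1 / (real j * (real j + 1)) \<le> 1 / (real i * real j)"
      using i0 j0 by (intro divide_left_mono) (auto simp: mult.commute intro!: mult_left_mono)
    also have "\<dots> \<le> (real j - real i) / (real i * real j)"
      using i0 j0 by (intro divide_right_mono) auto
    also have "\<dots> = 1 / real i - 1 / real j"
      using i0 j0 by (simp add: field_simps)
    also have "\<dots> \<le> \<bar>fE i - fE j\<bar>"
      using 2 j by (simp add: fE_def)
    finally show False using near by linarith
  next
    case 3
    have i0: "real i > 0" "real j + 1 \<le> real i" using 3 j by auto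
    have "1 / (real j * (real j + 1)) = 1 / real j - 1 / (real j + 1)"
      using j0 by (simp add: field_simps)
    also have "\<dots> \<le> 1 / real j - 1 / real i"
      using i0 j0 by (intro diff_left_mono divide_left_mono) auto
    also have "\<dots> \<le> \<bar>fE i - fE j\<bar>"
      using 3 j by (simp add: fE_def)
    finally show False using near by linarith
  qed
qed

lemma countable_Rats_Int: "countable (\<rat> \<inter> (S :: real set))"
  by (rule countable_subset[OF Int_lower1 countable_rat])

lemma rational_between_01:
  fixes a b :: real
  assumes "a < b" "0 \<le> a" "b \<le> 1"
  obtains x where "x \<in> \<rat> \<inter> {0..1}" "a < x" "x < b"
  using Rats_dense_in_real[OF assms(1)] assms by force

lemma pred_eq_nat:
  fixes f g :: "'a \<Rightarrow> nat"
  assumes "f \<in> measurable M (count_space UNIV)" "g \<in> measurable M (count_space UNIV)"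
  shows "Measurable.pred M (\<lambda>x. f x = g x)"
proof -
  have "Measurable.pred M (\<lambda>x. \<exists>k. g x = k \<and> f x = k)"
    by (intro pred_intros_countable(2) pred_intros_logic(3) pred_count_space_const1 assms)
  then show ?thesis by simp
qed

text \<open>One fixed sample path with the properties that hold at every sample point. The arguments
  are deterministic and reduce path events to countably many times, which is what measurability
  requires later.\<close>

locale E_path =
  fixes C :: "real \<Rightarrow> 'w \<Rightarrow> nat" and \<omega> :: 'w
  assumes path_state: "t \<ge> 0 \<Longrightarrow> C t \<omega> \<ge> 1"
    and path_cadlag: "cadlag_E (\<lambda>t. C t \<omega>)"
    and path_accumulation: "t > 0 \<Longrightarrow>
      (\<And>s. 0 \<le> s \<Longrightarrow> s < t \<Longrightarrow> \<not> (\<lambda>u. C u \<omega>) constant_on {s<..<t}) \<Longrightarrow> C t \<omega> = 1"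
begin

lemma right_continuous:
  assumes "t \<ge> 0"
  shows "((\<lambda>u. fE (C u \<omega>)) \<longlongrightarrow> fE (C t \<omega>)) (at_right t)"
proof (rule tendstoI)
  fix e :: real assume "e > 0"
  have "limitin E.mtopology (\<lambda>u. C u \<omega>) (C t \<omega>) (at_right t)"
    using path_cadlag assms by (simp add: cadlag_E_def)
  then have "\<forall>\<^sub>F u in at_right t. C u \<omega> \<in> {1..} \<and> dE (C u \<omega>) (C t \<omega>) < e"
    using \<open>e > 0\<close> unfolding E.limitin_metric by blast
  then show "\<forall>\<^sub>F u in at_right t. dist (fE (C u \<omega>)) (fE (C t \<omega>)) < e"
    by (rule eventually_mono) (simp add: dE_def dist_real_def)
qed

lemma left_limit:
  assumes "t > 0"
  obtains i where "i \<ge> 1" "((\<lambda>u. fE (C u \<omega>)) \<longlongrightarrow> fE i) (at_left t)"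
proof -
  obtain i where i: "limitin E.mtopology (\<lambda>u. C u \<omega>) i (at_left t)"
    using path_cadlag assms unfolding cadlag_E_def by blast
  have "i \<ge> 1" using i unfolding E.limitin_metric by simp
  moreover have "((\<lambda>u. fE (C u \<omega>)) \<longlongrightarrow> fE i) (at_left t)"
  proof (rule tendstoI)
    fix e :: real assume "e > 0"
    then have "\<forall>\<^sub>F u in at_left t. C u \<omega> \<in> {1..} \<and> dE (C u \<omega>) i < e"
      using i unfolding E.limitin_metric by blast
    then show "\<forall>\<^sub>F u in at_left t. dist (fE (C u \<omega>)) (fE i) < e"
      by (rule eventually_mono) (simp add: dE_def dist_real_def)
  qed
  ultimately show ?thesis by (rule that)
qed

text \<open>This form of right continuity is also available at the state 1, where the path need not
  rest: it may leave through arbitrarily large states, but it avoids any fixed other state for a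
  while.\<close>

lemma eventually_right_ne:
  assumes t: "t \<ge> 0" and j: "j \<ge> 1" "C t \<omega> \<noteq> j"
  obtains d where "d > 0" "\<And>u. t \<le> u \<Longrightarrow> u < t + d \<Longrightarrow> C u \<omega> \<noteq> j"
proof -
  have "fE (C t \<omega>) \<noteq> fE j" using fE_inj[OF path_state[OF t] j(1)] j(2) by simp
  then have "\<forall>\<^sub>F u in at_right t. fE (C u \<omega>) \<noteq> fE j"
    by (rule tendsto_imp_eventually_ne[OF right_continuous[OF t]])
  then obtain b where b: "b > t" "\<And>u. t < u \<Longrightarrow> u < b \<Longrightarrow> fE (C u \<omega>) \<noteq> fE j"
    by (auto simp: eventually_at_right_field)
  show ?thesis
  proof (rule that[of "b - t"])
    fix u assume "t \<le> u" "u < t + (b - t)"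
    then show "C u \<omega> \<noteq> j" using b(2)[of u] j(2) by (cases "u = t") auto
  qed (use b in simp)
qed

text \<open>States other than 1 are isolated, so right continuity there is constancy on an interval
  to the right.\<close>

lemma eventually_right_eq:
  assumes t: "t \<ge> 0" and j: "C t \<omega> \<noteq> 1"
  obtains d where "d > 0" "\<And>u. t \<le> u \<Longrightarrow> u < t + d \<Longrightarrow> C u \<omega> = C t \<omega>"
proof -
  define j where "j = C t \<omega>"
  have j2: "j \<ge> 2" using path_state[OF t] j by (simp add: j_def)
  have "1 / (real j * (real j + 1)) > 0" using j2 by simp
  from tendstoD[OF right_continuous[OF t] this]
  obtain b where b: "b > t" "\<And>u. t < u \<Longrightarrow> u < b \<Longrightarrow> \<bar>fE (C u \<omega>) - fE j\<bar> < 1 / (real j * (real j + 1))"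
    by (auto simp: eventually_at_right_field dist_real_def j_def)
  show ?thesis
  proof (rule that[of "b - t"])
    fix u assume u: "t \<le> u" "u < t + (b - t)"
    show "C u \<omega> = C t \<omega>"
    proof (cases "u = t")
      case False
      then show ?thesis
        using fE_isolated[OF path_state j2 b(2)] u t by (simp add: j_def)
    qed simp
  qed (use b in simp)
qed

text \<open>Times are written as a + x (b - a) with rational x because a will often be a random
  time, while the countable index set must be the same for all paths. At t = b there is no room to
  the right inside the interval; x = 1 is the witness there.\<close>

lemma rational_witness:
  fixes a b t d :: real
  assumes ab: "0 \<le> a" "a \<le> b" and t: "a \<le> t" "t \<le> b" and d: "d > 0"
    and P: "\<And>u. t \<le> u \<Longrightarrow> u < t + d \<Longrightarrow> P u"
  obtains x where "x \<in> \<rat> \<inter> {0..1}" "t \<le> a + x * (b - a)" "P (a + x * (b - a))"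
    "a + x * (b - a) \<le> t + d"
proof (cases "t = b")
  case True
  show ?thesis by (rule that[of 1]) (use True d P[of t] in auto)
next
  case False
  then have tb: "t < b" "b - a > 0" using t by auto
  define l where "l = (t - a) / (b - a)"
  define r where "r = min 1 ((t + d - a) / (b - a))"
  have "l < r" "0 \<le> l" "r \<le> 1"
    using tb t d by (auto simp: l_def r_def divide_strict_right_mono)
  then obtain x where x: "x \<in> \<rat> \<inter> {0..1}" "l < x" "x < r"
    by (rule rational_between_01)
  have "t - a < x * (b - a)" using x(2) tb by (simp add: l_def pos_divide_less_eq)
  moreover have "x * (b - a) < t + d - a"
    using x(3) tb by (simp add: r_def pos_less_divide_eq)
  ultimately show ?thesis using that[OF x(1)] P[of "a + x * (b - a)"] by simp
qed

text \<open>A path that is not at 1 at time t has no accumulation of jumps at t, so it is constant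
  just before t, and the constant has to be the left limit.\<close>

lemma left_limit_one:
  assumes t: "t > 0" and lim: "((\<lambda>u. fE (C u \<omega>)) \<longlongrightarrow> 0) (at_left t)" and ne: "C t \<omega> \<noteq> 1"
  obtains s where "0 \<le> s" "s < t" "\<And>u. s < u \<Longrightarrow> u < t \<Longrightarrow> C u \<omega> = 1"
proof -
  obtain s where s: "0 \<le> s" "s < t" "(\<lambda>u. C u \<omega>) constant_on {s<..<t}"
    using path_accumulation[OF t] ne by blast
  then obtain k where k: "\<And>u. u \<in> {s<..<t} \<Longrightarrow> C u \<omega> = k"
    by (auto simp: constant_on_def)
  have "k \<ge> 1" using k[of "(s+t)/2"] path_state[of "(s+t)/2"] s by auto
  have "((\<lambda>u. fE k) \<longlongrightarrow> 0) (at_left t)"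
    by (rule Lim_transform_eventually[OF lim])
      (use k s in \<open>auto simp: eventually_at_left_field intro!: exI[of _ s]\<close>)
  then have "fE k = 0" by (simp add: tendsto_const_iff)
  then have "k = 1" using fE_eq_0[OF \<open>k \<ge> 1\<close>] by simp
  then show ?thesis using that[OF s(1,2)] k by auto
qed

text \<open>To the right of l the path rests in an isolated state. To the left it has a limit other
  than 1, since a left limit 1 would force actual visits to 1. Compactness of [a,b] turns this local
  bound into a global one later.\<close>

lemma bounded_away:
  assumes ab: "0 \<le> a" "a \<le> b" and no: "\<And>t. a \<le> t \<Longrightarrow> t \<le> b \<Longrightarrow> C t \<omega> \<noteq> 1"
    and l: "a \<le> l" "l \<le> b"
  obtains d e where "d > 0" "e > 0" "\<And>u. a \<le> u \<Longrightarrow> u \<le> b \<Longrightarrow> \<bar>u - l\<bar> < d \<Longrightarrow> e \<le> fE (C u \<omega>)"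
proof -
  have l0: "l \<ge> 0" using ab l by simp
  define e1 where "e1 = fE (C l \<omega>)"
  have e1: "e1 > 0"
    using no[OF l] fE_eq_0[OF path_state[OF l0]] fE_nonneg[of "C l \<omega>"] by (simp add: e1_def)
  obtain d1 where d1: "d1 > 0" "\<And>u. l \<le> u \<Longrightarrow> u < l + d1 \<Longrightarrow> C u \<omega> = C l \<omega>"
    using eventually_right_eq[OF l0 no[OF l]] by blast
  show ?thesis
  proof (cases "a = l")
    case True
    show ?thesis
    proof (rule that[OF d1(1) e1])
      fix u assume "a \<le> u" "\<bar>u - l\<bar> < d1"
      then have "C u \<omega> = C l \<omega>" using True by (intro d1(2)) auto
      then show "e1 \<le> fE (C u \<omega>)" by (simp add: e1_def)
    qed
  next
    case False
    then have "l > 0" "a < l" using l ab by auto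
    from left_limit[OF \<open>l > 0\<close>] obtain i
      where i: "i \<ge> 1" "((\<lambda>u. fE (C u \<omega>)) \<longlongrightarrow> fE i) (at_left l)" .
    have "fE i \<noteq> 0"
    proof
      assume "fE i = 0"
      then obtain s where s: "0 \<le> s" "s < l" "\<And>u. s < u \<Longrightarrow> u < l \<Longrightarrow> C u \<omega> = 1"
        using left_limit_one[OF \<open>l > 0\<close> _ no[OF l]] i(2) by metis
      obtain u where "max s a < u" "u < l" using dense[of "max s a" l] s \<open>a < l\<close> by auto
      then show False using s(3)[of u] no[of u] l by auto
    qed
    then have pos: "fE i / 2 < fE i" "fE i > 0" using fE_nonneg[of i] by auto
    obtain b' where b': "b' < l" "\<And>u. b' < u \<Longrightarrow> u < l \<Longrightarrow> fE i / 2 < fE (C u \<omega>)"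
      using order_tendstoD(1)[OF i(2) pos(1)] unfolding eventually_at_left_field by blast
    show ?thesis
    proof (rule that[of "min d1 (l - b')" "min e1 (fE i / 2)"])
      fix u assume u: "a \<le> u" "u \<le> b" "\<bar>u - l\<bar> < min d1 (l - b')"
      show "min e1 (fE i / 2) \<le> fE (C u \<omega>)"
      proof (cases "l \<le> u")
        case True
        then have "C u \<omega> = C l \<omega>" using u by (intro d1(2)) auto
        then show ?thesis by (simp add: e1_def)
      next
        case False
        then have "fE i / 2 < fE (C u \<omega>)" using u by (intro b'(2)) auto
        then show ?thesis by linarith
      qed
    qed (use d1(1) b'(1) e1 pos in simp_all)
  qed
qed

section \<open>Path events expressed through countably many times\<close>

text \<open>Times at which the state comes ever closer to 1 have a limit point l in [a,b], and near
  l a path without visits to 1 would stay away from 1. Conversely a visit to 1 is approached from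
  the right, or lies at b, which is itself among the times consulted.\<close>

lemma hits_one_iff:
  assumes ab: "0 \<le> a" "a \<le> b"
  shows "(\<exists>t\<in>{a..b}. C t \<omega> = 1) \<longleftrightarrow>
    (\<forall>m::nat. \<exists>x\<in>\<rat> \<inter> {0..1}. fE (C (a + x * (b - a)) \<omega>) < 1 / (real m + 1))"
proof (intro iffI allI)
  fix m :: nat
  assume "\<exists>t\<in>{a..b}. C t \<omega> = 1"
  then obtain t where t: "a \<le> t" "t \<le> b" "C t \<omega> = 1" by auto
  then have "t \<ge> 0" using ab by simp
  have "\<forall>\<^sub>F u in at_right t. fE (C u \<omega>) < 1 / (real m + 1)"
    by (rule order_tendstoD(2)[OF right_continuous[OF \<open>t \<ge> 0\<close>]]) (simp add: t fE_def)
  then obtain r where r: "r > t" "\<And>u. t < u \<Longrightarrow> u < r \<Longrightarrow> fE (C u \<omega>) < 1 / (real m + 1)"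
    by (auto simp: eventually_at_right_field)
  have r': "fE (C u \<omega>) < 1 / (real m + 1)" if "t \<le> u" "u < t + (r - t)" for u
    using r(2)[of u] that t(3) by (cases "u = t") (auto simp: fE_def)
  obtain x where "x \<in> \<rat> \<inter> {0..1}" "fE (C (a + x * (b - a)) \<omega>) < 1 / (real m + 1)"
    by (rule rational_witness[where P = "\<lambda>u. fE (C u \<omega>) < 1 / (real m + 1)" and d = "r - t", OF ab t(1,2) _ r'])
      (use r(1) in simp_all)
  then show "\<exists>x\<in>\<rat> \<inter> {0..1}. fE (C (a + x * (b - a)) \<omega>) < 1 / (real m + 1)" by blast
next
  assume "\<forall>m::nat. \<exists>x\<in>\<rat> \<inter> {0..1}. fE (C (a + x * (b - a)) \<omega>) < 1 / (real m + 1)"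
  then obtain x where x: "\<And>m::nat. x m \<in> \<rat> \<inter> {0..1}"
    "\<And>m. fE (C (a + x m * (b - a)) \<omega>) < 1 / (real m + 1)"
    by metis
  define t where "t m = a + x m * (b - a)" for m
  have t: "t m \<in> {a..b}" for m
  proof -
    have "x m * (b - a) \<le> b - a" "0 \<le> x m * (b - a)"
      using x(1)[of m] ab by (auto intro!: mult_left_le_one_le)
    then show ?thesis by (simp add: t_def)
  qed
  obtain l r where l: "l \<in> {a..b}" "strict_mono r" "(t \<circ> r) \<longlonglongrightarrow> l"
    using compact_Icc[of a b] t unfolding compact_def by metis
  show "\<exists>t\<in>{a..b}. C t \<omega> = 1"
  proof (rule ccontr)
    assume "\<not> ?thesis"
    then obtain d e where de: "d > 0" "e > 0"
      "\<And>u. a \<le> u \<Longrightarrow> u \<le> b \<Longrightarrow> \<bar>u - l\<bar> < d \<Longrightarrow> e \<le> fE (C u \<omega>)"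
      using bounded_away[OF ab _, of l] l(1) by (metis atLeastAtMost_iff)
    have "(\<lambda>m. 1 / (real (r m) + 1)) \<longlonglongrightarrow> 0"
      using LIMSEQ_subseq_LIMSEQ[OF LIMSEQ_inverse_real_of_nat l(2)]
      by (simp add: o_def divide_inverse add.commute)
    then have "\<forall>\<^sub>F m in sequentially. 1 / (real (r m) + 1) < e"
      by (rule order_tendstoD(2)) (rule de)
    moreover have "\<forall>\<^sub>F m in sequentially. dist ((t \<circ> r) m) l < d"
      by (rule tendstoD[OF l(3) de(1)])
    ultimately have "\<forall>\<^sub>F m in sequentially. 1 / (real (r m) + 1) < e \<and> dist ((t \<circ> r) m) l < d"
      by (rule eventually_conj)
    then obtain m where m: "1 / (real (r m) + 1) < e" "dist ((t \<circ> r) m) l < d"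
      by (auto simp: eventually_sequentially)
    have "e \<le> fE (C (t (r m)) \<omega>)"
      using de(3)[of "t (r m)"] t[of "r m"] m(2) by (simp add: dist_real_def)
    then show False using x(2)[of "r m"] m(1) unfolding t_def by simp
  qed
qed

text \<open>By right continuity the infimum of the visits to 1 is itself a visit.\<close>

lemma first_hit:
  assumes a: "0 \<le> a" and hit: "t \<ge> a" "C t \<omega> = 1"
  obtains t' where "a \<le> t'" "t' \<le> t" "C t' \<omega> = 1" "\<And>u. a \<le> u \<Longrightarrow> u < t' \<Longrightarrow> C u \<omega> \<noteq> 1"
proof -
  define Z where "Z = {u. a \<le> u \<and> C u \<omega> = 1}"
  have Z: "t \<in> Z" "bdd_below Z" using hit by (auto simp: Z_def intro!: bdd_belowI[of _ a])
  define t' where "t' = Inf Z"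
  have le: "t' \<le> u" if "u \<in> Z" for u unfolding t'_def by (rule cInf_lower[OF that Z(2)])
  have ge: "a \<le> t'" unfolding t'_def by (rule cInf_greatest) (use Z in \<open>auto simp: Z_def\<close>)
  show ?thesis
  proof (rule that[OF ge le[OF Z(1)]])
    show "C t' \<omega> = 1"
    proof (rule ccontr)
      assume ne: "C t' \<omega> \<noteq> 1"
      obtain d where d: "d > 0" "\<And>u. t' \<le> u \<Longrightarrow> u < t' + d \<Longrightarrow> C u \<omega> \<noteq> 1"
        using eventually_right_ne[of t' 1] ne ge a by auto
      have "t' + d \<le> t'"
        unfolding t'_def
      proof (rule cInf_greatest)
        fix u assume u: "u \<in> Z"
        show "Inf Z + d \<le> u"
          using d(2)[of u] le[OF u] u unfolding t'_def Z_def by force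
      qed (use Z in auto)
      then show False using d(1) by simp
    qed
    fix u assume u: "a \<le> u" "u < t'"
    then show "C u \<omega> \<noteq> 1" using le[of u] by (auto simp: Z_def)
  qed
qed

text \<open>An explosion is the first visit to 1 after some rational time q at which the path is
  elsewhere. That this visit is not before s is expressed with closed intervals ending at s -
  1/(n+1), so that only hitting events of closed intervals occur.\<close>

lemma explodes_during_Icc_iff:
  assumes s: "0 \<le> s"
  shows "explodes_during C \<omega> {s..y} \<longleftrightarrow>
    (\<exists>q\<in>\<rat> \<inter> {0..y}. C q \<omega> \<noteq> 1 \<and> (\<exists>t\<in>{q..y}. C t \<omega> = 1) \<and>
       (\<forall>n::nat. q \<le> s - 1 / (real n + 1) \<longrightarrow> \<not> (\<exists>t\<in>{q..s - 1 / (real n + 1)}. C t \<omega> = 1)))"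
    (is "_ \<longleftrightarrow> (\<exists>q\<in>_. ?P q)")
proof
  assume "explodes_during C \<omega> {s..y}"
  then obtain t e where t: "s \<le> t" "t \<le> y" "t > 0" "C t \<omega> = 1" "e > 0"
    "\<And>u. u \<in> {t - e<..<t} \<Longrightarrow> u \<ge> 0 \<Longrightarrow> C u \<omega> \<noteq> 1"
    by (auto simp: explodes_during_def explodes_at_def)
  obtain q where q: "q \<in> \<rat>" "max 0 (t - e) < q" "q < t"
    using Rats_dense_in_real[of "max 0 (t - e)" t] t by auto
  have ne: "C u \<omega> \<noteq> 1" if "q \<le> u" "u < t" for u
    using t(6)[of u] that q by auto
  have "?P q"
  proof (intro conjI allI impI)
    show "C q \<omega> \<noteq> 1" using ne q by auto
    show "\<exists>t\<in>{q..y}. C t \<omega> = 1" using t q by (intro bexI[of _ t]) auto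
    fix n :: nat
    have "s - 1 / (real n + 1) < t" using t by (simp add: less_le_trans[of _ s])
    then show "\<not> (\<exists>t\<in>{q..s - 1 / (real n + 1)}. C t \<omega> = 1)"
      using ne by (meson atLeastAtMost_iff le_less_trans)
  qed
  then show "\<exists>q\<in>\<rat> \<inter> {0..y}. ?P q" using q t by (intro bexI[of _ q]) auto
next
  assume "\<exists>q\<in>\<rat> \<inter> {0..y}. ?P q"
  then obtain q where "q \<in> \<rat> \<inter> {0..y}" "?P q" by blast
  then have q: "0 \<le> q" "C q \<omega> \<noteq> 1" and ex: "\<exists>t\<in>{q..y}. C t \<omega> = 1"
    and no': "\<forall>n::nat. q \<le> s - 1 / (real n + 1) \<longrightarrow> \<not> (\<exists>t\<in>{q..s - 1 / (real n + 1)}. C t \<omega> = 1)"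
    by simp_all
  from ex obtain t0 where t0: "q \<le> t0" "t0 \<le> y" "C t0 \<omega> = 1" by auto
  have no: "C t \<omega> \<noteq> 1" if "q \<le> t" "t \<le> s - 1 / (real n + 1)" for n :: nat and t
    using no' that by (meson atLeastAtMost_iff order_trans)
  obtain t where t: "q \<le> t" "t \<le> t0" "C t \<omega> = 1" "\<And>u. q \<le> u \<Longrightarrow> u < t \<Longrightarrow> C u \<omega> \<noteq> 1"
    using first_hit[OF q(1) t0(1,3)] by blast
  have "q < t" using q t by (cases "q = t") auto
  have "s \<le> t"
  proof (rule ccontr)
    assume "\<not> s \<le> t"
    then obtain n :: nat where "1 / (real n + 1) < s - t"
      using reals_Archimedean[of "s - t"] by (auto simp: divide_inverse add.commute)
    then show False using no[of t n] t by simp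
  qed
  have "explodes_at C \<omega> t"
    unfolding explodes_at_def
  proof (intro conjI exI[of _ "t - q"] ballI impI)
    fix u assume "u \<in> {t - (t - q)<..<t}"
    then show "C u \<omega> \<noteq> 1" using t(4) by simp
  qed (use \<open>q < t\<close> q t in auto)
  then show "explodes_during C \<omega> {s..y}"
    using \<open>s \<le> t\<close> t t0 by (auto simp: explodes_during_def)
qed

lemma next_jump_ge: "a \<ge> 0 \<Longrightarrow> next_jump C a \<omega> \<ge> a"
  unfolding next_jump_def by (auto intro!: cInf_greatest)

lemma next_jump_le:
  assumes "a < u" "C u \<omega> \<noteq> C a \<omega>"
  shows "next_jump C a \<omega> \<le> u"
proof -
  have "Inf {u. a < u \<and> C u \<omega> \<noteq> C a \<omega>} \<le> u"
    by (rule cInf_lower) (use assms in \<open>auto intro!: bdd_belowI[of _ a]\<close>)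
  then show ?thesis using assms by (auto simp: next_jump_def)
qed

lemma constant_before_next_jump:
  assumes "a \<le> u" "u < next_jump C a \<omega>"
  shows "C u \<omega> = C a \<omega>"
  using next_jump_le[of a u] assms by (cases "u = a") force+

text \<open>The first conjunct separates a genuine change of state from the dummy value of
  \<open>next_jump\<close>. After a change the path avoids its old state for a while, so the change
  is seen at a rational fraction; x < 1 keeps it strictly before b.\<close>

lemma next_jump_less_iff:
  assumes a: "a \<ge> 0"
  shows "(\<exists>u>a. C u \<omega> \<noteq> C a \<omega>) \<and> next_jump C a \<omega> < b \<longleftrightarrow>
    (\<exists>x\<in>\<rat> \<inter> {0..1}. a < b \<and> C (a + x * (b - a)) \<omega> \<noteq> C a \<omega> \<and> x < 1)"
proof
  assume L: "(\<exists>u>a. C u \<omega> \<noteq> C a \<omega>) \<and> next_jump C a \<omega> < b"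
  then have "Inf {u. a < u \<and> C u \<omega> \<noteq> C a \<omega>} < b"
    unfolding next_jump_def by (simp split: if_splits)
  then obtain u where u: "a < u" "C u \<omega> \<noteq> C a \<omega>" "u < b"
    using cInf_lessD[of "{u. a < u \<and> C u \<omega> \<noteq> C a \<omega>}" b] L by auto
  obtain d where d: "d > 0" "\<And>r. u \<le> r \<Longrightarrow> r < u + d \<Longrightarrow> C r \<omega> \<noteq> C a \<omega>"
    using eventually_right_ne[of u "C a \<omega>"] u a path_state[OF a] by auto
  have d': "C r \<omega> \<noteq> C a \<omega> \<and> r < b" if "u \<le> r" "r < u + min d (b - u)" for r
    using d(2) that by auto
  obtain x where "x \<in> \<rat> \<inter> {0..1}" "C (a + x * (b - a)) \<omega> \<noteq> C a \<omega> \<and> a + x * (b - a) < b"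
    by (rule rational_witness[where P = "\<lambda>r. C r \<omega> \<noteq> C a \<omega> \<and> r < b" and t = u and b = b and d = "min d (b - u)", OF a _ _ _ _ d'])
      (use u d(1) in simp_all)
  moreover from this u have "x < 1" by (cases "x = 1") auto
  ultimately show "\<exists>x\<in>\<rat> \<inter> {0..1}. a < b \<and> C (a + x * (b - a)) \<omega> \<noteq> C a \<omega> \<and> x < 1"
    using u by (intro bexI[of _ x]) auto
next
  assume "\<exists>x\<in>\<rat> \<inter> {0..1}. a < b \<and> C (a + x * (b - a)) \<omega> \<noteq> C a \<omega> \<and> x < 1"
  then obtain x where x: "0 \<le> x" "x < 1" "a < b" "C (a + x * (b - a)) \<omega> \<noteq> C a \<omega>" by auto
  have "x \<noteq> 0" using x by auto
  then have "a < a + x * (b - a)" using x by simp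
  moreover have "a + x * (b - a) < b"
  proof -
    have "x * (b - a) < 1 * (b - a)"
      by (rule mult_strict_right_mono) (use x in simp_all)
    then show ?thesis unfolding mult_1 less_diff_eq by (simp only: add.commute)
  qed
  ultimately show "(\<exists>u>a. C u \<omega> \<noteq> C a \<omega>) \<and> next_jump C a \<omega> < b"
    using x(4) next_jump_le[of a "a + x * (b - a)"] by (intro conjI exI[of _ "a + x * (b - a)"]) auto
qed

lemma constant_Icc_iff:
  assumes "a \<ge> 0" "h \<ge> 0"
  shows "(\<forall>u\<in>{a..a + h}. C u \<omega> = C a \<omega>) \<longleftrightarrow> (\<forall>x\<in>\<rat> \<inter> {0..1}. C (a + x * h) \<omega> = C a \<omega>)"
proof
  assume L: "\<forall>u\<in>{a..a + h}. C u \<omega> = C a \<omega>"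
  show "\<forall>x\<in>\<rat> \<inter> {0..1}. C (a + x * h) \<omega> = C a \<omega>"
  proof
    fix x :: real assume "x \<in> \<rat> \<inter> {0..1}"
    then have "0 \<le> x * h" "x * h \<le> h"
      using assms by (auto intro: mult_left_le_one_le)
    then show "C (a + x * h) \<omega> = C a \<omega>" by (intro bspec[OF L]) simp
  qed
next
  assume R: "\<forall>x\<in>\<rat> \<inter> {0..1}. C (a + x * h) \<omega> = C a \<omega>"
  show "\<forall>u\<in>{a..a + h}. C u \<omega> = C a \<omega>"
  proof (rule ccontr)
    assume "\<not> ?thesis"
    then obtain u where u: "a \<le> u" "u \<le> a + h" "C u \<omega> \<noteq> C a \<omega>" by auto
    obtain d where d: "d > 0" "\<And>r. u \<le> r \<Longrightarrow> r < u + d \<Longrightarrow> C r \<omega> \<noteq> C a \<omega>"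
      by (rule eventually_right_ne[of u "C a \<omega>"]) (use u assms path_state[of a] in auto)
    obtain x where "x \<in> \<rat> \<inter> {0..1}" "C (a + x * (a + h - a)) \<omega> \<noteq> C a \<omega>"
      by (rule rational_witness[OF assms(1) _ u(1,2) d(1), of "\<lambda>r. C r \<omega> \<noteq> C a \<omega>"])
        (use d(2) assms in simp_all)
    then show False using bspec[OF R, of x] by simp
  qed
qed

text \<open>A jump into an isolated state j is pinned between two rational fractions: the path is
  unchanged at all fractions up to x and is in j at x', with x' - x arbitrarily small. Only times in
  [a,b] are consulted, so the path up to b decides the event; this is what makes the exit time a
  stopping time.\<close>

lemma regular_exit_iff:
  assumes ab: "0 \<le> a" "a \<le> b"
  shows "(C (next_jump C a \<omega>) \<omega> \<notin> {1, C a \<omega>} \<and> next_jump C a \<omega> \<le> b) \<longleftrightarrow>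
    (\<exists>j. j \<notin> {1, C a \<omega>} \<and> (\<forall>m::nat. \<exists>x\<in>\<rat> \<inter> {0..1}. \<exists>x'\<in>\<rat> \<inter> {0..1}. x' - x < 1 / (real m + 1) \<and>
       (\<forall>z\<in>\<rat> \<inter> {0..1}. z \<le> x \<longrightarrow> C (a + z * (b - a)) \<omega> = C a \<omega>) \<and> C (a + x' * (b - a)) \<omega> = j))"
    (is "?L \<longleftrightarrow> ?R")
proof
  define w where "w = next_jump C a \<omega>"
  assume ?L
  then have w: "C w \<omega> \<noteq> 1" "C w \<omega> \<noteq> C a \<omega>" "w \<le> b" by (auto simp: w_def)
  have "a \<noteq> w" using w by auto
  then have aw: "a < w" using next_jump_ge[OF ab(1)] by (simp add: w_def)
  have const: "C u \<omega> = C a \<omega>" if "a \<le> u" "u < w" for u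
    using constant_before_next_jump that by (simp add: w_def)
  have ba: "b - a > 0" using aw w by simp
  have w0: "w \<ge> 0" using aw ab by simp
  obtain d where d: "d > 0" "\<And>u. w \<le> u \<Longrightarrow> u < w + d \<Longrightarrow> C u \<omega> = C w \<omega>"
    using eventually_right_eq[OF w0 w(1)] by blast
  define x0 where "x0 = (w - a) / (b - a)"
  have x0: "0 < x0" "x0 \<le> 1" using aw w ba by (auto simp: x0_def)
  have "\<exists>x\<in>\<rat> \<inter> {0..1}. \<exists>x'\<in>\<rat> \<inter> {0..1}. x' - x < 1 / (real m + 1) \<and>
       (\<forall>z\<in>\<rat> \<inter> {0..1}. z \<le> x \<longrightarrow> C (a + z * (b - a)) \<omega> = C a \<omega>) \<and> C (a + x' * (b - a)) \<omega> = C w \<omega>"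
    for m :: nat
  proof -
    \<comment> \<open>The tolerance is split evenly between the two sides of the jump, which sits at
      the fraction \<open>x0\<close>.\<close>
    define e where "e = 1 / (real m + 1) / 2"
    have e: "e > 0" "e + e = 1 / (real m + 1)" by (auto simp: e_def field_simps)
    obtain x where x: "x \<in> \<rat> \<inter> {0..1}" "max 0 (x0 - e) < x" "x < x0"
      by (rule rational_between_01[of "max 0 (x0 - e)" x0]) (use e x0 in auto)
    have lo: "C (a + z * (b - a)) \<omega> = C a \<omega>" if "0 \<le> z" "z \<le> x" for z
    proof (rule const)
      show "a \<le> a + z * (b - a)" using that ba by simp
      have "z < x0" using that x by simp
      then show "a + z * (b - a) < w" using ba by (simp add: x0_def pos_less_divide_eq)
    qed
    have d': "C u \<omega> = C w \<omega> \<and> u < w + e * (b - a)" if "w \<le> u" "u < w + min d (e * (b - a))" for u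
      using that d(2)[of u] by auto
    obtain x' where x': "x' \<in> \<rat> \<inter> {0..1}" "w \<le> a + x' * (b - a)"
      "C (a + x' * (b - a)) \<omega> = C w \<omega>" "a + x' * (b - a) < w + e * (b - a)"
      by (rule rational_witness[where P = "\<lambda>u. C u \<omega> = C w \<omega> \<and> u < w + e * (b - a)"
          and t = w and d = "min d (e * (b - a))", OF ab _ w(3) _ d'])
        (use aw d(1) e(1) ba in simp_all)
    have "(x' - e) * (b - a) < w - a" using x'(4) by (simp add: algebra_simps)
    then have "x' - e < x0" using ba by (simp add: x0_def pos_less_divide_eq)
    then have "x' - x < 1 / (real m + 1)" using x(2) e(2) by simp
    with x(1) x'(1,3) lo show ?thesis
      by (intro bexI[of _ x] bexI[of _ x']) auto
  qed
  with w show ?R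
    by (intro exI[of _ "C w \<omega>"]) blast
next
  assume ?R
  then obtain j x x' where j: "j \<noteq> 1" "j \<noteq> C a \<omega>" and x: "\<And>m. x m \<in> \<rat> \<inter> {0..1}" "\<And>m. x' m \<in> \<rat> \<inter> {0..1}"
    "\<And>m::nat. x' m - x m < 1 / (real m + 1)"
    "\<And>m z. z \<in> \<rat> \<inter> {0..1} \<Longrightarrow> z \<le> x m \<Longrightarrow> C (a + z * (b - a)) \<omega> = C a \<omega>"
    "\<And>m. C (a + x' m * (b - a)) \<omega> = j"
    by (metis insert_iff)
  have "x' 0 \<noteq> 0" "a \<noteq> b" using x(5)[of 0] j by (metis add_0_right mult_zero_left, metis add_0_right diff_self mult_zero_right)
  then have ba: "b - a > 0" using ab by simp
  define w where "w = next_jump C a \<omega>"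
  have x'pos: "x' m > 0" for m
    using x(2)[of m] x(5)[of m] j(2) by (cases "x' m = 0") auto
  have le: "w \<le> a + x' m * (b - a)" for m
    unfolding w_def by (rule next_jump_le) (use x'pos[of m] ba x(5)[of m] j(2) in auto)
  have ge: "a + x m * (b - a) \<le> w" for m
  proof (rule ccontr)
    assume "\<not> a + x m * (b - a) \<le> w"
    then have lt: "w < a + x m * (b - a)" by simp
    have ex: "\<exists>u>a. C u \<omega> \<noteq> C a \<omega>"
      using x'pos[of m] ba x(5)[of m] j(2) by (intro exI[of _ "a + x' m * (b - a)"]) auto
    obtain z where z: "z \<in> \<rat> \<inter> {0..1}" "z < 1"
      "C (a + z * (a + x m * (b - a) - a)) \<omega> \<noteq> C a \<omega>"
      using next_jump_less_iff[OF ab(1), of "a + x m * (b - a)"] lt ex by (auto simp: w_def)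
    \<comment> \<open>A rational fraction of the fraction \<open>x m\<close> is again a rational
      fraction of [a,b], and it does not exceed \<open>x m\<close>, so the path is unchanged
      there.\<close>
    have "z * x m \<in> \<rat> \<inter> {0..1}" using z x(1)[of m] by (auto intro: mult_le_one)
    moreover have "z * x m \<le> x m" using z x(1)[of m] by (auto intro: mult_left_le_one_le)
    ultimately have "C (a + z * x m * (b - a)) \<omega> = C a \<omega>" by (rule x(4))
    then show False using z(3) by (simp add: mult.assoc)
  qed
  have w0: "w \<ge> 0" using next_jump_ge[OF ab(1)] ab by (simp add: w_def)
  have j1: "j \<ge> 1" using x(5)[of 0] path_state[of "a + x' 0 * (b - a)"] x'pos[of 0] ba ab by auto
  \<comment> \<open>Otherwise the path would avoid j for a while after w, although visits to j occur
    arbitrarily soon at or after w.\<close>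
  have "C w \<omega> = j"
  proof (rule ccontr)
    assume "C w \<omega> \<noteq> j"
    then obtain d where d: "d > 0" "\<And>u. w \<le> u \<Longrightarrow> u < w + d \<Longrightarrow> C u \<omega> \<noteq> j"
      using eventually_right_ne[OF w0 j1] by blast
    obtain m :: nat where m: "1 / (real m + 1) < d / (b - a)"
      using reals_Archimedean[of "d / (b - a)"] d ba by (auto simp: divide_inverse add.commute)
    have "(x' m - x m) * (b - a) < d"
      using less_trans[OF x(3) m] ba by (simp only: pos_less_divide_eq)
    then have "a + x' m * (b - a) < w + d" using ge[of m] by (simp add: algebra_simps)
    then show False using d(2)[OF le[of m]] x(5)[of m] by simp
  qed
  moreover have "w \<le> b"
  proof -
    have "x' 0 * (b - a) \<le> b - a"
      by (rule mult_left_le_one_le) (use x(2)[of 0] ba in auto)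
    then show ?thesis using le[of 0] by linarith
  qed
  ultimately show ?L
    using j by (simp add: w_def)
qed

end

subsection \<open>Measurability and stopping times\<close>

lemma (in E_path) right_continuous_LIMSEQ:
  assumes t: "t \<ge> 0" and x: "\<And>n. x n \<ge> t" "x \<longlonglongrightarrow> t"
  shows "(\<lambda>n. fE (C (x n) \<omega>)) \<longlonglongrightarrow> fE (C t \<omega>)"
proof (rule tendstoI)
  fix e :: real assume e: "e > 0"
  obtain b where b: "b > t" "\<And>u. t < u \<Longrightarrow> u < b \<Longrightarrow> dist (fE (C u \<omega>)) (fE (C t \<omega>)) < e"
    using tendstoD[OF right_continuous[OF t] e] unfolding eventually_at_right_field by blast
  have "\<forall>\<^sub>F n in sequentially. x n < b"
    by (rule order_tendstoD(2)[OF x(2) b(1)])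
  then show "\<forall>\<^sub>F n in sequentially. dist (fE (C (x n) \<omega>)) (fE (C t \<omega>)) < e"
  proof (rule eventually_mono)
    fix n assume "x n < b"
    then show "dist (fE (C (x n) \<omega>)) (fE (C t \<omega>)) < e"
      using b(2)[of "x n"] x(1)[of n] e by (cases "x n = t") auto
  qed
qed

text \<open>The next jump time need not be a stopping time of the natural filtration: a path may leave 1
  through arbitrarily large states, which shows only later. Recording only jumps to a new state
  other than 1, an isolated point of \<open>E\<close>, avoids this; almost surely no others occur.\<close>

definition exit_time :: "(real \<Rightarrow> 'w \<Rightarrow> nat) \<Rightarrow> real \<Rightarrow> real \<Rightarrow> 'w \<Rightarrow> real" where
  "exit_time C N a \<omega> =
     (if C (next_jump C a \<omega>) \<omega> \<notin> {1, C a \<omega>} \<and> next_jump C a \<omega> \<le> N then next_jump C a \<omega> else N)"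

context tagged_cluster_process
begin

lemma E_path: "\<omega> \<in> space M \<Longrightarrow> E_path C \<omega>"
  by (rule E_path.intro) (use state cadlag accumulation in blast)+

lemma space_natural_filtration: "space (natural_filtration M C t) = space M"
  unfolding natural_filtration_def by (rule space_measure_of) auto

lemma sets_natural_filtration:
  "sets (natural_filtration M C t) = sigma_sets (space M) {C u -` B \<inter> space M | u B. 0 \<le> u \<and> u \<le> t}"
  unfolding natural_filtration_def by (rule sets_measure_of) auto

lemma sets_natural_filtration_subset: "sets (natural_filtration M C t) \<subseteq> sets M"
  unfolding sets_natural_filtration
  by (rule sets.sigma_sets_subset) (auto intro!: measurable_sets[OF measurable_C])

lemma filtration_natural: "filtration (space M) (natural_filtration M C)"
proof
  show "sets (natural_filtration M C i) \<subseteq> sets (natural_filtration M C j)" if "i \<le> j" for i j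
    unfolding sets_natural_filtration
  proof (rule sigma_sets_mono')
    show "{C u -` B \<inter> space M |u B. 0 \<le> u \<and> u \<le> i} \<subseteq> {C u -` B \<inter> space M |u B. 0 \<le> u \<and> u \<le> j}"
      using that order_trans by blast
  qed
qed (rule space_natural_filtration)

lemma measurable_C_natural:
  assumes "0 \<le> u" "u \<le> t"
  shows "C u \<in> measurable (natural_filtration M C t) (count_space UNIV)"
proof (rule measurableI)
  fix A :: "nat set"
  show "C u -` A \<inter> space (natural_filtration M C t) \<in> sets (natural_filtration M C t)"
    unfolding space_natural_filtration sets_natural_filtration
    using assms by (intro sigma_sets.Basic) auto
qed simp

text \<open>Right continuity allows approximating \<open>\<rho>\<close> from above by fractions with
  denominator n + 1. The cap at u keeps all evaluation times within the range where \<open>C\<close>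
  is known to be measurable for \<open>G\<close>; with \<open>G\<close> the natural \<sigma>-algebra
  of time u this is progressive measurability. Limits are taken in the reals after applying
  \<open>fE\<close> and undone by its injectivity.\<close>

lemma measurable_C_at_time:
  assumes space: "space G = space M"
    and C: "\<And>r. 0 \<le> r \<Longrightarrow> r \<le> u \<Longrightarrow> C r \<in> measurable G (count_space UNIV)"
    and \<rho>: "\<rho> \<in> borel_measurable G" and range: "\<And>\<omega>. \<omega> \<in> space M \<Longrightarrow> 0 \<le> \<rho> \<omega> \<and> \<rho> \<omega> \<le> u"
  shows "(\<lambda>\<omega>. C (\<rho> \<omega>) \<omega>) \<in> measurable G (count_space UNIV)"
proof -
  define \<rho>' where "\<rho>' n \<omega> = min u (real (nat \<lceil>\<rho> \<omega> * real (Suc n)\<rceil>) / real (Suc n))" for n \<omega>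
  have u: "u \<ge> 0" if "\<omega> \<in> space M" for \<omega> using range[OF that] by linarith
  have meas: "(\<lambda>\<omega>. fE (C (\<rho>' n \<omega>) \<omega>)) \<in> borel_measurable G" for n
  proof -
    have u0: "u \<ge> 0" using u not_empty by blast
    have idx: "(\<lambda>\<omega>. nat \<lceil>\<rho> \<omega> * real (Suc n)\<rceil>) \<in> measurable G (count_space UNIV)"
      using \<rho> by measurable
    have "(\<lambda>\<omega>. C (\<rho>' n \<omega>) \<omega>) \<in> measurable G (count_space UNIV)"
      unfolding \<rho>'_def
      by (rule measurable_compose_countable[OF C idx]) (use u0 in auto)
    then show ?thesis by (rule measurable_compose) simp
  qed
  have lim: "(\<lambda>n. fE (C (\<rho>' n \<omega>) \<omega>)) \<longlonglongrightarrow> fE (C (\<rho> \<omega>) \<omega>)" if "\<omega> \<in> space G" for \<omega>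
  proof -
    have \<omega>: "\<omega> \<in> space M" using that space by simp
    interpret E_path C \<omega> by (rule E_path[OF \<omega>])
    have r: "0 \<le> \<rho> \<omega>" "\<rho> \<omega> \<le> u" using range[OF \<omega>] by auto
    let ?c = "\<lambda>n. real (nat \<lceil>\<rho> \<omega> * real (Suc n)\<rceil>)"
    have ceil: "\<rho> \<omega> \<le> ?c n / real (Suc n)"
      "?c n / real (Suc n) \<le> \<rho> \<omega> + inverse (real (Suc n))" for n
    proof -
      have "0 \<le> \<rho> \<omega> * real (Suc n)" using r by simp
      then have "?c n = of_int \<lceil>\<rho> \<omega> * real (Suc n)\<rceil>"
        by (intro of_nat_nat) (simp add: le_ceiling_iff)
      then have "\<rho> \<omega> * real (Suc n) \<le> ?c n"
        "?c n \<le> \<rho> \<omega> * real (Suc n) + 1"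
        using le_of_int_ceiling of_int_ceiling_le_add_one by metis+
      then show "\<rho> \<omega> \<le> ?c n / real (Suc n)"
        "?c n / real (Suc n) \<le> \<rho> \<omega> + inverse (real (Suc n))"
        by (simp_all add: field_simps del: of_nat_Suc)
    qed
    show ?thesis
    proof (rule right_continuous_LIMSEQ[OF r(1)])
      show "\<rho>' n \<omega> \<ge> \<rho> \<omega>" for n using ceil(1) r by (simp add: \<rho>'_def)
      show "(\<lambda>n. \<rho>' n \<omega>) \<longlonglongrightarrow> \<rho> \<omega>"
      proof (rule tendsto_sandwich[OF _ _ tendsto_const])
        have "(\<lambda>n. \<rho> \<omega> + inverse (real (Suc n))) \<longlonglongrightarrow> \<rho> \<omega> + 0"
          by (intro tendsto_intros LIMSEQ_inverse_real_of_nat)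
        then show "(\<lambda>n. \<rho> \<omega> + inverse (real (Suc n))) \<longlonglongrightarrow> \<rho> \<omega>" by simp
        show "\<forall>\<^sub>F n in sequentially. \<rho> \<omega> \<le> \<rho>' n \<omega>"
          using ceil(1) r by (simp add: \<rho>'_def)
        show "\<forall>\<^sub>F n in sequentially. \<rho>' n \<omega> \<le> \<rho> \<omega> + inverse (real (Suc n))"
          unfolding \<rho>'_def by (intro always_eventually allI min.coboundedI2 ceil(2))
      qed
    qed
  qed
  have fE_meas: "(\<lambda>\<omega>. fE (C (\<rho> \<omega>) \<omega>)) \<in> borel_measurable G"
    by (rule borel_measurable_LIMSEQ_real[OF lim meas])
  show ?thesis
    unfolding measurable_count_space_eq2_countable
  proof (intro conjI ballI)
    fix k :: nat
    show "(\<lambda>\<omega>. C (\<rho> \<omega>) \<omega>) -` {k} \<inter> space G \<in> sets G"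
    proof (cases "k \<ge> 1")
      case True
      have "(\<lambda>\<omega>. C (\<rho> \<omega>) \<omega>) -` {k} \<inter> space G = (\<lambda>\<omega>. fE (C (\<rho> \<omega>) \<omega>)) -` {fE k} \<inter> space G"
        using fE_inj[OF state True] range space by auto
      also have "\<dots> \<in> sets G" by (rule measurable_sets[OF fE_meas]) simp
      finally show ?thesis .
    next
      case False
      then have "(\<lambda>\<omega>. C (\<rho> \<omega>) \<omega>) -` {k} \<inter> space G = {}"
        using state range space by force
      then show ?thesis by simp
    qed
  qed simp
qed

lemma measurable_C_at:
  assumes \<rho>: "\<rho> \<in> borel_measurable M" and pos: "\<And>\<omega>. \<omega> \<in> space M \<Longrightarrow> 0 \<le> \<rho> \<omega>"
  shows "(\<lambda>\<omega>. C (\<rho> \<omega>) \<omega>) \<in> measurable M (count_space UNIV)"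
  unfolding measurable_count_space_eq2_countable
proof (intro conjI ballI)
  fix k :: nat
  have m: "(\<lambda>\<omega>. C (min (\<rho> \<omega>) (real n)) \<omega>) \<in> measurable M (count_space UNIV)" for n
    by (rule measurable_C_at_time[where u = "real n"]) (use \<rho> pos measurable_C in auto)
  have "(\<lambda>\<omega>. C (\<rho> \<omega>) \<omega>) -` {k} \<inter> space M
      = (\<Union>n. {\<omega> \<in> space M. \<rho> \<omega> \<le> real n} \<inter> ((\<lambda>\<omega>. C (min (\<rho> \<omega>) (real n)) \<omega>) -` {k} \<inter> space M))"
    (is "_ = ?R")
  proof (intro set_eqI iffI)
    fix \<omega> assume \<omega>: "\<omega> \<in> (\<lambda>\<omega>. C (\<rho> \<omega>) \<omega>) -` {k} \<inter> space M"
    obtain n :: nat where "\<rho> \<omega> \<le> real n" using real_arch_simple by blast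
    then show "\<omega> \<in> ?R" using \<omega> by (auto simp: min_def)
  qed (auto simp: min_def)
  also have "\<dots> \<in> sets M"
  proof (intro sets.countable_UN image_subsetI)
    fix n :: nat
    have "{\<omega> \<in> space M. \<rho> \<omega> \<le> real n} \<in> sets M"
      using \<rho> by measurable
    then show "{\<omega> \<in> space M. \<rho> \<omega> \<le> real n} \<inter> ((\<lambda>\<omega>. C (min (\<rho> \<omega>) (real n)) \<omega>) -` {k} \<inter> space M) \<in> sets M"
      by (rule sets.Int[OF _ measurable_sets[OF m]]) simp
  qed
  finally show "(\<lambda>\<omega>. C (\<rho> \<omega>) \<omega>) -` {k} \<inter> space M \<in> sets M" .
qed simp

lemma finite_stopping_timeD:
  assumes "finite_stopping_time M C \<sigma>"
  shows "\<sigma> \<in> borel_measurable M" "\<And>\<omega>. \<omega> \<in> space M \<Longrightarrow> 0 \<le> \<sigma> \<omega>" "stopping_time (natural_filtration M C) \<sigma>"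
    "(\<lambda>\<omega>. C (\<sigma> \<omega>) \<omega>) \<in> measurable M (count_space UNIV)"
proof -
  show 1: "\<sigma> \<in> borel_measurable M"
    by (rule measurable_stopping_time[where F = "natural_filtration M C"])
      (use assms sets_natural_filtration_subset space_natural_filtration in \<open>auto simp: finite_stopping_time_def\<close>)
  show 2: "\<And>\<omega>. \<omega> \<in> space M \<Longrightarrow> 0 \<le> \<sigma> \<omega>" and "stopping_time (natural_filtration M C) \<sigma>"
    using assms by (auto simp: finite_stopping_time_def)
  show "(\<lambda>\<omega>. C (\<sigma> \<omega>) \<omega>) \<in> measurable M (count_space UNIV)"
    by (rule measurable_C_at[OF 1 2])
qed

lemma measurable_next_jump:
  assumes \<sigma>: "\<sigma> \<in> borel_measurable M" and pos: "\<And>\<omega>. \<omega> \<in> space M \<Longrightarrow> 0 \<le> \<sigma> \<omega>"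
  shows "(\<lambda>\<omega>. next_jump C (\<sigma> \<omega>) \<omega>) \<in> borel_measurable M"
proof -
  note [measurable] = \<sigma>
  define E where "E b \<omega> \<longleftrightarrow> (\<exists>u>\<sigma> \<omega>. C u \<omega> \<noteq> C (\<sigma> \<omega>) \<omega>) \<and> next_jump C (\<sigma> \<omega>) \<omega> < b" for b \<omega>
  have meas: "Measurable.pred M (E b)" for b
  proof -
    have m: "(\<lambda>\<omega>. C (\<sigma> \<omega> + x * max 0 (b - \<sigma> \<omega>)) \<omega>) \<in> measurable M (count_space UNIV)"
      if "x \<in> \<rat> \<inter> {0..1}" for x
      by (rule measurable_C_at) (use that pos in auto)
    have "Measurable.pred M (\<lambda>\<omega>. \<exists>x\<in>\<rat> \<inter> {0..1}. \<sigma> \<omega> < b \<and>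
        C (\<sigma> \<omega> + x * max 0 (b - \<sigma> \<omega>)) \<omega> \<noteq> C (\<sigma> \<omega>) \<omega> \<and> x < 1)"
    proof (intro measurable_pred_countable countable_Rats_Int)
      fix x :: real assume "x \<in> \<rat> \<inter> {0..1}"
      then have [measurable]: "Measurable.pred M (\<lambda>\<omega>. C (\<sigma> \<omega> + x * max 0 (b - \<sigma> \<omega>)) \<omega> = C (\<sigma> \<omega>) \<omega>)"
        by (intro pred_eq_nat m measurable_C_at[OF \<sigma> pos])
      show "Measurable.pred M (\<lambda>\<omega>. \<sigma> \<omega> < b \<and>
          C (\<sigma> \<omega> + x * max 0 (b - \<sigma> \<omega>)) \<omega> \<noteq> C (\<sigma> \<omega>) \<omega> \<and> x < 1)"
        by measurable
    qed
    moreover have "E b \<omega> \<longleftrightarrow> (\<exists>x\<in>\<rat> \<inter> {0..1}. \<sigma> \<omega> < b \<and>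
        C (\<sigma> \<omega> + x * max 0 (b - \<sigma> \<omega>)) \<omega> \<noteq> C (\<sigma> \<omega>) \<omega> \<and> x < 1)" if "\<omega> \<in> space M" for \<omega>
      unfolding E_def E_path.next_jump_less_iff[OF E_path[OF that] pos[OF that]]
      by (intro bex_cong refl conj_cong) (auto simp: max_def)
    ultimately show ?thesis by (subst measurable_cong) auto
  qed
  show ?thesis
  proof (rule borel_measurableI_less)
    fix b :: real
    \<comment> \<open>Paths that never change after \<open>\<sigma>\<close> have
      \<open>next_jump\<close> equal to \<open>\<sigma>\<close>; they form the complement of the
      union of the events \<open>E (real n)\<close>.\<close>
    have "{\<omega> \<in> space M. next_jump C (\<sigma> \<omega>) \<omega> < b}
        = {\<omega> \<in> space M. E b \<omega> \<or> (\<sigma> \<omega> < b \<and> \<not> (\<exists>n::nat. E (real n) \<omega>))}"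
    proof (intro Collect_cong conj_cong refl)
      fix \<omega> assume "\<omega> \<in> space M"
      have "(\<exists>n::nat. E (real n) \<omega>) \<longleftrightarrow> (\<exists>u>\<sigma> \<omega>. C u \<omega> \<noteq> C (\<sigma> \<omega>) \<omega>)"
        using reals_Archimedean2 by (auto simp: E_def)
      then show "next_jump C (\<sigma> \<omega>) \<omega> < b \<longleftrightarrow> E b \<omega> \<or> (\<sigma> \<omega> < b \<and> \<not> (\<exists>n::nat. E (real n) \<omega>))"
        by (cases "\<exists>u>\<sigma> \<omega>. C u \<omega> \<noteq> C (\<sigma> \<omega>) \<omega>") (auto simp: E_def next_jump_def)
    qed
    also have "\<dots> \<in> sets M" using meas by measurable
    finally show "{\<omega> \<in> space M. next_jump C (\<sigma> \<omega>) \<omega> < b} \<in> sets M" .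
  qed
qed

lemma measurable_min_stopping_time:
  assumes st: "stopping_time (natural_filtration M C) \<sigma>"
  shows "(\<lambda>\<omega>. min (\<sigma> \<omega>) t) \<in> borel_measurable (natural_filtration M C t)"
proof (rule borel_measurableI_le)
  interpret filtration "space M" "natural_filtration M C" by (rule filtration_natural)
  fix x
  show "{\<omega> \<in> space (natural_filtration M C t). min (\<sigma> \<omega>) t \<le> x} \<in> sets (natural_filtration M C t)"
    using stopping_time_le_const[OF st, of "min x t" t]
    by (cases "t \<le> x") (auto simp: pred_def min_le_iff_disj)
qed

text \<open>On the event \<sigma> \<le> t nothing changes when \<open>\<sigma> \<omega>\<close> is
  replaced by \<open>min (\<sigma> \<omega>) t\<close>, and the latter only reads the path up to
  t.\<close>

lemma stopped_in_past:
  assumes \<sigma>: "finite_stopping_time M C \<sigma>" and B: "B \<in> sets borel"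
  shows "{\<omega> \<in> space M. \<sigma> \<omega> \<in> B \<and> C (\<sigma> \<omega>) \<omega> = k} \<in> past M C \<sigma>"
proof -
  interpret filtration "space M" "natural_filtration M C" by (rule filtration_natural)
  note st = finite_stopping_timeD(3)[OF \<sigma>] and pos = finite_stopping_timeD(2)[OF \<sigma>]
  show ?thesis
  proof (rule sets_pre_sigmaI[OF st])
    fix t :: real
    let ?A = "{\<omega> \<in> space M. \<sigma> \<omega> \<in> B \<and> C (\<sigma> \<omega>) \<omega> = k}"
    let ?F = "natural_filtration M C t"
    show "{\<omega> \<in> ?A. \<sigma> \<omega> \<le> t} \<in> sets ?F"
    proof (cases "t \<ge> 0")
      case True
      have m[measurable]: "(\<lambda>\<omega>. min (\<sigma> \<omega>) t) \<in> borel_measurable ?F"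
        by (rule measurable_min_stopping_time[OF st])
      have [measurable]: "(\<lambda>\<omega>. C (min (\<sigma> \<omega>) t) \<omega>) \<in> measurable ?F (count_space UNIV)"
        by (rule measurable_C_at_time[OF space_natural_filtration measurable_C_natural m])
          (use True pos in auto)
      have [measurable]: "Measurable.pred ?F (\<lambda>\<omega>. \<sigma> \<omega> \<le> t)" by (rule stopping_timeD[OF st])
      have "{\<omega> \<in> space ?F. \<sigma> \<omega> \<le> t \<and> min (\<sigma> \<omega>) t \<in> B \<and> C (min (\<sigma> \<omega>) t) \<omega> = k} \<in> sets ?F" (is "?D \<in> _")
        using B by measurable
      also have "?D = {\<omega> \<in> ?A. \<sigma> \<omega> \<le> t}"
        by (auto simp: space_natural_filtration)
      finally show ?thesis .
    next
      case False
      then have "{\<omega> \<in> ?A. \<sigma> \<omega> \<le> t} = {}"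
        using pos by force
      then show ?thesis by (simp only: sets.empty_sets)
    qed
  qed
qed

text \<open>For t at or beyond N the cap makes the event trivial. For 0 \<le> t < N, having exited
  by time t means \<sigma> \<le> t together with a jump to a new state other than 1 between
  \<open>min (\<sigma> \<omega>) t\<close> and t, which is decided by the path up to t.\<close>

lemma finite_stopping_time_exit:
  assumes \<sigma>: "finite_stopping_time M C \<sigma>" and N: "N \<ge> 0"
  shows "finite_stopping_time M C (\<lambda>\<omega>. exit_time C N (\<sigma> \<omega>) \<omega>)"
proof -
  interpret filtration "space M" "natural_filtration M C" by (rule filtration_natural)
  note st = finite_stopping_timeD(3)[OF \<sigma>] and pos = finite_stopping_timeD(2)[OF \<sigma>]
  have nonneg: "0 \<le> exit_time C N (\<sigma> \<omega>) \<omega>" if "\<omega> \<in> space M" for \<omega>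
    using E_path.next_jump_ge[OF E_path[OF that] pos[OF that]] pos[OF that] N
    by (auto simp: exit_time_def)
  have "Measurable.pred (natural_filtration M C t) (\<lambda>\<omega>. exit_time C N (\<sigma> \<omega>) \<omega> \<le> t)" for t
  proof -
    let ?F = "natural_filtration M C t"
    consider "t < 0" | "N \<le> t" | "0 \<le> t" "t < N" by linarith
    then show ?thesis
    proof cases
      case 1
      then have eq: "exit_time C N (\<sigma> \<omega>) \<omega> \<le> t \<longleftrightarrow> False" if "\<omega> \<in> space ?F" for \<omega>
        using nonneg[of \<omega>] that by (simp add: space_natural_filtration)
      show ?thesis by (rule iffD2[OF measurable_cong[OF eq]]) simp_all
    next
      case 2
      then have "exit_time C N (\<sigma> \<omega>) \<omega> \<le> t" for \<omega>
        by (auto simp: exit_time_def)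
      then show ?thesis by simp
    next
      case 3
      define a where "a \<omega> = min (\<sigma> \<omega>) t" for \<omega>
      have m[measurable]: "a \<in> borel_measurable ?F"
        unfolding a_def by (rule measurable_min_stopping_time[OF st])
      have a: "0 \<le> a \<omega>" "a \<omega> \<le> t" if "\<omega> \<in> space M" for \<omega>
        using pos[OF that] 3 by (auto simp: a_def)
      have mx: "(\<lambda>\<omega>. C (a \<omega> + x * (t - a \<omega>)) \<omega>) \<in> measurable ?F (count_space UNIV)"
        if "x \<in> \<rat> \<inter> {0..1}" for x
      proof (rule measurable_C_at_time[OF space_natural_filtration measurable_C_natural])
        fix \<omega> assume "\<omega> \<in> space M"
        note a = a[OF this]
        have "x * (t - a \<omega>) \<le> t - a \<omega>" "0 \<le> x * (t - a \<omega>)"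
          using that a by (auto intro: mult_left_le_one_le)
        then show "0 \<le> a \<omega> + x * (t - a \<omega>) \<and> a \<omega> + x * (t - a \<omega>) \<le> t" using a by linarith
      next
        show "(\<lambda>\<omega>. a \<omega> + x * (t - a \<omega>)) \<in> borel_measurable ?F" by measurable
      qed auto
      have ma: "(\<lambda>\<omega>. C (a \<omega>) \<omega>) \<in> measurable ?F (count_space UNIV)"
        by (rule measurable_C_at_time[OF space_natural_filtration measurable_C_natural m]) (use a in auto)
      have [measurable]: "Measurable.pred ?F (\<lambda>\<omega>. \<sigma> \<omega> \<le> t)" by (rule stopping_timeD[OF st])
      let ?P = "\<lambda>\<omega>. \<exists>j. j \<notin> {1, C (a \<omega>) \<omega>} \<and> (\<forall>m::nat. \<exists>x\<in>\<rat> \<inter> {0..1}. \<exists>x'\<in>\<rat> \<inter> {0..1}. x' - x < 1 / (real m + 1) \<and>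
         (\<forall>z\<in>\<rat> \<inter> {0..1}. z \<le> x \<longrightarrow> C (a \<omega> + z * (t - a \<omega>)) \<omega> = C (a \<omega>) \<omega>) \<and> C (a \<omega> + x' * (t - a \<omega>)) \<omega> = j)"
      define Q where "Q z \<omega> \<longleftrightarrow> C (a \<omega> + z * (t - a \<omega>)) \<omega> = C (a \<omega>) \<omega>" for z \<omega>
      define W where "W z j \<omega> \<longleftrightarrow> C (a \<omega> + z * (t - a \<omega>)) \<omega> = j" for z j \<omega>
      define K where "K j \<omega> \<longleftrightarrow> j \<notin> {1, C (a \<omega>) \<omega>}" for j \<omega>
      have mQ: "Measurable.pred ?F (Q z)" if z: "z \<in> \<rat> \<inter> {0..1}" for z
        unfolding Q_def by (rule pred_eq_nat[OF mx[OF z] ma])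
      have mW: "Measurable.pred ?F (W z j)" if z: "z \<in> \<rat> \<inter> {0..1}" for z j
        unfolding W_def by (rule pred_eq_nat[OF mx[OF z] measurable_const]) simp
      have mK: "Measurable.pred ?F (K j)" for j
        unfolding K_def insert_iff empty_iff simp_thms de_Morgan_disj
        by (intro pred_intros_logic(2,3) pred_eq_nat ma measurable_const) simp_all
      have "Measurable.pred ?F (\<lambda>\<omega>. \<exists>j. K j \<omega> \<and> (\<forall>m::nat. \<exists>x\<in>\<rat> \<inter> {0..1}. \<exists>x'\<in>\<rat> \<inter> {0..1}.
          x' - x < 1 / (real m + 1) \<and> (\<forall>z\<in>\<rat> \<inter> {0..1}. z \<le> x \<longrightarrow> Q z \<omega>) \<and> W x' j \<omega>))"
        by (intro pred_intros_logic(3,4) pred_intros_countable measurable_pred_countable countable_Rats_Int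
            mQ mW mK measurable_const) simp_all
      then have [measurable]: "Measurable.pred ?F ?P"
        by (simp only: Q_def W_def K_def)
      have P: "Measurable.pred ?F (\<lambda>\<omega>. \<sigma> \<omega> \<le> t \<and> ?P \<omega>)"
        by (rule pred_intros_logic(3)) fact+
      have eq: "exit_time C N (\<sigma> \<omega>) \<omega> \<le> t \<longleftrightarrow> \<sigma> \<omega> \<le> t \<and> ?P \<omega>" if "\<omega> \<in> space ?F" for \<omega>
      proof -
        have \<omega>: "\<omega> \<in> space M" using that by (simp add: space_natural_filtration)
        interpret E_path C \<omega> by (rule E_path[OF \<omega>])
        have "exit_time C N (\<sigma> \<omega>) \<omega> \<le> t \<longleftrightarrow>
            C (next_jump C (\<sigma> \<omega>) \<omega>) \<omega> \<notin> {1, C (\<sigma> \<omega>) \<omega>} \<and> next_jump C (\<sigma> \<omega>) \<omega> \<le> t"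
          using 3 by (auto simp: exit_time_def)
        also have "\<dots> \<longleftrightarrow> \<sigma> \<omega> \<le> t \<and> C (next_jump C (a \<omega>) \<omega>) \<omega> \<notin> {1, C (a \<omega>) \<omega>} \<and> next_jump C (a \<omega>) \<omega> \<le> t"
        proof (cases "\<sigma> \<omega> \<le> t")
          case True
          then show ?thesis by (simp add: a_def)
        next
          case False
          then show ?thesis using next_jump_ge[OF pos[OF \<omega>]] by simp
        qed
        also have "\<dots> \<longleftrightarrow> \<sigma> \<omega> \<le> t \<and> ?P \<omega>"
          by (simp only: regular_exit_iff[OF a[OF \<omega>]])
        finally show ?thesis .
      qed
      show ?thesis by (rule iffD2[OF measurable_cong[OF eq] P])
    qed
  qed
  then show ?thesis using nonneg by (auto simp: finite_stopping_time_def stopping_time_def)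
qed

lemma sets_hits_one:
  assumes "0 \<le> a"
  shows "{\<omega> \<in> space M. \<exists>t\<in>{a..b}. C t \<omega> = 1} \<in> sets M"
proof (cases "a \<le> b")
  case True
  have [measurable]: "C (a + x * (b - a)) \<in> measurable M (count_space UNIV)" if "x \<in> \<rat> \<inter> {0..1}" for x
    by (rule measurable_C) (use that True assms in auto)
  have "Measurable.pred M (\<lambda>\<omega>. \<forall>m::nat. \<exists>x\<in>\<rat> \<inter> {0..1}. fE (C (a + x * (b - a)) \<omega>) < 1 / (real m + 1))"
    by (intro pred_intros_countable measurable_pred_countable countable_Rats_Int) measurable
  then have "{\<omega> \<in> space M. \<forall>m::nat. \<exists>x\<in>\<rat> \<inter> {0..1}. fE (C (a + x * (b - a)) \<omega>) < 1 / (real m + 1)} \<in> sets M"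
    by simp
  also have "{\<omega> \<in> space M. \<forall>m::nat. \<exists>x\<in>\<rat> \<inter> {0..1}. fE (C (a + x * (b - a)) \<omega>) < 1 / (real m + 1)}
      = {\<omega> \<in> space M. \<exists>t\<in>{a..b}. C t \<omega> = 1}"
    using E_path.hits_one_iff[OF E_path assms True] by blast
  finally show ?thesis .
qed simp

lemma sets_explodes_during_Icc:
  assumes "0 \<le> s"
  shows "{\<omega> \<in> space M. explodes_during C \<omega> {s..y}} \<in> sets M"
proof -
  have m: "C q \<in> measurable M (count_space UNIV)" if "q \<in> \<rat> \<inter> {0..y}" for q
    by (rule measurable_C) (use that in auto)
  have hit: "Measurable.pred M (\<lambda>\<omega>. \<exists>t\<in>{q..b}. C t \<omega> = 1)" if "q \<in> \<rat> \<inter> {0..y}" for q b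
    using sets_hits_one[of q b] that by (auto simp: pred_def)
  have "Measurable.pred M (\<lambda>\<omega>. \<exists>q\<in>\<rat> \<inter> {0..y}. C q \<omega> \<noteq> 1 \<and> (\<exists>t\<in>{q..y}. C t \<omega> = 1) \<and>
       (\<forall>n::nat. q \<le> s - 1 / (real n + 1) \<longrightarrow> \<not> (\<exists>t\<in>{q..s - 1 / (real n + 1)}. C t \<omega> = 1)))"
  proof (intro measurable_pred_countable countable_Rats_Int)
    fix q assume q: "q \<in> \<rat> \<inter> {0..y}"
    show "Measurable.pred M (\<lambda>\<omega>. C q \<omega> \<noteq> 1 \<and> (\<exists>t\<in>{q..y}. C t \<omega> = 1) \<and>
       (\<forall>n::nat. q \<le> s - 1 / (real n + 1) \<longrightarrow> \<not> (\<exists>t\<in>{q..s - 1 / (real n + 1)}. C t \<omega> = 1)))"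
      by (intro pred_intros_logic(2,3,4) pred_intros_countable(1) hit q pred_eq_nat m measurable_const) simp_all
  qed
  then have "{\<omega> \<in> space M. \<exists>q\<in>\<rat> \<inter> {0..y}. C q \<omega> \<noteq> 1 \<and> (\<exists>t\<in>{q..y}. C t \<omega> = 1) \<and>
       (\<forall>n::nat. q \<le> s - 1 / (real n + 1) \<longrightarrow> \<not> (\<exists>t\<in>{q..s - 1 / (real n + 1)}. C t \<omega> = 1))} \<in> sets M"
    by simp
  then show ?thesis
    using E_path.explodes_during_Icc_iff[OF E_path assms] by (simp cong: conj_cong)
qed

end

subsection \<open>The first jump after a stopping time\<close>

lemma emeasure_exponential_greaterThan:
  assumes l: "0 < l"
  shows "emeasure (density lborel (\<lambda>x. ennreal (exponential_density l x))) {x<..} = ennreal (exp (- (l * max 0 x)))"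
proof -
  let ?E = "density lborel (\<lambda>x. ennreal (exponential_density l x))"
  interpret E: prob_space ?E
    using prob_space_exponential_density[OF l] by simp
  have D: "distributed ?E lborel (\<lambda>x. x) (exponential_density l)"
    by (auto simp: distributed_def distr_id2 intro: l exponential_density_nonneg)
  have gt: "E.prob {a<..} = exp (- (l * a))" if "a \<ge> 0" for a
    using E.exponential_distributedD_gt[OF D that l]
    by (simp add: greaterThan_def mult.commute)
  have "E.prob {x<..} = exp (- (l * max 0 x))"
  proof (cases "x \<ge> 0")
    case True
    then show ?thesis using gt by simp
  next
    case False
    have "E.prob {0<..} \<le> E.prob {x<..}"
      using False by (intro E.finite_measure_mono) auto
    then have "E.prob {x<..} = 1" using gt[of 0] E.prob_le_1 by (intro antisym) auto
    then show ?thesis using False by simp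
  qed
  then show ?thesis by (simp add: E.emeasure_eq_measure)
qed

context tagged_cluster_process
begin

lemma sets_constant:
  assumes \<sigma>: "finite_stopping_time M C \<sigma>" and h: "h \<ge> 0"
  shows "{\<omega> \<in> space M. \<forall>u\<in>{\<sigma> \<omega>..\<sigma> \<omega> + h}. C u \<omega> = C (\<sigma> \<omega>) \<omega>} \<in> sets M"
proof -
  note s = finite_stopping_timeD[OF \<sigma>]
  have m: "(\<lambda>\<omega>. C (\<sigma> \<omega> + x * h) \<omega>) \<in> measurable M (count_space UNIV)" if "x \<in> \<rat> \<inter> {0..1}" for x
    by (rule measurable_C_at) (use s that h in auto)
  have "Measurable.pred M (\<lambda>\<omega>. \<forall>x\<in>\<rat> \<inter> {0..1}. C (\<sigma> \<omega> + x * h) \<omega> = C (\<sigma> \<omega>) \<omega>)"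
    by (intro measurable_pred_countable countable_Rats_Int pred_eq_nat m s(4))
  then have "{\<omega> \<in> space M. \<forall>x\<in>\<rat> \<inter> {0..1}. C (\<sigma> \<omega> + x * h) \<omega> = C (\<sigma> \<omega>) \<omega>} \<in> sets M"
    by simp
  also have "{\<omega> \<in> space M. \<forall>x\<in>\<rat> \<inter> {0..1}. C (\<sigma> \<omega> + x * h) \<omega> = C (\<sigma> \<omega>) \<omega>}
      = {\<omega> \<in> space M. \<forall>u\<in>{\<sigma> \<omega>..\<sigma> \<omega> + h}. C u \<omega> = C (\<sigma> \<omega>) \<omega>}"
    by (intro Collect_cong conj_cong refl) (simp only: E_path.constant_Icc_iff[OF E_path s(2) h])
  finally show ?thesis .
qed

text \<open>The hypothesis \<open>holding\<close> speaks of constancy on a closed interval. That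
  event, \<open>D h\<close> below, also contains the paths that never change, where
  \<open>next_jump\<close> has its dummy value, and those that leave their state only just after
  \<sigma> + h. Both kinds turn out to be negligible by a sandwich between \<open>D h\<close> and
  \<open>D h'\<close> with h' decreasing to h.\<close>

lemma prob_holding:
  assumes \<sigma>: "finite_stopping_time M C \<sigma>" and B: "B \<in> sets borel" and h: "h \<ge> 0"
  shows "prob {\<omega> \<in> space M. \<sigma> \<omega> \<in> B \<and> C (\<sigma> \<omega>) \<omega> = k \<and> \<sigma> \<omega> + h < next_jump C (\<sigma> \<omega>) \<omega>}
    = prob {\<omega> \<in> space M. \<sigma> \<omega> \<in> B \<and> C (\<sigma> \<omega>) \<omega> = k} * exp (- (real k * h))"
proof (cases "k = 0")
  case True
  have "C (\<sigma> \<omega>) \<omega> \<noteq> 0" if "\<omega> \<in> space M" for \<omega>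
    using state[OF finite_stopping_timeD(2)[OF \<sigma> that] that] by simp
  then have "{\<omega> \<in> space M. \<sigma> \<omega> \<in> B \<and> C (\<sigma> \<omega>) \<omega> = k \<and> \<sigma> \<omega> + h < next_jump C (\<sigma> \<omega>) \<omega>} = {}"
    "{\<omega> \<in> space M. \<sigma> \<omega> \<in> B \<and> C (\<sigma> \<omega>) \<omega> = k} = {}"
    using True by auto
  then show ?thesis by (simp only: measure_empty mult_zero_left)
next
  case False
  let ?\<tau> = "\<lambda>\<omega>. next_jump C (\<sigma> \<omega>) \<omega>"
  note s = finite_stopping_timeD[OF \<sigma>]
  define A where "A = {\<omega> \<in> space M. \<sigma> \<omega> \<in> B \<and> C (\<sigma> \<omega>) \<omega> = k}"
  have past: "A \<in> past M C \<sigma>" unfolding A_def by (rule stopped_in_past[OF \<sigma> B])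
  have [measurable]: "\<sigma> \<in> borel_measurable M" "(\<lambda>\<omega>. C (\<sigma> \<omega>) \<omega>) \<in> measurable M (count_space UNIV)"
    "(\<lambda>\<omega>. ?\<tau> \<omega>) \<in> borel_measurable M"
    using s measurable_next_jump[OF s(1,2)] by auto
  have A: "A \<in> sets M" unfolding A_def using B by measurable
  define D where "D h = {\<omega> \<in> A. \<forall>u\<in>{\<sigma> \<omega>..\<sigma> \<omega> + h}. C u \<omega> = C (\<sigma> \<omega>) \<omega>}" for h
  have D: "D h \<in> sets M" if "h \<ge> 0" for h
  proof -
    have "D h = A \<inter> {\<omega> \<in> space M. \<forall>u\<in>{\<sigma> \<omega>..\<sigma> \<omega> + h}. C u \<omega> = C (\<sigma> \<omega>) \<omega>}"
      by (auto simp: D_def A_def)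
    then show ?thesis using sets.Int[OF A sets_constant[OF \<sigma> that]] by simp
  qed
  have PD: "prob (D h) = prob A * exp (- (real k * h))" if "h \<ge> 0" for h
  proof -
    have "prob (D h) = (LINT \<omega>:A|M. exp (- real (C (\<sigma> \<omega>) \<omega>) * h))"
      unfolding D_def by (rule holding[OF \<sigma> past that])
    also have "\<dots> = (LINT \<omega>:A|M. exp (- (real k * h)))"
      unfolding set_lebesgue_integral_def
      by (rule Bochner_Integration.integral_cong) (auto simp: A_def indicator_def)
    also have "\<dots> = prob A * exp (- (real k * h))"
      using A by (simp add: set_lebesgue_integral_def)
    finally show ?thesis .
  qed
  define T where "T = {\<omega> \<in> A. \<sigma> \<omega> + h < ?\<tau> \<omega>}"
  have T: "T \<in> sets M"
  proof -
    have "T = A \<inter> {\<omega> \<in> space M. \<sigma> \<omega> + h < ?\<tau> \<omega>}" by (auto simp: T_def A_def)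
    moreover have "{\<omega> \<in> space M. \<sigma> \<omega> + h < ?\<tau> \<omega>} \<in> sets M" by measurable
    ultimately show ?thesis using A by simp
  qed
  have upper: "prob T \<le> prob A * exp (- (real k * h))"
    unfolding PD[OF h, symmetric]
  proof (rule finite_measure_mono[OF _ D[OF h]])
    show "T \<subseteq> D h"
    proof
      fix \<omega> assume "\<omega> \<in> T"
      then have \<omega>: "\<omega> \<in> A" "\<sigma> \<omega> + h < ?\<tau> \<omega>" "\<omega> \<in> space M"
        by (auto simp: T_def A_def)
      have "C u \<omega> = C (\<sigma> \<omega>) \<omega>" if "u \<in> {\<sigma> \<omega>..\<sigma> \<omega> + h}" for u
        by (rule E_path.constant_before_next_jump[OF E_path[OF \<omega>(3)]]) (use that \<omega>(2) in auto)
      then show "\<omega> \<in> D h" using \<omega>(1) unfolding D_def by blast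
    qed
  qed
  have lower: "prob A * exp (- (real k * h')) \<le> prob T" if h': "h' > h" for h'
  proof -
    \<comment> \<open>Such a path changes by time \<sigma> + n but not up to \<sigma> + h', so its
      next jump is genuine and later than \<sigma> + h. The probability of \<open>D n\<close>
      vanishes as n grows because k is positive.\<close>
    have "D h' - D n \<subseteq> T" if "n \<ge> 0" for n
    proof
      fix \<omega> assume \<omega>: "\<omega> \<in> D h' - D n"
      then obtain u where u: "u \<in> {\<sigma> \<omega>..\<sigma> \<omega> + n}" "C u \<omega> \<noteq> C (\<sigma> \<omega>) \<omega>" and "\<omega> \<in> A"
        and const: "\<forall>u\<in>{\<sigma> \<omega>..\<sigma> \<omega> + h'}. C u \<omega> = C (\<sigma> \<omega>) \<omega>"
        unfolding D_def by blast
      have "u > \<sigma> \<omega>" using u by (cases "u = \<sigma> \<omega>") auto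
      have "\<sigma> \<omega> + h' \<le> Inf {u. \<sigma> \<omega> < u \<and> C u \<omega> \<noteq> C (\<sigma> \<omega>) \<omega>}"
      proof (rule cInf_greatest)
        fix r assume "r \<in> {u. \<sigma> \<omega> < u \<and> C u \<omega> \<noteq> C (\<sigma> \<omega>) \<omega>}"
        then show "\<sigma> \<omega> + h' \<le> r" using bspec[OF const, of r] by force
      qed (use u \<open>u > \<sigma> \<omega>\<close> in auto)
      then have "\<sigma> \<omega> + h' \<le> ?\<tau> \<omega>"
        using u \<open>u > \<sigma> \<omega>\<close> by (auto simp: next_jump_def)
      then show "\<omega> \<in> T" using \<open>\<omega> \<in> A\<close> h' by (simp add: T_def)
    qed
    then have b1: "prob (D h' - D n) \<le> prob T" if "n \<ge> 0" for n
      using that T by (intro finite_measure_mono)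
    have b2: "prob (D h') - prob (D n) \<le> prob (D h' - D n)" if "n \<ge> 0" for n
    proof -
      have "prob (D h' \<inter> D n) \<le> prob (D n)"
        using that h h' D by (intro finite_measure_mono) auto
      then show ?thesis
        using finite_measure_Diff'[OF D D, of h' n] that h h' by simp
    qed
    have h0: "h' \<ge> 0" using h h' by simp
    have le: "prob A * exp (- (real k * h')) - prob A * exp (- (real k * real n)) \<le> prob T" for n
      using order_trans[OF b2 b1, of "real n"] unfolding PD[OF h0] PD[OF of_nat_0_le_iff] by simp
    have "(\<lambda>n. exp (- real k) ^ n) \<longlonglongrightarrow> 0"
      using False by (intro LIMSEQ_power_zero) auto
    then have e0: "(\<lambda>n. exp (- (real k * real n))) \<longlonglongrightarrow> 0"
      by (simp add: exp_of_nat_mult[symmetric] mult.commute)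
    have "(\<lambda>n. prob A * exp (- (real k * h')) - prob A * exp (- (real k * real n)))
        \<longlonglongrightarrow> prob A * exp (- (real k * h')) - prob A * 0"
      by (intro tendsto_intros e0)
    then have "prob A * exp (- (real k * h')) - prob A * 0 \<le> prob T"
      by (rule LIMSEQ_le_const2) (use le in blast)
    then show ?thesis by simp
  qed
  have "prob A * exp (- (real k * h)) \<le> prob T"
  proof (rule LIMSEQ_le_const2)
    have "(\<lambda>n. prob A * exp (- (real k * (h + inverse (real (Suc n)))))) \<longlonglongrightarrow> prob A * exp (- (real k * (h + 0)))"
      by (intro tendsto_intros LIMSEQ_inverse_real_of_nat)
    then show "(\<lambda>n. prob A * exp (- (real k * (h + inverse (real (Suc n)))))) \<longlonglongrightarrow> prob A * exp (- (real k * h))"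
      by simp
    show "\<exists>N. \<forall>n\<ge>N. prob A * exp (- (real k * (h + inverse (real (Suc n))))) \<le> prob T"
      by (intro exI allI impI lower) simp
  qed
  with upper have "prob T = prob A * exp (- (real k * h))" by simp
  moreover have "T = {\<omega> \<in> space M. \<sigma> \<omega> \<in> B \<and> C (\<sigma> \<omega>) \<omega> = k \<and> \<sigma> \<omega> + h < ?\<tau> \<omega>}"
    by (auto simp: T_def A_def)
  ultimately show ?thesis by (simp add: A_def)
qed

text \<open>Given the state k, the waiting time is independent of \<open>\<sigma>\<close> and
  exponential with rate k. The measure \<open>Mk\<close> is the restriction of \<open>M\<close> to
  this state, left unnormalised so that null events need no separate treatment. It suffices to
  compare rectangles, and in the second coordinate half-lines, where the holding probabilities
  apply.\<close>

lemma holding_law: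
  assumes \<sigma>: "finite_stopping_time M C \<sigma>" and k: "k \<ge> 1"
  defines "Mk \<equiv> density M (\<lambda>\<omega>. indicator {\<omega>. C (\<sigma> \<omega>) \<omega> = k} \<omega>)"
  shows "distr Mk borel \<sigma> \<Otimes>\<^sub>M density lborel (\<lambda>x. ennreal (exponential_density (real k) x))
    = distr Mk (borel \<Otimes>\<^sub>M borel) (\<lambda>\<omega>. (\<sigma> \<omega>, next_jump C (\<sigma> \<omega>) \<omega> - \<sigma> \<omega>))"
proof -
  let ?\<tau> = "\<lambda>\<omega>. next_jump C (\<sigma> \<omega>) \<omega>"
  note s = finite_stopping_timeD[OF \<sigma>]
  have [measurable]: "\<sigma> \<in> borel_measurable M" "(\<lambda>\<omega>. C (\<sigma> \<omega>) \<omega>) \<in> measurable M (count_space UNIV)"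
    "(\<lambda>\<omega>. ?\<tau> \<omega>) \<in> borel_measurable M"
    using s measurable_next_jump[OF s(1,2)] by auto
  let ?E = "density lborel (\<lambda>x. ennreal (exponential_density (real k) x))"
  have setk: "{\<omega> \<in> space M. C (\<sigma> \<omega>) \<omega> = k} \<in> sets M" by measurable
  have indk: "(\<lambda>\<omega>. indicator {\<omega>. C (\<sigma> \<omega>) \<omega> = k} \<omega> :: ennreal) \<in> borel_measurable M"
    by measurable
  have sets_Mk [measurable_cong]: "sets Mk = sets M" and space_Mk: "space Mk = space M"
    by (simp_all add: Mk_def)
  have em: "emeasure Mk A = emeasure M {\<omega> \<in> A. C (\<sigma> \<omega>) \<omega> = k}" if A: "A \<in> sets M" for A
  proof -
    have "emeasure Mk A = (\<integral>\<^sup>+\<omega>. indicator {\<omega>. C (\<sigma> \<omega>) \<omega> = k} \<omega> * indicator A \<omega> \<partial>M)"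
      unfolding Mk_def by (rule emeasure_density[OF indk A])
    also have "\<dots> = (\<integral>\<^sup>+\<omega>. indicator {\<omega> \<in> A. C (\<sigma> \<omega>) \<omega> = k} \<omega> \<partial>M)"
      by (rule nn_integral_cong) (auto simp: indicator_def)
    also have "\<dots> = emeasure M {\<omega> \<in> A. C (\<sigma> \<omega>) \<omega> = k}"
    proof (rule nn_integral_indicator)
      have "{\<omega> \<in> A. C (\<sigma> \<omega>) \<omega> = k} = A \<inter> {\<omega> \<in> space M. C (\<sigma> \<omega>) \<omega> = k}"
        using sets.sets_into_space[OF A] by auto
      then show "{\<omega> \<in> A. C (\<sigma> \<omega>) \<omega> = k} \<in> sets M"
        using A setk by simp
    qed
    finally show ?thesis .
  qed
  have "emeasure Mk (space Mk) \<noteq> \<infinity>"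
    using em[OF sets.top] by (simp add: space_Mk emeasure_eq_measure)
  then interpret Mk: finite_measure Mk by (rule finite_measureI)
  interpret P: finite_measure "distr Mk borel \<sigma>"
    by (rule Mk.finite_measure_distr) measurable
  interpret E: prob_space ?E
    using prob_space_exponential_density[of "real k"] k by simp
  let ?L = "distr Mk (borel \<Otimes>\<^sub>M borel) (\<lambda>\<omega>. (\<sigma> \<omega>, ?\<tau> \<omega> - \<sigma> \<omega>))"
  show ?thesis
  proof (rule pair_measure_eqI)
    show "sigma_finite_measure (distr Mk borel \<sigma>)" "sigma_finite_measure ?E" by unfold_locales
    show "sets (distr Mk borel \<sigma> \<Otimes>\<^sub>M ?E) = sets (?L)"
      by (simp cong: sets_pair_measure_cong)
    fix A B assume "A \<in> sets (distr Mk borel \<sigma>)" and "B \<in> sets ?E"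
    then have A[measurable]: "A \<in> sets borel" and B[measurable]: "B \<in> sets borel" by auto
    let ?S = "{\<omega> \<in> space M. \<sigma> \<omega> \<in> A \<and> ?\<tau> \<omega> - \<sigma> \<omega> \<in> B}"
    let ?A = "{\<omega> \<in> space M. \<sigma> \<omega> \<in> A \<and> C (\<sigma> \<omega>) \<omega> = k}"
    have mA: "?A \<in> sets M" by measurable
    define \<nu> where "\<nu> = distr (density M (indicator ?A)) borel (\<lambda>\<omega>. ?\<tau> \<omega> - \<sigma> \<omega>)"
    have \<nu>: "emeasure \<nu> S = emeasure M {\<omega> \<in> ?A. ?\<tau> \<omega> - \<sigma> \<omega> \<in> S}" if S[measurable]: "S \<in> sets borel" for S
    proof -
      let ?S = "{\<omega> \<in> space M. ?\<tau> \<omega> - \<sigma> \<omega> \<in> S}"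
      have mS: "?S \<in> sets M" by measurable
      have "emeasure \<nu> S = emeasure (density M (indicator ?A)) ?S"
        unfolding \<nu>_def by (subst emeasure_distr) (auto simp: vimage_def Int_def conj_commute)
      also have "\<dots> = (\<integral>\<^sup>+\<omega>. indicator ?A \<omega> * indicator ?S \<omega> \<partial>M)"
        using mA mS by (intro emeasure_density) auto
      also have "\<dots> = (\<integral>\<^sup>+\<omega>. indicator (?A \<inter> ?S) \<omega> \<partial>M)"
        by (rule nn_integral_cong) (auto simp: indicator_def)
      also have "\<dots> = emeasure M (?A \<inter> ?S)" using mA mS by simp
      also have "?A \<inter> ?S = {\<omega> \<in> ?A. ?\<tau> \<omega> - \<sigma> \<omega> \<in> S}" by auto
      finally show ?thesis .
    qed
    have "\<nu> = scale_measure (prob ?A) ?E"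
    proof (rule measure_eqI_lessThan)
      show "sets \<nu> = sets borel" "sets (scale_measure (prob ?A) ?E) = sets borel" by (auto simp: \<nu>_def)
      fix x :: real
      show "emeasure \<nu> {x<..} < \<infinity>"
        by (simp add: \<nu> emeasure_eq_measure)
      have "{\<omega> \<in> ?A. ?\<tau> \<omega> - \<sigma> \<omega> \<in> {x<..}} =
          {\<omega> \<in> ?A. \<sigma> \<omega> + x < ?\<tau> \<omega>}" by auto
      moreover have "prob {\<omega> \<in> ?A. \<sigma> \<omega> + x < ?\<tau> \<omega>} = prob ?A * exp (- (real k * max 0 x))"
      proof (cases "x \<ge> 0")
        case True
        then show ?thesis using prob_holding[OF \<sigma> A True, of k] by (simp add: conj_assoc)
      next
        case False
        have "\<sigma> \<omega> + x < ?\<tau> \<omega>" if "\<omega> \<in> space M" for \<omega>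
          using E_path.next_jump_ge[OF E_path[OF that] s(2)[OF that]] False by simp
        then have "{\<omega> \<in> ?A. \<sigma> \<omega> + x < ?\<tau> \<omega>} = ?A"
          by auto
        then show ?thesis using False by simp
      qed
      ultimately show "emeasure \<nu> {x<..} = emeasure (scale_measure (prob ?A) ?E) {x<..}"
        using k by (simp add: \<nu> emeasure_eq_measure emeasure_exponential_greaterThan ennreal_mult)
    qed
    then have "emeasure \<nu> B = ennreal (prob ?A) * emeasure ?E B" by simp
    moreover have "emeasure (distr Mk borel \<sigma>) A = ennreal (prob ?A)"
    proof -
      have "emeasure (distr Mk borel \<sigma>) A = emeasure Mk {\<omega> \<in> space M. \<sigma> \<omega> \<in> A}"
        by (subst emeasure_distr) (auto simp: space_Mk vimage_def Int_def conj_commute)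
      also have "\<dots> = emeasure M {\<omega> \<in> {\<omega> \<in> space M. \<sigma> \<omega> \<in> A}. C (\<sigma> \<omega>) \<omega> = k}"
        by (rule em) measurable
      also have "{\<omega> \<in> {\<omega> \<in> space M. \<sigma> \<omega> \<in> A}. C (\<sigma> \<omega>) \<omega> = k} = ?A" by auto
      finally show ?thesis by (simp add: emeasure_eq_measure)
    qed
    moreover have "emeasure (?L) (A \<times> B) = emeasure \<nu> B"
    proof -
      have "emeasure (?L) (A \<times> B)
          = emeasure Mk ?S"
        using B by (subst emeasure_distr) (auto simp: space_Mk vimage_def Int_def conj_commute)
      also have "\<dots> = emeasure M {\<omega> \<in> ?S. C (\<sigma> \<omega>) \<omega> = k}"
        by (intro em) measurable
      also have "{\<omega> \<in> ?S. C (\<sigma> \<omega>) \<omega> = k}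
          = {\<omega> \<in> ?A. ?\<tau> \<omega> - \<sigma> \<omega> \<in> B}" by auto
      finally show ?thesis by (simp add: \<nu>[OF B])
    qed
    ultimately show "emeasure (distr Mk borel \<sigma>) A * emeasure ?E B
        = emeasure (?L) (A \<times> B)"
      by simp
  qed
qed

end

text \<open>Functions of time are regular on the half-line only. Composition with
  \<open>max 0\<close> makes them Borel on the whole line, which is the origin of the
  \<open>max 0\<close> in the integrands below.\<close>

lemma borel_measurable_continuous_nonneg:
  fixes f :: "real \<Rightarrow> real"
  assumes "continuous_on {0..} f"
  shows "(\<lambda>t. f (max 0 t)) \<in> borel_measurable borel"
  by (intro borel_measurable_continuous_onI continuous_on_compose2[OF assms] continuous_intros) auto

context forest_fire
begin

text \<open>In the logarithmic derivative of exp(-k h) \<phi>(a+h)^k the contributions -k and k (1 -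
  X) add up to -k X, so its negative \<open>F\<close> is an antiderivative of the integrand. It
  rises from -\<phi>(a)^k at 0 to 0 at infinity.\<close>

lemma nn_integral_characteristic:
  assumes char: "is_characteristic v y \<phi>" and a: "a \<ge> 0" and k: "k \<ge> (1::nat)"
  shows "(\<integral>\<^sup>+h. ennreal (exponential_density (real k) h) *
      ennreal (\<phi> (max 0 (a + h)) ^ k * X_gf v (max 0 (a + h)) (\<phi> (max 0 (a + h)))) \<partial>lborel) = ennreal (\<phi> a ^ k)"
proof -
  define f where "f h = real k * exp (- (real k * h)) * (\<phi> (a + h) ^ k * X_gf v (a + h) (\<phi> (a + h)))" for h
  define F where "F h = - (exp (- (real k * h)) * \<phi> (a + h) ^ k)" for h
  have cont: "continuous_on {0..} \<phi>" using char by (simp add: is_characteristic_def)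
  have unit: "\<phi> t \<in> {0<..1}" if "t \<ge> 0" for t using char that by (simp add: is_characteristic_def)
  have unit': "0 < \<phi> t" "\<phi> t \<le> 1" if "t \<ge> 0" for t using unit[OF that] by auto
  have Xb: "0 \<le> X_gf v t (\<phi> t)" if "t \<ge> 0" for t
    using X_bounds[OF that, of "\<phi> t"] unit'[OF that] by auto
  have f0: "f h \<ge> 0" if "h > 0" for h
    unfolding f_def using that a unit'(1)[of "a + h"] Xb[of "a + h"]
    by (intro mult_nonneg_nonneg zero_le_power) auto
  have contX: "continuous_on {0..} (\<lambda>t. X_gf v t (\<phi> t))"
    by (rule continuous_on_X[OF cont]) (use unit in \<open>force+\<close>)
  have shift: "continuous_on {0..} (\<lambda>h. g (a + h))" if "continuous_on {0..} g" for g :: "real \<Rightarrow> real"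
    by (rule continuous_on_compose2[OF that]) (use a in \<open>auto intro!: continuous_intros\<close>)
  have contf: "continuous_on {0..} f"
    unfolding f_def by (intro continuous_intros shift cont contX)
  have contF: "continuous_on {0..} F"
    unfolding F_def by (intro continuous_intros shift cont)
  have at0: "(F \<longlongrightarrow> - (\<phi> a ^ k)) (at_right 0)"
  proof -
    have "(F \<longlongrightarrow> F 0) (at 0 within {0..})"
      using contF by (simp add: continuous_on_def)
    then have "(F \<longlongrightarrow> F 0) (at_right 0)"
      by (rule tendsto_within_subset) auto
    then show ?thesis by (simp add: F_def)
  qed
  have atinf: "(F \<longlongrightarrow> 0) at_top"
  proof (rule Lim_null_comparison)
    show "\<forall>\<^sub>F h in at_top. norm (F h) \<le> exp (- (real k * h))"
      using eventually_ge_at_top[of 0]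
    proof eventually_elim
      case (elim h)
      have "\<phi> (a + h) ^ k \<le> 1" "0 \<le> \<phi> (a + h) ^ k"
        using unit'[of "a + h"] a elim by (auto intro!: power_le_one)
      then show ?case by (simp add: F_def mult_left_le)
    qed
    have "filterlim (\<lambda>h. real k * h) at_top at_top"
      using k by (intro filterlim_tendsto_pos_mult_at_top[OF tendsto_const _ filterlim_ident]) auto
    then show "((\<lambda>h. exp (- (real k * h))) \<longlongrightarrow> 0) at_top"
      by (intro filterlim_compose[OF exp_at_bot] filterlim_uminus_at_bot_at_top[THEN filterlim_compose])
  qed
  have deriv: "(F has_real_derivative f h) (at h)" if h: "h > 0" for h
  proof -
    have pos: "a + h > 0" using a h by simp
    define D where "D = \<phi> (a + h) * (1 - X_gf v (a + h) (\<phi> (a + h)))"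
    have "(\<phi> has_real_derivative D) (at (a + h))"
      using char pos by (simp add: is_characteristic_def D_def)
    then have "((\<lambda>h. \<phi> (a + h)) has_real_derivative D) (at h)"
      using DERIV_shift[of \<phi> D h a] by (simp add: add.commute)
    from DERIV_power[OF this, of k]
    have pw: "((\<lambda>h. \<phi> (a + h) ^ k) has_real_derivative real k * (D * \<phi> (a + h) ^ (k - Suc 0))) (at h)" .
    have ex: "((\<lambda>h. exp (- (real k * h))) has_real_derivative exp (- (real k * h)) * (- real k)) (at h)"
      by (auto intro!: derivative_eq_intros)
    have "(F has_real_derivative - (exp (- (real k * h)) * (- real k) * \<phi> (a + h) ^ k
        + real k * (D * \<phi> (a + h) ^ (k - Suc 0)) * exp (- (real k * h)))) (at h)"
      unfolding F_def by (rule DERIV_minus[OF DERIV_mult[OF ex pw]])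
    moreover have "D * \<phi> (a + h) ^ (k - Suc 0) = \<phi> (a + h) ^ k * (1 - X_gf v (a + h) (\<phi> (a + h)))"
      using power_minus_mult[of k "\<phi> (a + h)"] k by (simp add: D_def mult_ac)
    ultimately show ?thesis by (simp add: f_def algebra_simps)
  qed
  have einterval: "einterval (ereal 0) \<infinity> = {0<..}"
    by (auto simp: einterval_def)
  have F: "set_integrable lborel (einterval (ereal 0) \<infinity>) f" "(LBINT x=ereal 0..\<infinity>. f x) = 0 - - (\<phi> a ^ k)"
  proof -
    have isCont: "isCont f x" if "x > 0" for x
      by (rule continuous_on_interior[OF contf]) (use that in simp)
    have lim: "((F \<circ> real_of_ereal) \<longlongrightarrow> - (\<phi> a ^ k)) (at_right (ereal 0))"
      "((F \<circ> real_of_ereal) \<longlongrightarrow> 0) (at_left \<infinity>)"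
      unfolding ereal_tendsto_simps using at0 atinf .
    show "set_integrable lborel (einterval (ereal 0) \<infinity>) f"
      by (rule interval_integral_FTC_nonneg(1)[OF _ _ _ _ lim]) (use deriv isCont f0 in auto)
    show "(LBINT x=ereal 0..\<infinity>. f x) = 0 - - (\<phi> a ^ k)"
      by (rule interval_integral_FTC_nonneg(2)[OF _ _ _ _ lim]) (use deriv isCont f0 in auto)
  qed
  have "(\<integral>\<^sup>+h. ennreal (exponential_density (real k) h) *
      ennreal (\<phi> (max 0 (a + h)) ^ k * X_gf v (max 0 (a + h)) (\<phi> (max 0 (a + h)))) \<partial>lborel)
      = (\<integral>\<^sup>+h. ennreal (indicator {0<..} h *\<^sub>R f h) \<partial>lborel)"
  proof (rule nn_integral_cong_AE)
    show "AE h in lborel. ennreal (exponential_density (real k) h) *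
      ennreal (\<phi> (max 0 (a + h)) ^ k * X_gf v (max 0 (a + h)) (\<phi> (max 0 (a + h)))) = ennreal (indicator {0<..} h *\<^sub>R f h)"
      using AE_lborel_singleton[of 0]
    proof eventually_elim
      case (elim h)
      show ?case
      proof (cases "h > 0")
        case True
        then have "max 0 (a + h) = a + h" using a by simp
        then show ?thesis
          using True by (simp add: exponential_density_def f_def ennreal_mult'[symmetric] mult_ac)
      next
        case False
        then show ?thesis using elim by (simp add: exponential_density_def)
      qed
    qed
  qed
  also have "\<dots> = ennreal (LINT h|lborel. indicator {0<..} h *\<^sub>R f h)"
    by (rule nn_integral_eq_integral)
      (use F(1) f0 in \<open>auto simp: set_integrable_def einterval indicator_def\<close>)
  also have "(LINT h|lborel. indicator {0<..} h *\<^sub>R f h) = \<phi> a ^ k"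
    using F(2) by (simp add: interval_lebesgue_integral_def set_lebesgue_integral_def einterval)
  finally show ?thesis .
qed

end

section \<open>Expectations across a single jump\<close>

locale tagged_forest_fire = forest_fire p v + tagged_cluster_process v M C
  for p :: "nat \<Rightarrow> real" and v :: "nat \<Rightarrow> real \<Rightarrow> real" and M :: "'w measure" and C :: "real \<Rightarrow> 'w \<Rightarrow> nat"
begin

lemma v_borel_measurable: "l \<ge> 1 \<Longrightarrow> (\<lambda>t. v l (max 0 t)) \<in> borel_measurable borel"
  by (rule borel_measurable_continuous_nonneg[OF v_continuous])

lemma jump_measurable:
  assumes \<sigma>: "finite_stopping_time M C \<sigma>"
  shows "\<sigma> \<in> borel_measurable M" "(\<lambda>\<omega>. C (\<sigma> \<omega>) \<omega>) \<in> measurable M (count_space UNIV)"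
    "(\<lambda>\<omega>. next_jump C (\<sigma> \<omega>) \<omega>) \<in> borel_measurable M"
    "(\<lambda>\<omega>. C (next_jump C (\<sigma> \<omega>) \<omega>) \<omega>) \<in> measurable M (count_space UNIV)"
    "\<And>\<omega>. \<omega> \<in> space M \<Longrightarrow> 0 \<le> \<sigma> \<omega>" "\<And>\<omega>. \<omega> \<in> space M \<Longrightarrow> 0 \<le> next_jump C (\<sigma> \<omega>) \<omega>"
proof -
  note s = finite_stopping_timeD[OF \<sigma>]
  show 1: "\<sigma> \<in> borel_measurable M" "(\<lambda>\<omega>. C (\<sigma> \<omega>) \<omega>) \<in> measurable M (count_space UNIV)"
    "(\<lambda>\<omega>. next_jump C (\<sigma> \<omega>) \<omega>) \<in> borel_measurable M"
    using s(1,4) measurable_next_jump[OF s(1,2)] by auto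
  show "0 \<le> \<sigma> \<omega>" if "\<omega> \<in> space M" for \<omega> using s(2) that .
  show pos: "0 \<le> next_jump C (\<sigma> \<omega>) \<omega>" if "\<omega> \<in> space M" for \<omega>
    using E_path.next_jump_ge[OF E_path[OF that] s(2)[OF that]] s(2)[OF that] by simp
  show "(\<lambda>\<omega>. C (next_jump C (\<sigma> \<omega>) \<omega>) \<omega>) \<in> measurable M (count_space UNIV)"
    by (rule measurable_C_at[OF 1(3) pos])
qed

text \<open>The increments 1, 2, ... are disjoint events whose probabilities are the expectations of
  \<open>v l\<close> at the jump time, and these add up to 1. This disposes of the dummy value of
  \<open>next_jump\<close> and of departures from 1 that are not jumps.\<close>

lemma AE_jump_increases:
  assumes \<sigma>: "finite_stopping_time M C \<sigma>"
  shows "AE \<omega> in M. C (\<sigma> \<omega>) \<omega> < C (next_jump C (\<sigma> \<omega>) \<omega>) \<omega>"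
proof -
  let ?\<tau> = "\<lambda>\<omega>. next_jump C (\<sigma> \<omega>) \<omega>"
  let ?v = "\<lambda>l \<omega>. v (Suc l) (max 0 (?\<tau> \<omega>))"
  note j = jump_measurable[OF \<sigma>]
  note [measurable] = j(1-4)
  interpret filtration "space M" "natural_filtration M C" by (rule filtration_natural)
  have past: "space M \<in> past M C \<sigma>"
    using sets.top[of "pre_sigma \<sigma>"] by (simp add: space_pre_sigma)
  define S where "S l = {\<omega> \<in> space M. C (?\<tau> \<omega>) \<omega> = C (\<sigma> \<omega>) \<omega> + Suc l}" for l
  have S: "S l \<in> sets M" for l
  proof -
    have "Measurable.pred M (\<lambda>\<omega>. C (?\<tau> \<omega>) \<omega> = C (\<sigma> \<omega>) \<omega> + Suc l)"
      by (rule pred_eq_nat) (use j in \<open>auto intro: measurable_compose\<close>)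
    then show ?thesis by (simp add: S_def)
  qed
  have vm: "(\<lambda>\<omega>. ?v l \<omega>) \<in> borel_measurable M" for l
    by (rule measurable_compose[OF j(3) v_borel_measurable]) simp
  have "emeasure M (S l) = (\<integral>\<^sup>+\<omega>. ennreal (?v l \<omega>) \<partial>M)" for l
  proof -
    have "prob (S l) = (LINT \<omega>:space M|M. indicat_real UNIV (?\<tau> \<omega>) * v (Suc l) (?\<tau> \<omega>))"
      using increment[OF \<sigma> past, of UNIV "Suc l"] by (simp add: S_def)
    also have "\<dots> = (LINT \<omega>|M. ?v l \<omega>)"
      unfolding set_lebesgue_integral_def
      by (rule Bochner_Integration.integral_cong) (use j(6) in \<open>auto simp: max_def\<close>)
    finally have "emeasure M (S l) = ennreal (LINT \<omega>|M. ?v l \<omega>)"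
      by (simp add: emeasure_eq_measure)
    also have "\<dots> = (\<integral>\<^sup>+\<omega>. ennreal (?v l \<omega>) \<partial>M)"
    proof (rule nn_integral_eq_integral[symmetric])
      show "integrable M (\<lambda>\<omega>. ?v l \<omega>)"
        by (rule integrable_const_bound[where B = 1]) (use vm v_nonneg v_le_one in auto)
    qed (use v_nonneg in auto)
    finally show ?thesis .
  qed
  then have "(\<Sum>l. emeasure M (S l)) = (\<integral>\<^sup>+\<omega>. (\<Sum>l. ennreal (?v l \<omega>)) \<partial>M)"
    using vm by (subst nn_integral_suminf) auto
  also have "\<dots> = (\<integral>\<^sup>+\<omega>. 1 \<partial>M)"
  proof (rule nn_integral_cong)
    fix \<omega>
    have "(\<lambda>l. ennreal (?v l \<omega>)) sums ennreal 1"
      using has_sum_from_1_imp_LIMSEQ(2)[OF v_has_sum] v_nonneg by (subst sums_ennreal) auto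
    then show "(\<Sum>l. ennreal (?v l \<omega>)) = 1"
      by (simp add: sums_iff)
  qed
  also have "\<dots> = 1" by (simp add: emeasure_space_1)
  finally have "(\<Sum>l. emeasure M (S l)) = 1" .
  moreover have "(\<Sum>l. emeasure M (S l)) = emeasure M (\<Union>l. S l)"
    by (rule suminf_emeasure) (use S in \<open>auto simp: disjoint_family_on_def S_def\<close>)
  ultimately have "prob (\<Union>l. S l) = 1" by (simp add: emeasure_eq_measure)
  then have "AE \<omega> in M. \<omega> \<in> (\<Union>l. S l)" by (rule AE_prob_1)
  then show ?thesis by eventually_elim (auto simp: S_def)
qed

text \<open>With B varying, \<open>increment\<close> equates the laws of the jump time under the
  densities \<open>f1\<close> and \<open>f2\<close>; equality of these measures extends the identity
  from indicators to every g.\<close>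

lemma nn_integral_increment:
  assumes \<sigma>: "finite_stopping_time M C \<sigma>" and l: "l \<ge> 1" and g: "g \<in> borel_measurable borel"
  shows "(\<integral>\<^sup>+\<omega>. indicator {\<omega>. C (\<sigma> \<omega>) \<omega> = k \<and> C (next_jump C (\<sigma> \<omega>) \<omega>) \<omega> = k + l} \<omega> * g (next_jump C (\<sigma> \<omega>) \<omega>) \<partial>M)
    = (\<integral>\<^sup>+\<omega>. indicator {\<omega>. C (\<sigma> \<omega>) \<omega> = k} \<omega> * ennreal (v l (max 0 (next_jump C (\<sigma> \<omega>) \<omega>)))
        * g (next_jump C (\<sigma> \<omega>) \<omega>) \<partial>M)"
proof -
  note j = jump_measurable[OF \<sigma>]
  let ?\<tau> = "\<lambda>\<omega>. next_jump C (\<sigma> \<omega>) \<omega>"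
  note [measurable] = j(1-4) g
  have [measurable]: "(\<lambda>\<omega>. v l (max 0 (?\<tau> \<omega>))) \<in> borel_measurable M"
    by (rule measurable_compose[OF j(3) v_borel_measurable[OF l]])
  define A where "A = {\<omega> \<in> space M. C (\<sigma> \<omega>) \<omega> = k}"
  have past: "A \<in> past M C \<sigma>" using stopped_in_past[OF \<sigma>, of UNIV k] by (simp add: A_def)
  have A[measurable]: "A \<in> sets M" unfolding A_def by measurable
  define f1 where "f1 \<omega> = (indicator {\<omega>. C (\<sigma> \<omega>) \<omega> = k \<and> C (?\<tau> \<omega>) \<omega> = k + l} \<omega> :: ennreal)" for \<omega>
  define f2 where "f2 \<omega> = indicator {\<omega>. C (\<sigma> \<omega>) \<omega> = k} \<omega> * ennreal (v l (max 0 (?\<tau> \<omega>)))" for \<omega>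
  have [measurable]: "f1 \<in> borel_measurable M" "f2 \<in> borel_measurable M"
    unfolding f1_def f2_def by measurable
  have eq: "distr (density M f1) borel ?\<tau> = distr (density M f2) borel ?\<tau>"
  proof (rule measure_eqI)
    fix B assume "B \<in> sets (distr (density M f1) borel ?\<tau>)"
    then have B[measurable]: "B \<in> sets borel" by simp
    have TB: "{\<omega> \<in> space M. ?\<tau> \<omega> \<in> B} \<in> sets M" by measurable
    have em: "emeasure (distr (density M f) borel ?\<tau>) B = (\<integral>\<^sup>+\<omega>. f \<omega> * indicator B (?\<tau> \<omega>) \<partial>M)"
      if f: "f \<in> borel_measurable M" for f
    proof -
      have "emeasure (distr (density M f) borel ?\<tau>) B = emeasure (density M f) {\<omega> \<in> space M. ?\<tau> \<omega> \<in> B}"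
        by (subst emeasure_distr) (auto simp: vimage_def Int_def conj_commute)
      also have "\<dots> = (\<integral>\<^sup>+\<omega>. f \<omega> * indicator {\<omega> \<in> space M. ?\<tau> \<omega> \<in> B} \<omega> \<partial>M)"
        by (rule emeasure_density[OF f TB])
      also have "\<dots> = (\<integral>\<^sup>+\<omega>. f \<omega> * indicator B (?\<tau> \<omega>) \<partial>M)"
        by (rule nn_integral_cong) (auto simp: indicator_def)
      finally show ?thesis .
    qed
    let ?S = "{\<omega> \<in> A. ?\<tau> \<omega> \<in> B \<and> C (?\<tau> \<omega>) \<omega> = C (\<sigma> \<omega>) \<omega> + l}"
    have S: "?S \<in> sets M"
    proof -
      have "{\<omega> \<in> space M. C (\<sigma> \<omega>) \<omega> = k \<and> ?\<tau> \<omega> \<in> B \<and> C (?\<tau> \<omega>) \<omega> = k + l} \<in> sets M" by measurable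
      also have "{\<omega> \<in> space M. C (\<sigma> \<omega>) \<omega> = k \<and> ?\<tau> \<omega> \<in> B \<and> C (?\<tau> \<omega>) \<omega> = k + l} = ?S"
        by (auto simp: A_def)
      finally show ?thesis .
    qed
    have "emeasure (distr (density M f1) borel ?\<tau>) B = (\<integral>\<^sup>+\<omega>. indicator ?S \<omega> \<partial>M)"
      unfolding em[OF \<open>f1 \<in> borel_measurable M\<close>]
      by (rule nn_integral_cong) (auto simp: f1_def indicator_def A_def)
    also have "\<dots> = ennreal (prob ?S)" using S by (simp add: emeasure_eq_measure)
    also have "prob ?S = (LINT \<omega>:A|M. indicat_real B (?\<tau> \<omega>) * v l (?\<tau> \<omega>))"
      by (rule increment[OF \<sigma> past B l])
    also have "\<dots> = (LINT \<omega>|M. indicat_real A \<omega> * indicat_real B (?\<tau> \<omega>) * v l (max 0 (?\<tau> \<omega>)))"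
      unfolding set_lebesgue_integral_def
      by (rule Bochner_Integration.integral_cong) (use j(6) in \<open>auto simp: max_def mult_ac\<close>)
    also have "ennreal \<dots> = (\<integral>\<^sup>+\<omega>. ennreal (indicat_real A \<omega> * indicat_real B (?\<tau> \<omega>) * v l (max 0 (?\<tau> \<omega>))) \<partial>M)"
    proof (rule nn_integral_eq_integral[symmetric])
      show "integrable M (\<lambda>\<omega>. indicat_real A \<omega> * indicat_real B (?\<tau> \<omega>) * v l (max 0 (?\<tau> \<omega>)))"
      proof (rule integrable_const_bound[where B = 1])
        show "AE \<omega> in M. norm (indicat_real A \<omega> * indicat_real B (?\<tau> \<omega>) * v l (max 0 (?\<tau> \<omega>))) \<le> 1"
          using v_nonneg[OF l] v_le_one[OF l] by (intro AE_I2) (auto simp: indicator_def)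
      qed measurable
    qed (use v_nonneg[OF l] in \<open>auto simp: indicator_def\<close>)
    also have "\<dots> = (\<integral>\<^sup>+\<omega>. f2 \<omega> * indicator B (?\<tau> \<omega>) \<partial>M)"
      by (rule nn_integral_cong) (auto simp: f2_def indicator_def A_def)
    also have "\<dots> = emeasure (distr (density M f2) borel ?\<tau>) B"
      by (rule em[symmetric]) measurable
    finally show "emeasure (distr (density M f1) borel ?\<tau>) B = emeasure (distr (density M f2) borel ?\<tau>) B" .
  qed simp
  have "(\<integral>\<^sup>+\<omega>. f \<omega> * g (?\<tau> \<omega>) \<partial>M) = (\<integral>\<^sup>+t. g t \<partial>distr (density M f) borel ?\<tau>)"
    if [measurable]: "f \<in> borel_measurable M" for f
    by (subst nn_integral_distr) (auto simp: nn_integral_density)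
  from this[of f1] this[of f2] eq show ?thesis
    by (simp add: f1_def f2_def)
qed

text \<open>The product law of \<open>\<sigma>\<close> and the waiting time lets the waiting time be
  integrated out first with \<open>\<sigma>\<close> held fixed; this inner integral is the
  zero-drift integral with a = \<sigma>.\<close>

lemma nn_integral_jump:
  assumes \<sigma>: "finite_stopping_time M C \<sigma>" and k: "k \<ge> 1" and char: "is_characteristic v y \<phi>"
  shows "(\<integral>\<^sup>+\<omega>. indicator {\<omega>. C (\<sigma> \<omega>) \<omega> = k} \<omega> * ennreal (\<phi> (max 0 (next_jump C (\<sigma> \<omega>) \<omega>)) ^ k
        * X_gf v (max 0 (next_jump C (\<sigma> \<omega>) \<omega>)) (\<phi> (max 0 (next_jump C (\<sigma> \<omega>) \<omega>)))) \<partial>M)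
    = (\<integral>\<^sup>+\<omega>. indicator {\<omega>. C (\<sigma> \<omega>) \<omega> = k} \<omega> * ennreal (\<phi> (\<sigma> \<omega>) ^ k) \<partial>M)"
proof -
  note j = jump_measurable[OF \<sigma>]
  let ?\<tau> = "\<lambda>\<omega>. next_jump C (\<sigma> \<omega>) \<omega>"
  let ?K = "\<lambda>\<omega>. indicator {\<omega>. C (\<sigma> \<omega>) \<omega> = k} \<omega> :: ennreal"
  note [measurable] = j(1-4)
  have cont: "continuous_on {0..} \<phi>" and unit: "\<And>t. t \<ge> 0 \<Longrightarrow> \<phi> t \<in> {0<..1}"
    using char by (auto simp: is_characteristic_def)
  define H where "H t = ennreal (\<phi> (max 0 t) ^ k * X_gf v (max 0 t) (\<phi> (max 0 t)))" for t
  have [measurable]: "(\<lambda>t. \<phi> (max 0 t)) \<in> borel_measurable borel"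
    by (rule borel_measurable_continuous_nonneg[OF cont])
  have "continuous_on {0..} (\<lambda>t. X_gf v t (\<phi> t))"
    by (rule continuous_on_X[OF cont]) (use unit in force)+
  from borel_measurable_continuous_nonneg[OF this]
  have [measurable]: "(\<lambda>t. X_gf v (max 0 t) (\<phi> (max 0 t))) \<in> borel_measurable borel" .
  have [measurable]: "H \<in> borel_measurable borel" unfolding H_def by measurable
  define Mk where "Mk = density M (\<lambda>\<omega>. ?K \<omega>)"
  let ?E = "density lborel (\<lambda>x. ennreal (exponential_density (real k) x))"
  have [measurable_cong]: "sets Mk = sets M" by (simp add: Mk_def)
  have dens: "(\<integral>\<^sup>+\<omega>. ?K \<omega> * f \<omega> \<partial>M) = (\<integral>\<^sup>+\<omega>. f \<omega> \<partial>Mk)"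
    if [measurable]: "f \<in> borel_measurable M" for f
    unfolding Mk_def by (subst nn_integral_density) auto
  interpret E: prob_space ?E
    using prob_space_exponential_density[of "real k"] k by simp
  have "(\<integral>\<^sup>+\<omega>. ?K \<omega> * H (?\<tau> \<omega>) \<partial>M) = (\<integral>\<^sup>+\<omega>. H (?\<tau> \<omega>) \<partial>Mk)"
    by (rule dens) measurable
  also have "\<dots> = (\<integral>\<^sup>+z. H (fst z + snd z) \<partial>distr Mk (borel \<Otimes>\<^sub>M borel) (\<lambda>\<omega>. (\<sigma> \<omega>, ?\<tau> \<omega> - \<sigma> \<omega>)))"
    by (subst nn_integral_distr) auto
  also have "\<dots> = (\<integral>\<^sup>+z. H (fst z + snd z) \<partial>(distr Mk borel \<sigma> \<Otimes>\<^sub>M ?E))"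
    using holding_law[OF \<sigma> k] by (simp add: Mk_def)
  also have "\<dots> = (\<integral>\<^sup>+a. \<integral>\<^sup>+h. H (a + h) \<partial>?E \<partial>distr Mk borel \<sigma>)"
    by (subst E.nn_integral_fst[symmetric]) auto
  also have "\<dots> = (\<integral>\<^sup>+\<omega>. \<integral>\<^sup>+h. H (\<sigma> \<omega> + h) \<partial>?E \<partial>Mk)"
    by (subst nn_integral_distr) (auto intro!: E.borel_measurable_nn_integral)
  also have "\<dots> = (\<integral>\<^sup>+\<omega>. ennreal (\<phi> (\<sigma> \<omega>) ^ k) \<partial>Mk)"
  proof (rule nn_integral_cong)
    fix \<omega> assume "\<omega> \<in> space Mk"
    then have "\<sigma> \<omega> \<ge> 0" using j(5) by (simp add: Mk_def)
    have "(\<integral>\<^sup>+h. H (\<sigma> \<omega> + h) \<partial>?E) = (\<integral>\<^sup>+h. ennreal (exponential_density (real k) h) * H (\<sigma> \<omega> + h) \<partial>lborel)"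
      by (subst nn_integral_density) auto
    also have "\<dots> = ennreal (\<phi> (\<sigma> \<omega>) ^ k)"
      unfolding H_def by (rule nn_integral_characteristic[OF char \<open>\<sigma> \<omega> \<ge> 0\<close> k])
    finally show "(\<integral>\<^sup>+h. H (\<sigma> \<omega> + h) \<partial>?E) = ennreal (\<phi> (\<sigma> \<omega>) ^ k)" .
  qed
  also have "\<dots> = (\<integral>\<^sup>+\<omega>. ennreal (\<phi> (max 0 (\<sigma> \<omega>)) ^ k) \<partial>Mk)"
    by (rule nn_integral_cong) (use j(5) in \<open>auto simp: Mk_def max_def\<close>)
  also have "\<dots> = (\<integral>\<^sup>+\<omega>. ?K \<omega> * ennreal (\<phi> (max 0 (\<sigma> \<omega>)) ^ k) \<partial>M)"
    by (rule dens[symmetric]) measurable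
  also have "\<dots> = (\<integral>\<^sup>+\<omega>. ?K \<omega> * ennreal (\<phi> (\<sigma> \<omega>) ^ k) \<partial>M)"
    by (rule nn_integral_cong) (use j(5) in \<open>auto simp: max_def\<close>)
  finally show ?thesis by (simp add: H_def)
qed

text \<open>The martingale step. After splitting by the state k and the increment l, the increment
  law replaces the indicator by \<open>v l\<close>, and summing \<phi>^(k+l) v_l over l produces
  \<phi>^k X(\<phi>), whose integral over the jump time is known.\<close>

lemma nn_integral_next_jump:
  assumes \<sigma>: "finite_stopping_time M C \<sigma>" and char: "is_characteristic v y \<phi>"
  shows "(\<integral>\<^sup>+\<omega>. ennreal (\<phi> (next_jump C (\<sigma> \<omega>) \<omega>) ^ C (next_jump C (\<sigma> \<omega>) \<omega>) \<omega>) \<partial>M)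
    = (\<integral>\<^sup>+\<omega>. ennreal (\<phi> (\<sigma> \<omega>) ^ C (\<sigma> \<omega>) \<omega>) \<partial>M)"
proof -
  note j = jump_measurable[OF \<sigma>]
  let ?\<tau> = "\<lambda>\<omega>. next_jump C (\<sigma> \<omega>) \<omega>"
  note [measurable] = j(1-4)
  have cont: "continuous_on {0..} \<phi>" and unit: "\<And>t. t \<ge> 0 \<Longrightarrow> \<phi> t \<in> {0<..1}"
    using char by (auto simp: is_characteristic_def)
  have unit': "0 < \<phi> (max 0 t)" "\<phi> (max 0 t) \<le> 1" for t using unit[of "max 0 t"] by auto
  define \<Phi> where "\<Phi> t = \<phi> (max 0 t)" for t
  have \<Phi>m[measurable]: "\<Phi> \<in> borel_measurable borel"
    unfolding \<Phi>_def by (rule borel_measurable_continuous_nonneg[OF cont])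
  have vm[measurable]: "(\<lambda>\<omega>. v (Suc l) (max 0 (?\<tau> \<omega>))) \<in> borel_measurable M" for l
    by (rule measurable_compose[OF j(3) v_borel_measurable]) simp
  have ones: "(\<Sum>k. indicator {\<omega>. C (\<sigma> \<omega>) \<omega> = k} \<omega> * c) = (c :: ennreal)" for \<omega> c
  proof -
    have "(\<Sum>k. indicator {\<omega>. C (\<sigma> \<omega>) \<omega> = k} \<omega> * c)
        = (\<Sum>k\<in>{C (\<sigma> \<omega>) \<omega>}. indicator {\<omega>. C (\<sigma> \<omega>) \<omega> = k} \<omega> * c)"
      by (rule suminf_finite) auto
    then show ?thesis by simp
  qed
  let ?I = "\<lambda>k l \<omega>. indicator {\<omega>. C (\<sigma> \<omega>) \<omega> = k \<and> C (?\<tau> \<omega>) \<omega> = k + Suc l} \<omega> :: ennreal"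
  let ?J = "\<lambda>k \<omega>. indicator {\<omega>. C (\<sigma> \<omega>) \<omega> = k} \<omega> :: ennreal"
  let ?G = "\<lambda>\<omega> k l. ennreal (\<Phi> (?\<tau> \<omega>) ^ (k + Suc l))"
  have "(\<integral>\<^sup>+\<omega>. ennreal (\<phi> (?\<tau> \<omega>) ^ C (?\<tau> \<omega>) \<omega>) \<partial>M)
      = (\<integral>\<^sup>+\<omega>. (\<Sum>k. \<Sum>l. ?I k l \<omega> * ?G \<omega> k l) \<partial>M)"
  proof (rule nn_integral_cong_AE)
    show "AE \<omega> in M. ennreal (\<phi> (?\<tau> \<omega>) ^ C (?\<tau> \<omega>) \<omega>) = (\<Sum>k. \<Sum>l. ?I k l \<omega> * ?G \<omega> k l)"
      using AE_jump_increases[OF \<sigma>] AE_space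
    proof eventually_elim
      case (elim \<omega>)
      then obtain l where l: "C (?\<tau> \<omega>) \<omega> = C (\<sigma> \<omega>) \<omega> + Suc l"
        using less_imp_Suc_add by fastforce
      have "(\<Sum>l'. ?I k l' \<omega> * ennreal (\<Phi> (?\<tau> \<omega>) ^ (k + Suc l')))
          = ?J k \<omega> * ennreal (\<Phi> (?\<tau> \<omega>) ^ C (?\<tau> \<omega>) \<omega>)" for k
      proof -
        have "(\<Sum>l'. ?I k l' \<omega> * ennreal (\<Phi> (?\<tau> \<omega>) ^ (k + Suc l')))
            = (\<Sum>l'\<in>{l}. ?I k l' \<omega> * ennreal (\<Phi> (?\<tau> \<omega>) ^ (k + Suc l')))"
          by (rule suminf_finite) (use l in \<open>auto simp: indicator_def\<close>)
        then show ?thesis using l by (auto simp: indicator_def)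
      qed
      then show ?case using ones j(6)[OF elim(2)] by (simp add: \<Phi>_def max_def)
    qed
  qed
  also have "\<dots> = (\<Sum>k. \<Sum>l. \<integral>\<^sup>+\<omega>. ?I k l \<omega> * ?G \<omega> k l \<partial>M)"
    by (subst nn_integral_suminf, measurable, subst nn_integral_suminf) auto
  also have "\<dots> = (\<Sum>k. \<integral>\<^sup>+\<omega>. ?J k \<omega> * ennreal (\<phi> (\<sigma> \<omega>) ^ k) \<partial>M)"
  proof (rule suminf_cong)
    fix k
    show "(\<Sum>l. \<integral>\<^sup>+\<omega>. ?I k l \<omega> * ?G \<omega> k l \<partial>M)
        = (\<integral>\<^sup>+\<omega>. ?J k \<omega> * ennreal (\<phi> (\<sigma> \<omega>) ^ k) \<partial>M)"
    proof (cases "k \<ge> 1")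
      case True
      have "(\<integral>\<^sup>+\<omega>. ?I k l \<omega> * ?G \<omega> k l \<partial>M)
          = (\<integral>\<^sup>+\<omega>. ?J k \<omega> * ennreal (v (Suc l) (max 0 (?\<tau> \<omega>)))
              * ?G \<omega> k l \<partial>M)" for l
        by (rule nn_integral_increment[OF \<sigma>]) (simp, measurable)
      then have "(\<Sum>l. \<integral>\<^sup>+\<omega>. ?I k l \<omega> * ?G \<omega> k l \<partial>M)
          = (\<integral>\<^sup>+\<omega>. (\<Sum>l. ?J k \<omega> * ennreal (v (Suc l) (max 0 (?\<tau> \<omega>)))
              * ?G \<omega> k l) \<partial>M)"
        by (subst nn_integral_suminf) auto
      also have "\<dots> = (\<integral>\<^sup>+\<omega>. ?J k \<omega> * ennreal (\<phi> (max 0 (?\<tau> \<omega>)) ^ k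
          * X_gf v (max 0 (?\<tau> \<omega>)) (\<phi> (max 0 (?\<tau> \<omega>)))) \<partial>M)"
      proof (rule nn_integral_cong)
        fix \<omega>
        let ?z = "\<Phi> (?\<tau> \<omega>)" and ?t = "max 0 (?\<tau> \<omega>)"
        have z: "0 \<le> ?z" "?z \<in> {0..1}" using unit'[of "?\<tau> \<omega>"] by (auto simp: \<Phi>_def)
        have "(\<lambda>l. ?z ^ k * (?z ^ Suc l * v (Suc l) ?t)) sums (?z ^ k * X_gf v ?t ?z)"
          by (intro sums_mult X_sums z) auto
        then have "(\<lambda>l. ennreal (?z ^ k * (?z ^ Suc l * v (Suc l) ?t))) sums ennreal (?z ^ k * X_gf v ?t ?z)"
          using z X_bounds[OF _ z(2), of ?t] v_nonneg by (subst sums_ennreal) auto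
        moreover have "ennreal (?z ^ k * (?z ^ Suc l * v (Suc l) ?t))
            = ennreal (v (Suc l) ?t) * ennreal (?z ^ (k + Suc l))" for l
          using z v_nonneg[of "Suc l" ?t] by (simp add: ennreal_mult'[symmetric] power_add mult_ac)
        ultimately have "(\<Sum>l. ennreal (v (Suc l) ?t) * ennreal (?z ^ (k + Suc l))) = ennreal (?z ^ k * X_gf v ?t ?z)"
          by (simp add: sums_iff)
        then show "(\<Sum>l. ?J k \<omega> * ennreal (v (Suc l) ?t) * ennreal (?z ^ (k + Suc l)))
            = ?J k \<omega> * ennreal (\<phi> ?t ^ k * X_gf v ?t (\<phi> ?t))"
          by (simp add: \<Phi>_def mult.assoc ennreal_suminf_cmult del: power_Suc)
      qed
      also have "\<dots> = (\<integral>\<^sup>+\<omega>. ?J k \<omega> * ennreal (\<phi> (\<sigma> \<omega>) ^ k) \<partial>M)"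
        by (rule nn_integral_jump[OF \<sigma> True char])
      finally show ?thesis .
    next
      case False
      have "C (\<sigma> \<omega>) \<omega> \<noteq> k" if "\<omega> \<in> space M" for \<omega>
        using state[OF j(5)[OF that] that] False by auto
      then have "(\<integral>\<^sup>+\<omega>. ?I k l \<omega> * ?G \<omega> k l \<partial>M) = (\<integral>\<^sup>+\<omega>. 0 \<partial>M)"
        "(\<integral>\<^sup>+\<omega>. ?J k \<omega> * ennreal (\<phi> (\<sigma> \<omega>) ^ k) \<partial>M) = (\<integral>\<^sup>+\<omega>. 0 \<partial>M)" for l
        by (intro nn_integral_cong; auto simp: indicator_def)+
      then show ?thesis by simp
    qed
  qed
  also have "\<dots> = (\<Sum>k. \<integral>\<^sup>+\<omega>. ?J k \<omega> * ennreal (\<Phi> (\<sigma> \<omega>) ^ C (\<sigma> \<omega>) \<omega>) \<partial>M)"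
    by (intro suminf_cong nn_integral_cong) (use j(5) in \<open>auto simp: indicator_def \<Phi>_def max_def\<close>)
  also have "\<dots> = (\<integral>\<^sup>+\<omega>. (\<Sum>k. ?J k \<omega> * ennreal (\<Phi> (\<sigma> \<omega>) ^ C (\<sigma> \<omega>) \<omega>)) \<partial>M)"
    by (subst nn_integral_suminf) auto
  also have "\<dots> = (\<integral>\<^sup>+\<omega>. ennreal (\<phi> (\<sigma> \<omega>) ^ C (\<sigma> \<omega>) \<omega>) \<partial>M)"
    unfolding ones by (rule nn_integral_cong) (use j(5) in \<open>auto simp: \<Phi>_def max_def\<close>)
  finally show ?thesis .
qed

end

subsection \<open>The embedded jump chain and explosions\<close>

text \<open>A typical path together with its successive exit times. The assumption
  \<open>increase\<close> is the property that holds almost surely along the chain, so all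
  statements here remain deterministic.\<close>

locale E_jump_chain = E_path C \<omega> for C :: "real \<Rightarrow> 'w \<Rightarrow> nat" and \<omega> +
  fixes \<sigma> :: "nat \<Rightarrow> real" and N :: real
  assumes start: "0 \<le> \<sigma> 0" "\<sigma> 0 \<le> N"
    and step: "\<sigma> (Suc n) = exit_time C N (\<sigma> n) \<omega>"
    and increase: "C (\<sigma> n) \<omega> < C (next_jump C (\<sigma> n) \<omega>) \<omega>"
begin

lemma chain_range: "0 \<le> \<sigma> n" "\<sigma> n \<le> N"
proof (induction n)
  case (Suc n)
  { case 1
    then show ?case
      using next_jump_ge[OF Suc(1)] Suc start by (auto simp: step exit_time_def)
  next
    case 2
    then show ?case by (auto simp: step exit_time_def)
  }
qed (use start in auto)

text \<open>A jump to a strictly larger state leads neither to 1 nor to the old state, so the clause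
  that makes \<open>exit_time\<close> a stopping time never takes effect and only the cap at N
  remains.\<close>

lemma chain_step: "\<sigma> (Suc n) = min (next_jump C (\<sigma> n) \<omega>) N"
proof -
  have "C (next_jump C (\<sigma> n) \<omega>) \<omega> \<notin> {1, C (\<sigma> n) \<omega>}"
    using increase[of n] path_state[OF chain_range(1), of n] by auto
  then show ?thesis by (auto simp: step exit_time_def min_def)
qed

lemma chain_next_jump_gt: "\<sigma> n < next_jump C (\<sigma> n) \<omega>"
  using next_jump_ge[OF chain_range(1), of n] increase[of n] by (cases "\<sigma> n = next_jump C (\<sigma> n) \<omega>") auto

lemma chain_constant: "\<sigma> n \<le> u \<Longrightarrow> u < next_jump C (\<sigma> n) \<omega> \<Longrightarrow> C u \<omega> = C (\<sigma> n) \<omega>"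
  by (rule constant_before_next_jump)

lemma chain_less: "\<sigma> n < N \<Longrightarrow> \<sigma> n < \<sigma> (Suc n)"
  using chain_next_jump_gt[of n] by (simp add: chain_step)

lemma chain_mono: "m \<le> n \<Longrightarrow> \<sigma> m \<le> \<sigma> n"
proof (rule lift_Suc_mono_le[of \<sigma>])
  show "\<sigma> n \<le> \<sigma> (Suc n)" for n
    using chain_next_jump_gt[of n] chain_range(2)[of n] by (simp add: chain_step)
qed

text \<open>Each jump before N raises the state by at least 1, starting from at least 1. This growth
  is what later sends powers of a number below 1 to 0.\<close>

lemma chain_state: "\<sigma> n < N \<Longrightarrow> Suc n \<le> C (\<sigma> n) \<omega>"
proof (induction n)
  case 0
  show ?case using path_state[OF start(1)] by simp
next
  case (Suc n)
  have "\<sigma> n < N" using chain_mono[of n "Suc n"] Suc.prems by simp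
  moreover have "\<sigma> (Suc n) = next_jump C (\<sigma> n) \<omega>"
    using Suc.prems by (simp add: chain_step min_def split: if_splits)
  ultimately show ?case using Suc.IH increase[of n] by simp
qed

text \<open>Finitely many jumps cover the interval. At a jump the new state exceeds 1, and between
  jumps the state is constant, so a visit to 1 is preceded by a stretch spent at 1 and is not an
  explosion.\<close>

lemma no_explosion:
  assumes y: "y < N" and n: "y < \<sigma> n"
  shows "\<not> explodes_during C \<omega> {\<sigma> 0<..y}"
proof
  assume "explodes_during C \<omega> {\<sigma> 0<..y}"
  then obtain t where ty: "\<sigma> 0 < t" "t \<le> y" and "explodes_at C \<omega> t"
    by (auto simp: explodes_during_def)
  then obtain e where t: "\<sigma> 0 < t" "t \<le> y" "C t \<omega> = 1" "e > 0"
    and ne: "\<And>u. u \<in> {t - e<..<t} \<Longrightarrow> u \<ge> 0 \<Longrightarrow> C u \<omega> \<noteq> 1"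
    unfolding explodes_at_def by blast
  define m where "m = (LEAST m. t \<le> \<sigma> m)"
  have m: "t \<le> \<sigma> m" unfolding m_def by (rule LeastI[of _ n]) (use t n in simp)
  then have "m \<noteq> 0" using t(1) by (metis not_le)
  then obtain k where k: "m = Suc k" by (cases m) auto
  have less: "\<sigma> k < t"
    using not_less_Least[of k "\<lambda>m. t \<le> \<sigma> m"] k by (simp add: m_def)
  have le: "t \<le> next_jump C (\<sigma> k) \<omega>"
    using m k by (simp add: chain_step)
  show False
  proof (cases "t = next_jump C (\<sigma> k) \<omega>")
    case True
    then show False using increase[of k] t(3) path_state[OF chain_range(1), of k] by simp
  next
    case False
    obtain u where u: "max (\<sigma> k) (t - e) < u" "u < t"
      using dense[of "max (\<sigma> k) (t - e)" t] less t(4) by auto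
    have "C u \<omega> = C (\<sigma> k) \<omega>"
      by (rule chain_constant) (use u le in simp_all)
    moreover have "C t \<omega> = C (\<sigma> k) \<omega>"
      by (rule chain_constant) (use le False less in simp_all)
    moreover have "C u \<omega> \<noteq> 1"
      by (rule ne) (use u chain_range(1)[of k] in simp_all)
    ultimately show False using t(3) by simp
  qed
qed

text \<open>Times that never reach N keep increasing strictly, so they converge to some S at most y.
  The path is not constant on any left neighbourhood of S, which places it at 1 there, while the
  growing states exclude 1 just before.\<close>

lemma explosion:
  assumes y: "y < N" and le: "\<And>n. \<sigma> n \<le> y"
  shows "explodes_during C \<omega> {\<sigma> 0<..y}"
proof -
  have less: "\<sigma> n < \<sigma> (Suc n)" for n
    by (rule chain_less) (use le[of n] y in simp)
  have bdd: "bdd_above (range \<sigma>)" using le by (auto intro: bdd_aboveI[of _ y])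
  define S where "S = (SUP n. \<sigma> n)"
  have S_ge: "\<sigma> n \<le> S" for n unfolding S_def by (rule cSUP_upper[OF _ bdd]) simp
  have S_gt: "\<sigma> n < S" for n using less[of n] S_ge[of "Suc n"] by simp
  have S_le: "S \<le> y" unfolding S_def by (rule cSUP_least) (use le in auto)
  have S_pos: "S > 0" using S_gt[of 0] start by simp
  have jump: "next_jump C (\<sigma> n) \<omega> = \<sigma> (Suc n)" for n
    using le[of "Suc n"] y by (simp add: chain_step min_def split: if_splits)
  have ex: "\<exists>n. s < \<sigma> n" if "s < S" for s
    using that unfolding S_def by (subst (asm) less_cSUP_iff) (use bdd in auto)
  have "C S \<omega> = 1"
  proof (rule path_accumulation[OF S_pos])
    fix s assume "0 \<le> s" "s < S"
    then obtain n where n: "s < \<sigma> n" using ex by blast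
    show "\<not> (\<lambda>u. C u \<omega>) constant_on {s<..<S}"
    proof
      assume "(\<lambda>u. C u \<omega>) constant_on {s<..<S}"
      then obtain c where "\<And>u. u \<in> {s<..<S} \<Longrightarrow> C u \<omega> = c" by (auto simp: constant_on_def)
      then have "C (\<sigma> n) \<omega> = c" "C (\<sigma> (Suc n)) \<omega> = c"
        using n S_gt less[of n] by auto
      then show False using increase[of n] by (simp add: jump)
    qed
  qed
  \<comment> \<open>The window starts at \<open>\<sigma> 1\<close>: the initial state may be 1, but
    every state from the first jump on is at least 2.\<close>
  moreover have "C u \<omega> \<noteq> 1" if u: "u \<in> {S - (S - \<sigma> 1)<..<S}" for u
  proof -
    have "\<exists>n. u < \<sigma> n" using u ex by auto
    define m where "m = (LEAST n. u < \<sigma> n)"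
    have m: "u < \<sigma> m" unfolding m_def using \<open>\<exists>n. u < \<sigma> n\<close> by (rule LeastI_ex)
    have "\<not> m \<le> 1" using chain_mono[of m 1] m u by auto
    then obtain k where k: "m = Suc k" "k \<ge> 1" by (cases m) auto
    have "\<sigma> k \<le> u" using not_less_Least[of k "\<lambda>n. u < \<sigma> n"] k by (simp add: m_def)
    then have "C u \<omega> = C (\<sigma> k) \<omega>" using m k by (intro chain_constant) (auto simp: jump)
    moreover have "Suc k \<le> C (\<sigma> k) \<omega>" by (rule chain_state) (use le[of k] y in simp)
    ultimately show ?thesis using k by simp
  qed
  ultimately have "explodes_at C \<omega> S"
    unfolding explodes_at_def using S_pos S_gt[of 1] by (intro conjI exI[of _ "S - \<sigma> 1"]) auto
  then show ?thesis using S_gt[of 0] S_le by (auto simp: explodes_during_def)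
qed

end

primrec jump_times :: "(real \<Rightarrow> 'w \<Rightarrow> nat) \<Rightarrow> real \<Rightarrow> real \<Rightarrow> nat \<Rightarrow> 'w \<Rightarrow> real" where
  "jump_times C N s 0 \<omega> = s"
| "jump_times C N s (Suc n) \<omega> = exit_time C N (jump_times C N s n \<omega>) \<omega>"

context tagged_forest_fire
begin

lemma finite_stopping_time_jump_times:
  assumes "0 \<le> s" "0 \<le> N"
  shows "finite_stopping_time M C (jump_times C N s n)"
proof (induction n)
  case 0
  have "jump_times C N s 0 = (\<lambda>\<omega>. s)" by (rule ext) simp
  then show ?case using assms by (simp add: finite_stopping_time_def stopping_time_const)
next
  case (Suc n)
  have "jump_times C N s (Suc n) = (\<lambda>\<omega>. exit_time C N (jump_times C N s n \<omega>) \<omega>)"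
    by (rule ext) simp
  then show ?case using finite_stopping_time_exit[OF Suc assms(2)] by simp
qed

lemma AE_jump_chain:
  assumes s: "0 \<le> s" "s \<le> N"
  shows "AE \<omega> in M. E_jump_chain C \<omega> (\<lambda>n. jump_times C N s n \<omega>) N"
proof -
  have "AE \<omega> in M. \<forall>n. C (jump_times C N s n \<omega>) \<omega> < C (next_jump C (jump_times C N s n \<omega>) \<omega>) \<omega>"
    unfolding AE_all_countable
    by (intro allI AE_jump_increases finite_stopping_time_jump_times) (use s in auto)
  then show ?thesis
    using AE_space
  proof eventually_elim
    case (elim \<omega>)
    show ?case
      by (intro E_jump_chain.intro E_path[OF elim(2)] E_jump_chain_axioms.intro) (use elim(1) s in auto)
  qed
qed

text \<open>Capping at N is harmless because N is at least y: from N on the characteristic equals 1,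
  so the capped and the uncapped time both contribute the value 1.\<close>

lemma nn_integral_jump_times:
  assumes char: "is_characteristic v y \<phi>" and s: "0 \<le> s" "s \<le> N" and y: "y \<le> N"
  shows "(\<integral>\<^sup>+\<omega>. ennreal (\<phi> (jump_times C N s n \<omega>) ^ C (jump_times C N s n \<omega>) \<omega>) \<partial>M)
    = (\<integral>\<^sup>+\<omega>. ennreal (\<phi> s ^ C s \<omega>) \<partial>M)"
proof (induction n)
  case (Suc n)
  let ?\<sigma> = "jump_times C N s"
  have one: "\<phi> t = 1" if "t \<ge> N" for t
    using char that s y by (simp add: is_characteristic_def)
  have "(\<integral>\<^sup>+\<omega>. ennreal (\<phi> (?\<sigma> (Suc n) \<omega>) ^ C (?\<sigma> (Suc n) \<omega>) \<omega>) \<partial>M)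
      = (\<integral>\<^sup>+\<omega>. ennreal (\<phi> (next_jump C (?\<sigma> n \<omega>) \<omega>) ^ C (next_jump C (?\<sigma> n \<omega>) \<omega>) \<omega>) \<partial>M)"
  proof (rule nn_integral_cong_AE)
    show "AE \<omega> in M. ennreal (\<phi> (?\<sigma> (Suc n) \<omega>) ^ C (?\<sigma> (Suc n) \<omega>) \<omega>)
        = ennreal (\<phi> (next_jump C (?\<sigma> n \<omega>) \<omega>) ^ C (next_jump C (?\<sigma> n \<omega>) \<omega>) \<omega>)"
      using AE_jump_chain[OF s]
    proof eventually_elim
      case (elim \<omega>)
      then have "?\<sigma> (Suc n) \<omega> = min (next_jump C (?\<sigma> n \<omega>) \<omega>) N"
        by (rule E_jump_chain.chain_step)
      then show ?case
        by (cases "next_jump C (?\<sigma> n \<omega>) \<omega> \<le> N") (simp_all add: one min_def del: jump_times.simps)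
    qed
  qed
  also have "\<dots> = (\<integral>\<^sup>+\<omega>. ennreal (\<phi> (?\<sigma> n \<omega>) ^ C (?\<sigma> n \<omega>) \<omega>) \<partial>M)"
    by (rule nn_integral_next_jump[OF finite_stopping_time_jump_times char]) (use s in auto)
  finally show ?case using Suc.IH by simp
qed simp

section \<open>Bounds for the probability of no explosion\<close>

abbreviation exploded :: "real \<Rightarrow> real \<Rightarrow> 'w set" where
  "exploded s y \<equiv> {\<omega> \<in> space M. explodes_during C \<omega> {s<..y}}"

lemma sets_explodes_during_half_open:
  assumes s: "0 \<le> s"
  shows "exploded s y \<in> sets M"
proof -
  have "exploded s y
      = (\<Union>n::nat. {\<omega> \<in> space M. explodes_during C \<omega> {s + inverse (real (Suc n))..y}})"
  proof (intro set_eqI iffI)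
    fix \<omega> assume "\<omega> \<in> exploded s y"
    then obtain t where t: "\<omega> \<in> space M" "s < t" "t \<le> y" "explodes_at C \<omega> t"
      by (auto simp: explodes_during_def)
    obtain n where "inverse (real (Suc n)) < t - s"
      using reals_Archimedean[of "t - s"] t by auto
    then show "\<omega> \<in> (\<Union>n::nat. {\<omega> \<in> space M. explodes_during C \<omega> {s + inverse (real (Suc n))..y}})"
      using t by (auto simp: explodes_during_def intro!: exI[of _ n] bexI[of _ t])
  next
    fix \<omega> assume "\<omega> \<in> (\<Union>n::nat. {\<omega> \<in> space M. explodes_during C \<omega> {s + inverse (real (Suc n))..y}})"
    then obtain n t where t: "\<omega> \<in> space M" "s + inverse (real (Suc n)) \<le> t" "t \<le> y" "explodes_at C \<omega> t"
      by (auto simp: explodes_during_def)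
    have "inverse (real (Suc n)) > 0" by simp
    then have "t \<in> {s<..y}" using t(2,3) by (simp del: of_nat_Suc inverse_positive_iff_positive)
    then show "\<omega> \<in> exploded s y"
      using t by (auto simp: explodes_during_def)
  qed
  also have "\<dots> \<in> sets M"
    by (intro sets.countable_UN image_subsetI sets_explodes_during_Icc add_nonneg_nonneg s) simp
  finally show ?thesis .
qed

lemma characteristic_power_integrable:
  assumes char: "is_characteristic v y \<phi>" and \<sigma>: "finite_stopping_time M C \<sigma>"
  shows "integrable M (\<lambda>\<omega>. \<phi> (\<sigma> \<omega>) ^ C (\<sigma> \<omega>) \<omega>)"
    "\<omega> \<in> space M \<Longrightarrow> 0 \<le> \<phi> (\<sigma> \<omega>) ^ C (\<sigma> \<omega>) \<omega> \<and> \<phi> (\<sigma> \<omega>) ^ C (\<sigma> \<omega>) \<omega> \<le> 1"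
proof -
  note j = jump_measurable[OF \<sigma>]
  have cont: "continuous_on {0..} \<phi>" and unit: "\<And>t. t \<ge> 0 \<Longrightarrow> \<phi> t \<in> {0<..1}"
    using char by (auto simp: is_characteristic_def)
  have unit': "0 \<le> \<phi> (\<sigma> \<omega>)" "\<phi> (\<sigma> \<omega>) \<le> 1" if "\<omega> \<in> space M" for \<omega>
    using unit[OF j(5)[OF that]] by auto
  show bound: "0 \<le> \<phi> (\<sigma> \<omega>) ^ C (\<sigma> \<omega>) \<omega> \<and> \<phi> (\<sigma> \<omega>) ^ C (\<sigma> \<omega>) \<omega> \<le> 1" if "\<omega> \<in> space M" for \<omega>
    using unit'[OF that] by (auto intro: power_le_one)
  have [measurable]: "(\<lambda>\<omega>. \<phi> (max 0 (\<sigma> \<omega>))) \<in> borel_measurable M"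
    by (rule measurable_compose[OF j(1) borel_measurable_continuous_nonneg[OF cont]])
  note [measurable] = j(2)
  have "(\<lambda>\<omega>. \<phi> (max 0 (\<sigma> \<omega>)) ^ C (\<sigma> \<omega>) \<omega>) \<in> borel_measurable M" by measurable
  then have meas: "(\<lambda>\<omega>. \<phi> (\<sigma> \<omega>) ^ C (\<sigma> \<omega>) \<omega>) \<in> borel_measurable M"
    by (rule iffD1[OF measurable_cong, rotated]) (use j(5) in \<open>simp add: max_def\<close>)
  show "integrable M (\<lambda>\<omega>. \<phi> (\<sigma> \<omega>) ^ C (\<sigma> \<omega>) \<omega>)"
    by (rule integrable_const_bound[where B = 1]) (use meas bound in auto)
qed

lemma Y_gf_jump_times:
  assumes char: "is_characteristic v y \<phi>" and s: "0 \<le> s" "s \<le> N" and y: "y \<le> N"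
  shows "Y_gf M C s (\<phi> s) = (LINT \<omega>|M. \<phi> (jump_times C N s n \<omega>) ^ C (jump_times C N s n \<omega>) \<omega>)"
proof -
  have st: "finite_stopping_time M C (jump_times C N s n)" for n
    by (rule finite_stopping_time_jump_times) (use s in auto)
  have nn: "ennreal (LINT \<omega>|M. \<phi> (jump_times C N s n \<omega>) ^ C (jump_times C N s n \<omega>) \<omega>)
      = (\<integral>\<^sup>+\<omega>. ennreal (\<phi> s ^ C s \<omega>) \<partial>M)" for n
    unfolding nn_integral_jump_times[OF char s y, of n, symmetric]
    by (rule nn_integral_eq_integral[symmetric, OF characteristic_power_integrable(1)[OF char st]])
      (intro AE_I2 conjunct1[OF characteristic_power_integrable(2)[OF char st]])
  have nonneg: "0 \<le> (LINT \<omega>|M. \<phi> (jump_times C N s n \<omega>) ^ C (jump_times C N s n \<omega>) \<omega>)" for n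
    by (intro integral_nonneg_AE AE_I2 conjunct1[OF characteristic_power_integrable(2)[OF char st]])
  show ?thesis
    using nn[of 0, folded nn[of n]] nonneg[of 0] nonneg[of n] unfolding Y_gf_def by simp
qed

text \<open>Once the jump times have passed y the integrand equals 1, and almost surely they do pass
  y unless an explosion in (s,y] stops them.\<close>

lemma no_explosion_le_Y_gf:
  assumes char: "is_characteristic v y \<phi>" and s: "0 \<le> s" "s < y"
  shows "1 - prob (exploded s y) \<le> Y_gf M C s (\<phi> s)"
proof -
  \<comment> \<open>The cap must lie strictly beyond y, as otherwise no jump time could be seen to
    pass y.\<close>
  define N where "N = y + 1"
  have N: "0 \<le> s" "s \<le> N" "y \<le> N" "y < N" using s by (auto simp: N_def)
  let ?\<sigma> = "jump_times C N s"
  have st: "finite_stopping_time M C (?\<sigma> n)" for n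
    by (rule finite_stopping_time_jump_times) (use N in auto)
  have [measurable]: "?\<sigma> n \<in> borel_measurable M" for n
    by (rule jump_measurable(1)[OF st])
  \<comment> \<open>The quantifier over m makes \<open>A\<close> increasing at every sample point;
    monotonicity of the jump times themselves holds only almost surely.\<close>
  define A where "A n = {\<omega> \<in> space M. \<exists>m\<le>n. y < ?\<sigma> m \<omega>}" for n
  have A: "A n \<in> sets M" for n unfolding A_def by measurable
  have le: "prob (A n) \<le> Y_gf M C s (\<phi> s)" for n
  proof -
    have "prob (A n) = (LINT \<omega>|M. indicat_real (A n) \<omega>)" using A by simp
    also have "\<dots> \<le> (LINT \<omega>|M. \<phi> (?\<sigma> n \<omega>) ^ C (?\<sigma> n \<omega>) \<omega>)"
    proof (rule integral_mono_AE)
      show "AE \<omega> in M. indicat_real (A n) \<omega> \<le> \<phi> (?\<sigma> n \<omega>) ^ C (?\<sigma> n \<omega>) \<omega>"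
        using AE_jump_chain[OF N(1,2)] AE_space
      proof eventually_elim
        case (elim \<omega>)
        show ?case
        proof (cases "\<omega> \<in> A n")
          case True
          then obtain m where "m \<le> n" "y < ?\<sigma> m \<omega>" by (auto simp: A_def)
          then have "y < ?\<sigma> n \<omega>" using E_jump_chain.chain_mono[OF elim(1), of m n] by simp
          then have "\<phi> (?\<sigma> n \<omega>) = 1" using char s by (simp add: is_characteristic_def)
          then show ?thesis by (simp add: indicator_def)
        next
          case False
          then show ?thesis
            using characteristic_power_integrable(2)[OF char st elim(2)] by simp
        qed
      qed
      show "integrable M (indicat_real (A n))"
        by (rule integrable_real_indicator[OF A]) (simp add: emeasure_eq_measure)
    qed (rule characteristic_power_integrable(1)[OF char st])
    also have "\<dots> = Y_gf M C s (\<phi> s)" by (rule Y_gf_jump_times[OF char N(1,2,3), symmetric])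
    finally show ?thesis .
  qed
  have "(\<lambda>n. prob (A n)) \<longlonglongrightarrow> prob (\<Union>n. A n)"
  proof (rule finite_Lim_measure_incseq)
    show "incseq A" by (auto simp: incseq_def A_def intro: order_trans)
  qed (use A in auto)
  then have "prob (\<Union>n. A n) \<le> Y_gf M C s (\<phi> s)"
    by (rule LIMSEQ_le_const2) (use le in auto)
  moreover have "prob (space M - exploded s y) \<le> prob (\<Union>n. A n)"
  proof (rule finite_measure_mono_AE)
    show "AE \<omega> in M. \<omega> \<in> space M - exploded s y \<longrightarrow> \<omega> \<in> (\<Union>n. A n)"
      using AE_jump_chain[OF N(1,2)]
    proof eventually_elim
      case (elim \<omega>)
      show ?case
      proof
        assume \<omega>: "\<omega> \<in> space M - exploded s y"
        then have "\<not> (\<forall>n. ?\<sigma> n \<omega> \<le> y)"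
          using E_jump_chain.explosion[OF elim N(4)] by auto
        then obtain n where "y < ?\<sigma> n \<omega>" by (auto simp: not_le)
        then have "\<omega> \<in> A n" using \<omega> by (auto simp: A_def)
        then show "\<omega> \<in> (\<Union>n. A n)" by blast
      qed
    qed
  qed (use A in auto)
  ultimately show ?thesis
    using prob_compl[OF sets_explodes_during_half_open[OF s(1), of y]] by simp
qed

text \<open>If the n-th time has not passed a, the state exceeds n and the base is at most
  \<phi>(a), so the value is at most \<phi>(a)^n. If it has, the value is at most 1 and there is no
  explosion in (s,a]. The strict inequality a < y makes \<phi>(a) < 1, so the first contribution
  vanishes as n grows.\<close>

lemma Y_gf_le_no_explosion:
  assumes char: "is_characteristic v y \<phi>" and s: "0 \<le> s" and a: "a < y" "s \<le> a"
  shows "Y_gf M C s (\<phi> s) \<le> 1 - prob (exploded s a)"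
proof -
  have N: "0 \<le> s" "s \<le> y" "y \<le> y" "a < y" using s a by auto
  let ?\<sigma> = "jump_times C y s"
  have st: "finite_stopping_time M C (?\<sigma> n)" for n
    by (rule finite_stopping_time_jump_times) (use N in auto)
  define E where "E = exploded s a"
  have E: "E \<in> sets M" unfolding E_def by (rule sets_explodes_during_half_open[OF s])
  have ind: "integrable M (indicat_real (space M - E))"
    by (rule integrable_real_indicator) (use E in \<open>auto simp: emeasure_eq_measure\<close>)
  have \<phi>a: "0 \<le> \<phi> a" "\<phi> a < 1" using char a s by (auto simp: is_characteristic_def less_imp_le)
  have "Y_gf M C s (\<phi> s) \<le> (1 - prob E) + \<phi> a ^ n" for n
  proof -
    have "Y_gf M C s (\<phi> s) = (LINT \<omega>|M. \<phi> (?\<sigma> n \<omega>) ^ C (?\<sigma> n \<omega>) \<omega>)"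
      by (rule Y_gf_jump_times[OF char N(1,2,3)])
    also have "\<dots> \<le> (LINT \<omega>|M. indicat_real (space M - E) \<omega> + \<phi> a ^ n)"
    proof (rule integral_mono_AE)
      show "AE \<omega> in M. \<phi> (?\<sigma> n \<omega>) ^ C (?\<sigma> n \<omega>) \<omega> \<le> indicat_real (space M - E) \<omega> + \<phi> a ^ n"
        using AE_jump_chain[OF N(1,2)] AE_space
      proof eventually_elim
        case (elim \<omega>)
        interpret E_jump_chain C \<omega> "\<lambda>n. ?\<sigma> n \<omega>" y by (rule elim(1))
        note b = characteristic_power_integrable(2)[OF char st elim(2), of n]
        show ?case
        proof (cases "?\<sigma> n \<omega> \<le> a")
          case True
          then have "Suc n \<le> C (?\<sigma> n \<omega>) \<omega>" using chain_state[of n] a by simp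
          have mono: "\<phi> (?\<sigma> n \<omega>) \<le> \<phi> a"
            by (rule characteristic_mono[OF char chain_range(1) True])
          have pos: "0 \<le> \<phi> (?\<sigma> n \<omega>)"
            using char chain_range(1)[of n] by (auto simp: is_characteristic_def less_imp_le)
          have "\<phi> (?\<sigma> n \<omega>) ^ C (?\<sigma> n \<omega>) \<omega> \<le> \<phi> a ^ C (?\<sigma> n \<omega>) \<omega>"
            by (rule power_mono[OF mono pos])
          also have "\<dots> \<le> \<phi> a ^ n"
            using \<open>Suc n \<le> C (?\<sigma> n \<omega>) \<omega>\<close> \<phi>a by (intro power_decreasing) auto
          finally show ?thesis by (simp add: add_increasing)
        next
          case False
          then have "\<omega> \<in> space M - E"
            using no_explosion[OF N(4), of n] elim(2) by (auto simp: E_def)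
          then show ?thesis using b \<phi>a by (simp add: add_increasing2)
        qed
      qed
      show "integrable M (\<lambda>\<omega>. indicat_real (space M - E) \<omega> + \<phi> a ^ n)"
        using ind by simp
    qed (rule characteristic_power_integrable(1)[OF char st])
    also have "\<dots> = prob (space M - E) + \<phi> a ^ n"
      using ind E by (subst Bochner_Integration.integral_add) (simp_all add: prob_space)
    finally show ?thesis using prob_compl[OF E] by simp
  qed
  moreover have "(\<lambda>n. (1 - prob E) + \<phi> a ^ n) \<longlonglongrightarrow> (1 - prob E) + 0"
    using \<phi>a by (intro tendsto_intros LIMSEQ_power_zero) auto
  ultimately have "Y_gf M C s (\<phi> s) \<le> (1 - prob E) + 0"
    by (intro LIMSEQ_le_const) auto
  then show ?thesis by (simp add: E_def)
qed

lemma Y_gf_LIMSEQ: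
  assumes z: "z \<longlonglongrightarrow> w" and unit: "\<And>n. 0 \<le> z n \<and> z n \<le> 1" and s: "0 \<le> s"
  shows "(\<lambda>n. Y_gf M C s (z n)) \<longlonglongrightarrow> Y_gf M C s w"
  unfolding Y_gf_def
proof (rule integral_dominated_convergence[where w = "\<lambda>_. 1"])
  note [measurable] = measurable_C[OF s]
  show "(\<lambda>\<omega>. w ^ C s \<omega>) \<in> borel_measurable M" "(\<lambda>\<omega>. z n ^ C s \<omega>) \<in> borel_measurable M" for n
    by measurable
  show "AE \<omega> in M. (\<lambda>n. z n ^ C s \<omega>) \<longlonglongrightarrow> w ^ C s \<omega>"
    by (intro AE_I2 tendsto_intros z)
  show "AE \<omega> in M. norm (z n ^ C s \<omega>) \<le> 1" for n
    using unit[of n] by (intro AE_I2) (simp add: power_le_one)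
qed simp

end

section \<open>Explosion probabilities along the whole family of characteristics\<close>

locale tagged_forest_fire_characteristics =
  forest_fire_characteristics p v \<psi> + tagged_forest_fire p v M C
  for p v \<psi> and M :: "'w measure" and C
begin

text \<open>For the upper bound y itself serves as the intermediate time of a curve with end point
  \<open>z n\<close> > y; letting \<open>z n\<close> decrease to y brings back
  \<open>\<psi> y\<close>.\<close>

lemma Y_gf_eq_no_explosion:
  assumes y: "y > T_gel p" and s: "0 \<le> s" "s < y"
  shows "Y_gf M C s (\<psi> y s) = 1 - prob (exploded s y)"
proof (rule antisym)
  define z where "z n = y + inverse (real (Suc n))" for n
  have z_gt: "z n > y" for n by (simp add: z_def)
  have dec: "decseq z"
    unfolding z_def decseq_def by (auto intro!: le_imp_inverse_le)
  have "z \<longlonglongrightarrow> y + 0"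
    unfolding z_def by (intro tendsto_intros LIMSEQ_inverse_real_of_nat)
  then have "(\<lambda>n. \<psi> (z n) s) \<longlonglongrightarrow> \<psi> y s"
    using psi_limit_decseq[OF y dec _ s(1)] by simp
  then have lim: "(\<lambda>n. Y_gf M C s (\<psi> (z n) s)) \<longlonglongrightarrow> Y_gf M C s (\<psi> y s)"
    by (rule Y_gf_LIMSEQ) (use psi_bounds[OF less_trans[OF y z_gt] s(1)] s(1) in \<open>auto intro: less_imp_le\<close>)
  show "Y_gf M C s (\<psi> y s) \<le> 1 - prob (exploded s y)"
  proof (rule LIMSEQ_le_const2[OF lim])
    show "\<exists>N. \<forall>n\<ge>N. Y_gf M C s (\<psi> (z n) s) \<le> 1 - prob (exploded s y)"
    proof (intro exI allI impI)
      fix n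
      show "Y_gf M C s (\<psi> (z n) s) \<le> 1 - prob (exploded s y)"
        by (rule Y_gf_le_no_explosion[OF psi_characteristic s(1) z_gt])
          (use less_trans[OF y z_gt] s in auto)
    qed
  qed
  show "1 - prob (exploded s y) \<le> Y_gf M C s (\<psi> y s)"
    by (rule no_explosion_le_Y_gf[OF psi_characteristic[OF y] s])
qed

lemma sets_explodes_at: "{\<omega> \<in> space M. explodes_at C \<omega> y} \<in> sets M"
proof (cases "y \<ge> 0")
  case True
  have "{\<omega> \<in> space M. explodes_at C \<omega> y} = {\<omega> \<in> space M. explodes_during C \<omega> {y..y}}"
    by (simp add: explodes_during_def)
  then show ?thesis by (simp only: sets_explodes_during_Icc[OF True])
next
  case False
  then have "{\<omega> \<in> space M. explodes_at C \<omega> y} = {}"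
    by (auto simp: explodes_at_def)
  then show ?thesis by (simp only: sets.empty_sets)
qed

text \<open>An explosion at y with none in (s,y) is counted in (s,y] but in none of the intervals
  (s, \<open>z n\<close>] with \<open>z n\<close> increasing to y. The difference of these
  probabilities tends to 0 because they are expressed through Y and \<open>\<psi>\<close> is
  continuous in its end point.\<close>

lemma AE_first_explosion_ne:
  assumes y: "y > T_gel p" and s: "0 \<le> s" "s < y"
  shows "AE \<omega> in M. explodes_at C \<omega> y \<longrightarrow> explodes_during C \<omega> {s<..<y}"
proof -
  \<comment> \<open>The approximating end points must exceed s and also \<open>T_gel p\<close>,
    below which no characteristic is given.\<close>
  define b where "b = max s (T_gel p)"
  \<comment> \<open>The shift to n + 2 makes the factor at most 1/2, so that already
    \<open>z 0\<close> lies above b.\<close>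
  define z where "z n = y - (y - b) * inverse (real (Suc (Suc n)))" for n
  have b: "b < y" "s \<le> b" "T_gel p \<le> b" using y s by (auto simp: b_def)
  have z_lt: "z n < y" for n using b by (simp add: z_def)
  have z_gt: "b < z n" for n
  proof -
    have "(y - b) * inverse (real (Suc (Suc n))) < (y - b) * 1"
      using b by (intro mult_strict_left_mono) (auto simp: inverse_less_1_iff)
    then show ?thesis by (simp add: z_def del: of_nat_Suc)
  qed
  have inc: "incseq z"
    unfolding z_def incseq_def using b
    by (auto intro!: mult_left_mono le_imp_inverse_le)
  have "z \<longlonglongrightarrow> y - (y - b) * 0"
    unfolding z_def by (intro tendsto_intros LIMSEQ_Suc[OF LIMSEQ_inverse_real_of_nat])
  then have zlim: "z \<longlonglongrightarrow> y" by simp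
  have gel: "z n > T_gel p" for n using z_gt[of n] b by simp
  have sz: "s < z n" for n using z_gt[of n] b by simp
  define e where "e a = prob (exploded s a)" for a
  have q: "e a = 1 - Y_gf M C s (\<psi> a s)" if "a > T_gel p" "s < a" for a
    using Y_gf_eq_no_explosion[OF that(1) s(1) that(2)] by (simp add: e_def)
  have "(\<lambda>n. 1 - Y_gf M C s (\<psi> (z n) s)) \<longlonglongrightarrow> 1 - Y_gf M C s (\<psi> y s)"
    by (intro tendsto_intros Y_gf_LIMSEQ psi_limit_incseq[OF y inc zlim gel] s)
      (use psi_bounds[OF gel s(1)] in \<open>auto intro: less_imp_le\<close>)
  then have elim: "(\<lambda>n. e y - e (z n)) \<longlonglongrightarrow> e y - e y"
    by (intro tendsto_intros) (simp add: q[OF gel sz] q[OF y s(2)])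
  define W where "W n = {\<omega> \<in> space M. explodes_at C \<omega> y} - exploded s (z n)" for n
  have W: "W n \<in> sets M" for n
    unfolding W_def by (intro sets.Diff sets_explodes_at sets_explodes_during_half_open s)
  have "prob (\<Inter>n. W n) \<le> e y - e (z n)" for n
  proof -
    let ?A = "exploded s y" and ?B = "exploded s (z n)"
    have sets: "?A \<in> sets M" "?B \<in> sets M" by (intro sets_explodes_during_half_open s)+
    have sub: "?B \<subseteq> ?A" using z_lt[of n] by (auto simp: explodes_during_def intro: less_imp_le order_trans)
    have "prob (\<Inter>n. W n) \<le> prob (?A - ?B)"
    proof (rule finite_measure_mono)
      show "(\<Inter>n. W n) \<subseteq> ?A - ?B"
        using s by (auto simp: W_def explodes_during_def)
    qed (use sets in auto)
    also have "\<dots> = e y - e (z n)"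
      unfolding e_def by (rule finite_measure_Diff[OF sets sub])
    finally show ?thesis .
  qed
  then have "prob (\<Inter>n. W n) \<le> e y - e y"
    by (intro LIMSEQ_le_const[OF elim]) auto
  then have "prob (\<Inter>n. W n) = 0" by (simp add: measure_le_0_iff)
  then have "AE \<omega> in M. \<omega> \<notin> (\<Inter>n. W n)"
    using W by (subst (asm) prob_eq_0) (auto intro!: sets.countable_INT)
  then show ?thesis
    using AE_space
  proof eventually_elim
    case (elim \<omega>)
    show ?case
    proof
      assume "explodes_at C \<omega> y"
      then obtain n where "explodes_during C \<omega> {s<..z n}"
        using elim by (auto simp: W_def)
      then show "explodes_during C \<omega> {s<..<y}"
        using z_lt[of n] by (auto simp: explodes_during_def intro: le_less_trans)
    qed
  qed
qed

text \<open>Just before an explosion at y the path avoids 1, so for a rational s close enough to y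
  there is no explosion in (s,y). Countably many exceptional null sets therefore suffice.\<close>

lemma AE_not_explodes_at:
  assumes y: "y > T_gel p"
  shows "AE \<omega> in M. \<not> explodes_at C \<omega> y"
proof -
  have "AE \<omega> in M. \<forall>s\<in>\<rat> \<inter> {0..<y}. explodes_at C \<omega> y \<longrightarrow> explodes_during C \<omega> {s<..<y}"
    by (subst AE_ball_countable[OF countable_Rats_Int]) (use AE_first_explosion_ne[OF y] in auto)
  then show ?thesis
  proof eventually_elim
    case (elim \<omega>)
    show ?case
    proof
      assume ex: "explodes_at C \<omega> y"
      then obtain e where e: "e > 0" "y > 0" "\<And>u. u \<in> {y - e<..<y} \<Longrightarrow> u \<ge> 0 \<Longrightarrow> C u \<omega> \<noteq> 1"
        unfolding explodes_at_def by blast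
      obtain s where s: "s \<in> \<rat>" "max 0 (y - e) < s" "s < y"
        using Rats_dense_in_real[of "max 0 (y - e)" y] e by auto
      then have "explodes_during C \<omega> {s<..<y}" using elim ex by auto
      then obtain t where "s < t" "t < y" "C t \<omega> = 1"
        by (auto simp: explodes_during_def explodes_at_def)
      then show False using e(3)[of t] s by auto
    qed
  qed
qed

text \<open>Here \<open>T_gel p\<close> is the intermediate time of the curves with end points
  decreasing to it. Their initial values tend to 1 and Y_0(1) = 1, which leaves no room for an
  explosion.\<close>

lemma prob_explodes_until_T_gel: "prob {\<omega> \<in> space M. explodes_during C \<omega> {0..T_gel p}} = 0"
proof -
  define z where "z n = T_gel p + inverse (real (Suc n))" for n
  have z_gt: "z n > T_gel p" for n by (simp add: z_def)
  have "z \<longlonglongrightarrow> T_gel p + 0"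
    unfolding z_def by (intro tendsto_intros LIMSEQ_inverse_real_of_nat)
  then have "(\<lambda>n. \<psi> (z n) 0) \<longlonglongrightarrow> 1"
    using psi_initial_limit[OF z_gt] by simp
  then have lim: "(\<lambda>n. Y_gf M C 0 (\<psi> (z n) 0)) \<longlonglongrightarrow> Y_gf M C 0 1"
    by (rule Y_gf_LIMSEQ) (use psi_bounds[OF z_gt] in \<open>auto intro: less_imp_le\<close>)
  have "Y_gf M C 0 1 \<le> 1 - prob (exploded 0 (T_gel p))"
  proof (rule LIMSEQ_le_const2[OF lim])
    show "\<exists>N. \<forall>n\<ge>N. Y_gf M C 0 (\<psi> (z n) 0) \<le> 1 - prob (exploded 0 (T_gel p))"
      using Y_gf_le_no_explosion[OF psi_characteristic[OF z_gt] order_refl z_gt] T_gel_pos by auto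
  qed
  moreover have "Y_gf M C 0 1 = 1" by (simp add: Y_gf_def prob_space)
  \<comment> \<open>Explosion times are positive by definition, so including 0 changes
    nothing.\<close>
  moreover have "{\<omega> \<in> space M. explodes_during C \<omega> {0..T_gel p}} = exploded 0 (T_gel p)"
  proof (intro Collect_cong conj_cong refl)
    fix \<omega>
    show "explodes_during C \<omega> {0..T_gel p} \<longleftrightarrow> explodes_during C \<omega> {0<..T_gel p}"
      unfolding explodes_during_def
      by (metis atLeastAtMost_iff explodes_at_def greaterThanAtMost_iff less_imp_le)
  qed
  ultimately show ?thesis
    using measure_nonneg[of M "exploded 0 (T_gel p)"] by simp
qed

text \<open>Times up to \<open>T_gel p\<close> are covered by the third claim and later ones by the
  second; together they admit every left end point s.\<close>

lemma AE_not_explodes_at_any: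
  assumes "0 \<le> s"
  shows "AE \<omega> in M. \<not> explodes_at C \<omega> s"
proof (cases "s > T_gel p")
  case False
  have "AE \<omega> in M. \<not> explodes_during C \<omega> {0..T_gel p}"
    using prob_explodes_until_T_gel sets_explodes_during_Icc[of 0 "T_gel p"] AE_iff_measurable[OF _ refl]
    by (subst AE_iff_measurable[where N = "{\<omega> \<in> space M. explodes_during C \<omega> {0..T_gel p}}"])
      (auto simp: emeasure_eq_measure)
  then show ?thesis
  proof eventually_elim
    case (elim \<omega>)
    then show ?case using False assms by (auto simp: explodes_during_def)
  qed
qed (rule AE_not_explodes_at)

text \<open>Adding the left end point s to the half-open interval changes the event only by a null
  set.\<close>

lemma prob_not_explodes_during:
  assumes y: "y > T_gel p" and s: "0 \<le> s" "s < y"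
  shows "{\<omega> \<in> space M. \<not> explodes_during C \<omega> {s..y}} \<in> sets M"
    "Y_gf M C s (\<psi> y s) = prob {\<omega> \<in> space M. \<not> explodes_during C \<omega> {s..y}}"
proof -
  let ?A = "{\<omega> \<in> space M. explodes_during C \<omega> {s..y}}"
  let ?B = "exploded s y"
  have A: "?A \<in> sets M" and B: "?B \<in> sets M"
    using sets_explodes_during_Icc sets_explodes_during_half_open s by auto
  have eq: "{\<omega> \<in> space M. \<not> explodes_during C \<omega> {s..y}} = space M - ?A" by auto
  then show "{\<omega> \<in> space M. \<not> explodes_during C \<omega> {s..y}} \<in> sets M" using A by simp
  have "prob ?A = prob ?B"
  proof (rule finite_measure_eq_AE)
    show "AE \<omega> in M. \<omega> \<in> ?A \<longleftrightarrow> \<omega> \<in> ?B"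
      using AE_not_explodes_at_any[OF s(1)]
    proof eventually_elim
      case (elim \<omega>)
      have "explodes_during C \<omega> {s..y} \<longleftrightarrow> explodes_during C \<omega> {s<..y}"
        unfolding explodes_during_def using elim by (metis atLeastAtMost_iff greaterThanAtMost_iff le_less)
      then show ?case by simp
    qed
  qed (use A B in auto)
  then show "Y_gf M C s (\<psi> y s) = prob {\<omega> \<in> space M. \<not> explodes_during C \<omega> {s..y}}"
    unfolding eq prob_compl[OF A] using Y_gf_eq_no_explosion[OF y s] by simp
qed

end

theorem lemma3p10:
  fixes p :: "nat \<Rightarrow> real" and v :: "nat \<Rightarrow> real \<Rightarrow> real" and \<psi> :: "real \<Rightarrow> real \<Rightarrow> real"
    and M :: "'w measure" and C :: "real \<Rightarrow> 'w \<Rightarrow> nat"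
  assumes "\<And>l. l \<ge> 1 \<Longrightarrow> p l \<ge> 0"
    and "(p has_sum 1) {1..}"
    and "(\<lambda>l. real l ^ 3 * p l) summable_on {1..}"
    and "unique_forest_fire_solution p v"
    and "\<And>y. y > T_gel p \<Longrightarrow> unique_characteristic v y (\<psi> y)"
    and "tagged_cluster_process v M C"
  shows "(\<forall>y>T_gel p.
           (\<forall>s. 0 \<le> s \<and> s < y \<longrightarrow>
              {\<omega> \<in> space M. \<not> explodes_during C \<omega> {s..y}} \<in> sets M \<and>
              Y_gf M C s (\<psi> y s) = \<P>(\<omega> in M. \<not> explodes_during C \<omega> {s..y})) \<and>
           {\<omega> \<in> space M. explodes_at C \<omega> y} \<in> sets M \<and>
           \<P>(\<omega> in M. explodes_at C \<omega> y) = 0) \<and>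
         {\<omega> \<in> space M. explodes_during C \<omega> {0..T_gel p}} \<in> sets M \<and>
         \<P>(\<omega> in M. explodes_during C \<omega> {0..T_gel p}) = 0"
proof -
  interpret tagged_cluster_process v M C by (rule assms(6))
  interpret forest_fire p v
    by unfold_locales (use assms(4) in \<open>simp add: unique_forest_fire_solution_def\<close>)
  interpret tagged_forest_fire_characteristics p v \<psi> M C
    by unfold_locales (use assms in auto)
  have "prob {\<omega> \<in> space M. explodes_at C \<omega> y} = 0" if "y > T_gel p" for y
    using AE_not_explodes_at[OF that] by (subst prob_eq_0[OF sets_explodes_at]) auto
  then show ?thesis
    using prob_not_explodes_during sets_explodes_at sets_explodes_during_Icc[of 0 "T_gel p"]
      prob_explodes_until_T_gel by blast
qed

end
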